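(* Let $k\geq 2$ and let $n_1,\dots,n_k$ be $k$ distinct natural numbers, each at least $3$. 1. If $\prod_{i=1}^k n_i$ is even, then $D_\mathcal{G}(C_{n_1}\square\cdots\square C_{n_k})=\infty$ and $D_\mathcal{R}(C_{n_1}\square\cdots\square C_{n_k})=2$. 2. If $\prod_{i=1}^k n_i$ is odd, then $D_\mathcal{R}(C_{n_1}\square\cdots\square C_{n_k})=\infty$ and $D_\mathcal{G}(C_{n_1}\square\cdots\square C_{n_k})=2$.
   Context: $C_n$ is the cycle of order $n$ and $\square$ the Cartesian product of graphs. A coloring of a graph $X$ is distinguishing if the identity is its only color-preserving automorphism. The distinguishing game on $X$ with $d$ colors: Gentle and Rascal alternately choose an uncolored vertex and color it with one of the $d$ colors; when all vertices are colored, Gentle wins iff the coloring is distinguishing. $D_\mathcal{G}(X)$ (resp. $D_\mathcal{R}(X)$) is the least $d$ such that Gentle has a winning strategy with $d$ colors when Gentle (resp. Rascal) moves first, and $\infty$ if no such $d$ exists. *)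

theory Defs
  imports Main "HOL-Library.Extended_Nat"
begin

section \<open>Graphs\<close>

record 'a graph =
  verts :: "'a set"
  adj :: "'a \<Rightarrow> 'a \<Rightarrow> bool"

definition finite_simple_graph :: "'a graph \<Rightarrow> bool" where
  "finite_simple_graph X \<longleftrightarrow> finite (verts X) \<and>
     (\<forall>u v. adj X u v \<longrightarrow> u \<in> verts X \<and> v \<in> verts X \<and> u \<noteq> v \<and> adj X v u)"

definition cycle_graph :: "nat \<Rightarrow> nat graph" where
  "cycle_graph n = \<lparr>verts = {..<n},
     adj = (\<lambda>i j. i < n \<and> j < n \<and> (j = (i + 1) mod n \<or> i = (j + 1) mod n))\<rparr>"

text \<open>The Cartesian product of a list of graphs; its vertices are the lists whose \<open>i\<close>-th
  entry is a vertex of the \<open>i\<close>-th factor.\<close>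

definition cart_prod :: "'a graph list \<Rightarrow> 'a list graph" where
  "cart_prod Xs = (let V = {xs. length xs = length Xs \<and> (\<forall>i<length Xs. xs ! i \<in> verts (Xs ! i))} in
     \<lparr>verts = V,
      adj = (\<lambda>xs ys. xs \<in> V \<and> ys \<in> V \<and>
        (\<exists>i<length Xs. adj (Xs ! i) (xs ! i) (ys ! i) \<and>
           (\<forall>j<length Xs. j \<noteq> i \<longrightarrow> xs ! j = ys ! j)))\<rparr>)"

definition automorphism :: "'a graph \<Rightarrow> ('a \<Rightarrow> 'a) \<Rightarrow> bool" where
  "automorphism X f \<longleftrightarrow> bij_betw f (verts X) (verts X) \<and>
     (\<forall>u\<in>verts X. \<forall>v\<in>verts X. adj X (f u) (f v) \<longleftrightarrow> adj X u v)"

definition distinguishing :: "'a graph \<Rightarrow> ('a \<Rightarrow> 'c) \<Rightarrow> bool" where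
  "distinguishing X c \<longleftrightarrow>
     (\<forall>f. automorphism X f \<and> (\<forall>v\<in>verts X. c (f v) = c v) \<longrightarrow> (\<forall>v\<in>verts X. f v = v))"

lemma finite_simple_graph_cycle_graph:
  assumes "3 \<le> n"
  shows "finite_simple_graph (cycle_graph n)"
proof -
  have "(i + 1) mod n \<noteq> i" if "i < n" for i
    using assms that by (cases "i + 1 = n") auto
  then show ?thesis
    unfolding finite_simple_graph_def cycle_graph_def by fastforce
qed

lemma finite_simple_graph_cart_prod:
  assumes "\<forall>X\<in>set Xs. finite_simple_graph X"
  shows "finite_simple_graph (cart_prod Xs)"
proof -
  have fs: "finite_simple_graph (Xs ! i)" if "i < length Xs" for i
    using assms that by simp
  have "{xs. length xs = length Xs \<and> (\<forall>i<length Xs. xs ! i \<in> verts (Xs ! i))}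
      \<subseteq> {xs. set xs \<subseteq> (\<Union>X\<in>set Xs. verts X) \<and> length xs = length Xs}"
    by (fastforce simp: in_set_conv_nth)
  moreover have "finite (\<Union>X\<in>set Xs. verts X)"
    using assms by (auto simp: finite_simple_graph_def)
  ultimately have "finite (verts (cart_prod Xs))"
    by (simp add: cart_prod_def Let_def) (erule finite_subset, rule finite_lists_length_eq, simp)
  moreover have "u \<noteq> v \<and> adj (cart_prod Xs) v u" if uv: "adj (cart_prod Xs) u v" for u v
  proof -
    obtain i where i: "i < length Xs" "adj (Xs ! i) (u ! i) (v ! i)"
      "\<forall>j<length Xs. j \<noteq> i \<longrightarrow> u ! j = v ! j"
      using uv by (auto simp: cart_prod_def)
    have "u ! i \<noteq> v ! i" "adj (Xs ! i) (v ! i) (u ! i)"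
      using fs[OF i(1)] i(2) unfolding finite_simple_graph_def by blast+
    then show ?thesis
      using uv i by (auto simp: cart_prod_def)
  qed
  ultimately show ?thesis
    unfolding finite_simple_graph_def by (auto simp: cart_prod_def)
qed


section \<open>The distinguishing game\<close>

datatype player = Gentle | Rascal

fun opponent :: "player \<Rightarrow> player" where
  "opponent Gentle = Rascal"
| "opponent Rascal = Gentle"

text \<open>The player to move after \<open>m\<close> moves, if \<open>p\<close> moves first.\<close>

definition to_move :: "player \<Rightarrow> nat \<Rightarrow> player" where
  "to_move p m = (if even m then p else opponent p)"

text \<open>A history is the chronological list of the moves made so far; the move \<open>(v, c)\<close> gives
  vertex \<open>v\<close> the color \<open>c\<close>, and the \<open>d\<close> colors are \<open>0, \<dots>, d - 1\<close>.\<close>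

type_synonym 'a history = "('a \<times> nat) list"

definition legal_history :: "'a graph \<Rightarrow> nat \<Rightarrow> 'a history \<Rightarrow> bool" where
  "legal_history X d h \<longleftrightarrow> distinct (map fst h) \<and> set h \<subseteq> verts X \<times> {..<d}"

definition complete_play :: "'a graph \<Rightarrow> nat \<Rightarrow> 'a history \<Rightarrow> bool" where
  "complete_play X d h \<longleftrightarrow> legal_history X d h \<and> fst ` set h = verts X"

definition final_coloring :: "'a history \<Rightarrow> 'a \<Rightarrow> nat" where
  "final_coloring h v = the (map_of h v)"

definition gentle_strategy ::
    "'a graph \<Rightarrow> nat \<Rightarrow> player \<Rightarrow> ('a history \<Rightarrow> 'a \<times> nat) \<Rightarrow> bool" where
  "gentle_strategy X d p s \<longleftrightarrow>
     (\<forall>h. legal_history X d h \<and> \<not> complete_play X d h \<and> to_move p (length h) = Gentle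
        \<longrightarrow> legal_history X d (h @ [s h]))"

definition follows :: "player \<Rightarrow> ('a history \<Rightarrow> 'a \<times> nat) \<Rightarrow> 'a history \<Rightarrow> bool" where
  "follows p s h \<longleftrightarrow> (\<forall>m<length h. to_move p m = Gentle \<longrightarrow> h ! m = s (take m h))"

definition gentle_wins :: "'a graph \<Rightarrow> nat \<Rightarrow> player \<Rightarrow> bool" where
  "gentle_wins X d p \<longleftrightarrow>
     (\<exists>s. gentle_strategy X d p s \<and>
        (\<forall>h. complete_play X d h \<and> follows p s h \<longrightarrow> distinguishing X (final_coloring h)))"

text \<open>The restriction \<open>1 \<le> d\<close> matters: for \<open>d = 0\<close> and Rascal moving first there are no moves
  and no complete plays, so \<^const>\<open>gentle_wins\<close> would hold vacuously. The infimum of the empty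
  set is \<open>\<infinity>\<close>.\<close>

definition game_number :: "player \<Rightarrow> 'a graph \<Rightarrow> enat" where
  "game_number p X = Inf (enat ` {d. 1 \<le> d \<and> gentle_wins X d p})"

abbreviation D_G :: "'a graph \<Rightarrow> enat" where
  "D_G \<equiv> game_number Gentle"

abbreviation D_R :: "'a graph \<Rightarrow> enat" where
  "D_R \<equiv> game_number Rascal"

end

theory Submission
  imports Defs "HOL-Computational_Algebra.Primes" "HOL-Library.FuncSet"
begin

text \<open>
  The player who moves last wins. For Rascal this is a matter of copying: he repeats the color of
  Gentle's last move at its image under an involutive automorphism, which is half a turn of one
  cycle if the number of vertices is even, and the reflection of all cycles, whose fixed vertex he
  colors first, if it is odd.

  Gentle, too, answers in pairs of vertices, but chooses for each pair whether its two colors are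
  equal or different. As the lengths are distinct, every automorphism acts on each coordinate by
  a rotation or a reflection. If there is a cycle of even length, then pairing opposite vertices
  of that cycle works, the colors being different exactly in the pairs of the origin and of its
  neighbors. In the odd case there is a pairing for two cycles, one of them of length at least 9,
  and it can be extended by further cycles: in each new row, all vertices but one are paired up,
  so that the number of vertices of a color in the row determines the color of the remaining
  vertex. This leaves the cycles of length 3, 5 and 7, where pairings for two cycles are given
  explicitly. Only for lengths 3 and 5 Gentle uses more than a fixed pairing: on six of the
  vertices the answers depend on the course of the game.
\<close>

section \<open>Strategies from invariants\<close>

text \<open>Inside a pair Gentle controls only the relation between the two colors, because Rascal
  colors the first vertex. Asymmetry must therefore follow from these relations alone, however the
  pairs are filled; this is the notion \<open>rigid\<close>. Over the field with two elements, the
  relations together with invariance under a map \<open>f\<close> form a linear system. The map is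
  excluded as soon as some closed walk alternating between partners and \<open>f\<close> changes the
  color an odd number of times.

  Distinct lengths keep automorphisms from permuting coordinates, so that only a product of dihedral
  groups has to be broken.

  The bound 9 comes from the rows of dominoes. Such a row determines the center of a reflection only
  up to an error of 1 in \<open>t\<close>, and the rows are compared through shifts of 3, which
  change \<open>t\<close> by up to 6. So differences of absolute value up to 8 have to be nonzero
  modulo the length.\<close>

lemma to_move_cases [case_names to_move other]:
  obtains "to_move p n = q" "to_move p (Suc n) = opponent q"
  | "to_move p n = opponent q" "to_move p (Suc n) = q"
  by (cases p; cases q; cases "even n") (auto simp: to_move_def)

lemma to_move_0 [simp]: "to_move p 0 = p"
  by (simp add: to_move_def)

lemma opponent_neq [simp]: "opponent q \<noteq> q"
  by (cases q; simp)

lemma map_of_snoc: "v \<notin> fst ` set h \<Longrightarrow> map_of (h @ [(v, c)]) = (map_of h)(v \<mapsto> c)"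
  by (simp add: map_add_def map_of_eq_None_iff[symmetric] fun_eq_iff split: option.split)

lemma legal_history_snoc:
  "legal_history X d (h @ [(v, c)]) \<longleftrightarrow>
     legal_history X d h \<and> v \<in> verts X - dom (map_of h) \<and> c < d"
  by (auto simp: legal_history_def dom_map_of_conv_image_fst)

lemma legal_history_dom: "legal_history X d h \<Longrightarrow> dom (map_of h) \<subseteq> verts X"
  by (auto simp: legal_history_def dom_map_of_conv_image_fst)

lemma legal_history_ran: "legal_history X d h \<Longrightarrow> ran (map_of h) \<subseteq> {..<d}"
  by (auto simp: legal_history_def ran_def dest!: map_of_SomeD)

lemma complete_play_iff:
  "complete_play X d h \<longleftrightarrow> legal_history X d h \<and> dom (map_of h) = verts X"
  by (simp add: complete_play_def dom_map_of_conv_image_fst)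

text \<open>\<^term>\<open>T r m\<close> is a property of partial colorings \<^term>\<open>m\<close> with player \<^term>\<open>r\<close> to move.\<close>

definition can_keep :: "'a set \<Rightarrow> nat \<Rightarrow> player \<Rightarrow> (player \<Rightarrow> ('a \<rightharpoonup> nat) \<Rightarrow> bool) \<Rightarrow> bool" where
  "can_keep V d q T \<longleftrightarrow>
     (\<forall>m v c. T (opponent q) m \<and> v \<in> V - dom m \<and> c < d \<longrightarrow> T q (m(v \<mapsto> c))) \<and>
     (\<forall>m. T q m \<and> dom m \<subset> V \<longrightarrow> (\<exists>v\<in>V - dom m. \<exists>c<d. T (opponent q) (m(v \<mapsto> c))))"

text \<open>The strategy chooses in each history some move that keeps the invariant. By induction
  along the history, \<open>T\<close> then holds throughout every play that follows it, so later
  arguments speak of partial colorings only.\<close>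

lemma gentle_wins_if_can_keep:
  assumes keep: "can_keep (verts X) d Gentle T" and start: "T p Map.empty" and d: "1 \<le> d"
    and final: "\<And>r m. T r m \<Longrightarrow> dom m = verts X \<Longrightarrow> ran m \<subseteq> {..<d} \<Longrightarrow>
       distinguishing X (\<lambda>v. the (m v))"
  shows "gentle_wins X d p"
proof -
  define good where
    "good h x \<longleftrightarrow> legal_history X d (h @ [x]) \<and> T Rascal (map_of (h @ [x]))" for h x
  \<comment> \<open>\<open>gentle_strategy\<close> asks for a legal move in every incomplete
    history, also in those without a good move; the second branch serves these.\<close>
  define s where "s h = (if \<exists>x. good h x then SOME x. good h x
     else SOME x. legal_history X d (h @ [x]))" for h
  have good: "\<exists>x. good h x"
    if leg: "legal_history X d h" and inc: "\<not> complete_play X d h" and T: "T Gentle (map_of h)" for h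
  proof -
    have "dom (map_of h) \<subset> verts X"
      using leg inc legal_history_dom[OF leg] by (auto simp: complete_play_iff)
    then obtain v c where "v \<in> verts X - dom (map_of h)" "c < d" "T Rascal ((map_of h)(v \<mapsto> c))"
      using keep T unfolding can_keep_def by (metis opponent.simps(1))
    then have "good h (v, c)"
      using leg map_of_snoc[of v h c]
      by (simp add: good_def legal_history_snoc dom_map_of_conv_image_fst del: map_of_append)
    then show ?thesis ..
  qed
  have "gentle_strategy X d p s"
    unfolding gentle_strategy_def
  proof (intro allI impI)
    fix h assume h: "legal_history X d h \<and> \<not> complete_play X d h \<and> to_move p (length h) = Gentle"
    show "legal_history X d (h @ [s h])"
    proof (cases "\<exists>x. good h x")
      case True
      then have "good h (s h)" by (simp add: s_def someI_ex)
      then show ?thesis by (simp add: good_def)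
    next
      case False
      obtain v where "v \<in> verts X - dom (map_of h)"
        using h legal_history_dom[of X d h] by (auto simp: complete_play_iff)
      then have "legal_history X d (h @ [(v, 0)])"
        using h d by (simp add: legal_history_snoc)
      then have "legal_history X d (h @ [SOME x. legal_history X d (h @ [x])])"
        by (rule someI)
      then show ?thesis using False by (simp add: s_def)
    qed
  qed
  moreover have inv: "T (to_move p (length h)) (map_of h)"
    if "legal_history X d h" "follows p s h" for h
    using that
  proof (induction h rule: rev_induct)
    case Nil
    then show ?case using start by (simp add: to_move_def)
  next
    case (snoc x h)
    obtain v c where x: "x = (v, c)" by (cases x)
    have leg: "legal_history X d h" "v \<in> verts X - dom (map_of h)" "c < d"
      using snoc.prems(1) by (auto simp: x legal_history_snoc)
    have "follows p s h"
      unfolding follows_def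
    proof (intro allI impI)
      fix n assume "n < length h" "to_move p n = Gentle"
      then show "h ! n = s (take n h)"
        using snoc.prems(2) unfolding follows_def
        by (metis less_Suc_eq length_append_singleton nth_append order_less_imp_le take_append
            append_Nil2 diff_is_0_eq take0)
    qed
    then have IH: "T (to_move p (length h)) (map_of h)" using snoc.IH leg(1) by blast
    show ?case
    proof (cases rule: to_move_cases[of p "length h" Gentle])
      case to_move
      have "x = s h"
        using snoc.prems(2) to_move(1) unfolding follows_def by force
      moreover have "\<not> complete_play X d h" using leg(2) by (auto simp: complete_play_iff)
      then have "\<exists>x. good h x" using good leg(1) IH to_move(1) by simp
      ultimately have "good h x" by (simp add: s_def someI_ex)
      then show ?thesis using to_move by (simp add: good_def)
    next
      case other
      then have "T Gentle ((map_of h)(v \<mapsto> c))"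
        using keep IH leg unfolding can_keep_def by simp
      then show ?thesis
        using other leg(2) map_of_snoc[of v h c]
        by (simp add: x dom_map_of_conv_image_fst del: map_of_append fun_upd_apply)
    qed
  qed
  have "distinguishing X (final_coloring h)" if "complete_play X d h" "follows p s h" for h
    using inv[OF _ that(2)] final[of _ "map_of h"] legal_history_ran[of X d h] that(1)
    by (auto simp: complete_play_iff final_coloring_def[abs_def])
  ultimately show ?thesis unfolding gentle_wins_def by blast
qed

text \<open>Each strategy of Gentle is refuted by one complete play against it: Rascal keeps
  \<open>T\<close> at his moves, Gentle moves as the strategy says, and the number of uncolored
  vertices decreases.\<close>

lemma not_gentle_wins_if_can_keep:
  assumes fin: "finite (verts X)"
    and keep: "can_keep (verts X) d Rascal T" and start: "T p Map.empty"
    and final: "\<And>r m. T r m \<Longrightarrow> dom m = verts X \<Longrightarrow> ran m \<subseteq> {..<d} \<Longrightarrow>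
       \<not> distinguishing X (\<lambda>v. the (m v))"
  shows "\<not> gentle_wins X d p"
proof
  assume "gentle_wins X d p"
  then obtain s where s: "gentle_strategy X d p s"
    and win: "\<And>h. complete_play X d h \<Longrightarrow> follows p s h \<Longrightarrow> distinguishing X (final_coloring h)"
    unfolding gentle_wins_def by blast
  have "\<exists>h'. complete_play X d h' \<and> follows p s h' \<and> T (to_move p (length h')) (map_of h')"
    if "legal_history X d h" "follows p s h" "T (to_move p (length h)) (map_of h)" for h
    using that
  proof (induction "card (verts X - dom (map_of h))" arbitrary: h rule: less_induct)
    case less
    show ?case
    proof (cases "complete_play X d h")
      case True
      then show ?thesis using less.prems by blast
    next
      case False
      then have sub: "dom (map_of h) \<subset> verts X"
        using less.prems(1) legal_history_dom[OF less.prems(1)] by (auto simp: complete_play_iff)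
      obtain v c where vc: "v \<in> verts X - dom (map_of h)" "c < d"
        "to_move p (length h) = Gentle \<longrightarrow> (v, c) = s h"
        "T (to_move p (Suc (length h))) ((map_of h)(v \<mapsto> c))"
      proof (cases rule: to_move_cases[of p "length h" Rascal])
        case to_move
        then obtain v c where "v \<in> verts X - dom (map_of h)" "c < d"
          "T (opponent Rascal) ((map_of h)(v \<mapsto> c))"
          using keep less.prems(3) sub unfolding can_keep_def by metis
        then show ?thesis using that to_move by simp
      next
        case other
        obtain v c where vc: "s h = (v, c)" by (cases "s h")
        have "legal_history X d (h @ [(v, c)])"
          using s less.prems(1) False other(1) unfolding gentle_strategy_def vc[symmetric] by simp
        then show ?thesis
          using that[of v c] vc keep less.prems(3) other
          unfolding can_keep_def by (auto simp: legal_history_snoc)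
      qed
      let ?h = "h @ [(v, c)]"
      have m: "map_of ?h = (map_of h)(v \<mapsto> c)"
        using vc(1) map_of_snoc[of v h c] by (simp add: dom_map_of_conv_image_fst)
      have "card (verts X - dom (map_of ?h)) < card (verts X - dom (map_of h))"
        unfolding m by (rule psubset_card_mono) (use fin vc(1) in auto)
      moreover have "legal_history X d ?h"
        using less.prems(1) vc by (simp add: legal_history_snoc)
      moreover have "follows p s ?h"
        unfolding follows_def
      proof (intro allI impI)
        fix n assume n: "n < length ?h" "to_move p n = Gentle"
        show "?h ! n = s (take n ?h)"
        proof (cases "n < length h")
          case True
          then show ?thesis
            using less.prems(2) n(2) by (simp add: follows_def nth_append)
        next
          case False
          then have "n = length h" using n(1) by simp
          then show ?thesis using vc(3) n(2) by simp
        qed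
      qed
      moreover have "T (to_move p (length ?h)) (map_of ?h)"
        using vc(4) by (simp add: m del: map_of_append)
      ultimately show ?thesis using less.hyps by blast
    qed
  qed
  from this[of "[]"] obtain h where h: "complete_play X d h" "follows p s h"
      "T (to_move p (length h)) (map_of h)"
    using start by (auto simp: legal_history_def follows_def)
  then show False
    using win[OF h(1,2)] final[OF h(3)] legal_history_ran[of X d h]
    by (auto simp: complete_play_iff final_coloring_def[abs_def])
qed

lemma not_gentle_wins_one_color:
  assumes "finite (verts X)" and "automorphism X \<sigma>" and "v \<in> verts X" "\<sigma> v \<noteq> v"
  shows "\<not> gentle_wins X 1 p"
proof (rule not_gentle_wins_if_can_keep[where T = "\<lambda>_ _. True"])
  show "can_keep (verts X) 1 Rascal (\<lambda>_ _. True)"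
    by (auto simp: can_keep_def)
  fix m :: "'a \<rightharpoonup> nat" assume m: "dom m = verts X" "ran m \<subseteq> {..<1}"
  have "the (m u) = 0" if "u \<in> verts X" for u
    using that m by (force simp: ran_def)
  moreover have "\<sigma> u \<in> verts X" if "u \<in> verts X" for u
    using that assms(2) by (auto simp: automorphism_def bij_betw_def)
  ultimately show "\<not> distinguishing X (\<lambda>v. the (m v))"
    using assms unfolding distinguishing_def by auto
qed (use assms in auto)

section \<open>Strategies answering every move\<close>

text \<open>One round is a move of the opponent and the reply; \<open>S\<close> is demanded only
  between rounds. Since the reply needs a free vertex, an odd number of uncolored vertices cannot
  occur under \<open>S\<close> if \<open>V\<close> is finite and \<open>d > 0\<close>.\<close>

definition responds :: "'a set \<Rightarrow> nat \<Rightarrow> (('a \<rightharpoonup> nat) \<Rightarrow> bool) \<Rightarrow> bool" where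
  "responds V d S \<longleftrightarrow> (\<forall>m v c. S m \<and> v \<in> V - dom m \<and> c < d \<longrightarrow>
     (\<exists>w\<in>V - dom m - {v}. \<exists>e<d. S (m(v \<mapsto> c, w \<mapsto> e))))"

definition startable :: "'a set \<Rightarrow> nat \<Rightarrow> (('a \<rightharpoonup> nat) \<Rightarrow> bool) \<Rightarrow> bool \<Rightarrow> bool" where
  "startable V d S first \<longleftrightarrow> (if first then \<exists>v\<in>V. \<exists>c<d. S [v \<mapsto> c] else S Map.empty)"

definition reply_pending :: "'a set \<Rightarrow> nat \<Rightarrow> (('a \<rightharpoonup> nat) \<Rightarrow> bool) \<Rightarrow> ('a \<rightharpoonup> nat) \<Rightarrow> bool" where
  "reply_pending V d S m \<longleftrightarrow> m = Map.empty \<and> startable V d S True \<or>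
     (\<exists>m' v c. S m' \<and> v \<in> V - dom m' \<and> c < d \<and> m = m'(v \<mapsto> c))"

lemma can_keep_responds:
  assumes "responds V d S"
  shows "can_keep V d q (\<lambda>r m. if r = q then reply_pending V d S m else S m)"
proof -
  have "\<exists>w\<in>V - dom m. \<exists>e<d. S (m(w \<mapsto> e))" if "reply_pending V d S m" for m
    using that unfolding reply_pending_def
  proof (elim disjE conjE exE)
    fix m' v c assume "S m'" "v \<in> V - dom m'" "c < d" "m = m'(v \<mapsto> c)"
    then show ?thesis using assms unfolding responds_def by fastforce
  qed (auto simp: startable_def)
  moreover have "reply_pending V d S (m(v \<mapsto> c))" if "S m" "v \<in> V - dom m" "c < d" for m v c
    using that unfolding reply_pending_def by blast
  ultimately show ?thesis by (simp add: can_keep_def)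
qed

text \<open>While a reply is due some vertex is still free, so a full coloring is only reached
  between rounds.\<close>

lemma responds_full:
  assumes "responds V d S" "if r = q then reply_pending V d S m else S m" "dom m = V"
  shows "S m"
proof (cases "S m")
  case False
  then have "reply_pending V d S m" using assms(2) by (simp split: if_splits)
  then show ?thesis
    unfolding reply_pending_def
  proof (elim disjE conjE exE)
    fix m' v c assume "S m'" "v \<in> V - dom m'" "c < d" "m = m'(v \<mapsto> c)"
    then show ?thesis using assms(1,3) unfolding responds_def by fastforce
  qed (use assms(3) in \<open>auto simp: startable_def\<close>)
qed

lemma responds_start:
  "startable V d S (p = q) \<Longrightarrow> if p = q then reply_pending V d S Map.empty else S Map.empty"
  by (auto simp: reply_pending_def startable_def)

text \<open>Strategies on disjoint parts are combined by answering in the part in which the opponent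
  has just moved.\<close>

lemma responds_Un:
  assumes "responds V d S" "responds W d T" "V \<inter> W = {}"
  shows "responds (V \<union> W) d (\<lambda>m. S (m |` V) \<and> T (m |` W))"
  unfolding responds_def
proof (intro allI impI)
  fix m v c assume *: "(S (m |` V) \<and> T (m |` W)) \<and> v \<in> V \<union> W - dom m \<and> c < d"
  consider "v \<in> V" "v \<notin> W" | "v \<in> W" "v \<notin> V" using * assms(3) by blast
  then show "\<exists>w\<in>V \<union> W - dom m - {v}. \<exists>e<d.
      S (m(v \<mapsto> c, w \<mapsto> e) |` V) \<and> T (m(v \<mapsto> c, w \<mapsto> e) |` W)"
  proof cases
    case 1
    then have "S (m |` V) \<and> v \<in> V - dom (m |` V) \<and> c < d" using * by simp
    then obtain w e where "w \<in> V - dom (m |` V) - {v}" and e: "e < d"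
      and S: "S ((m |` V)(v \<mapsto> c, w \<mapsto> e))"
      using assms(1) unfolding responds_def by blast
    then have w: "w \<in> V - dom m - {v}" by auto
    have "w \<notin> W" using w assms(3) by blast
    moreover have "m(v \<mapsto> c, w \<mapsto> e) |` V = (m |` V)(v \<mapsto> c, w \<mapsto> e)"
      using 1 w by (auto simp: restrict_map_def)
    moreover have "m(v \<mapsto> c, w \<mapsto> e) |` W = m |` W"
      using 1 \<open>w \<notin> W\<close> by (auto simp: restrict_map_def)
    ultimately have "S (m(v \<mapsto> c, w \<mapsto> e) |` V) \<and> T (m(v \<mapsto> c, w \<mapsto> e) |` W)"
      using * S by (simp only:)
    then show ?thesis using w e by blast
  next
    case 2
    then have "T (m |` W) \<and> v \<in> W - dom (m |` W) \<and> c < d" using * by simp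
    then obtain w e where "w \<in> W - dom (m |` W) - {v}" and e: "e < d"
      and S: "T ((m |` W)(v \<mapsto> c, w \<mapsto> e))"
      using assms(2) unfolding responds_def by blast
    then have w: "w \<in> W - dom m - {v}" by auto
    have "w \<notin> V" using w assms(3) by blast
    moreover have "m(v \<mapsto> c, w \<mapsto> e) |` W = (m |` W)(v \<mapsto> c, w \<mapsto> e)"
      using 2 w by (auto simp: restrict_map_def)
    moreover have "m(v \<mapsto> c, w \<mapsto> e) |` V = m |` V"
      using 2 \<open>w \<notin> V\<close> by (auto simp: restrict_map_def)
    ultimately have "S (m(v \<mapsto> c, w \<mapsto> e) |` V) \<and> T (m(v \<mapsto> c, w \<mapsto> e) |` W)"
      using * S by (simp only:)
    then show ?thesis using w e by blast
  qed
qed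

text \<open>A move at \<^term>\<open>v\<close> with color \<^term>\<open>c\<close> is answered by a move at \<^term>\<open>\<mu> v\<close> with
  color \<^term>\<open>\<rho> v c\<close>; a vertex fixed by \<open>\<mu>\<close> has to be colored in advance.\<close>

definition paired :: "'a set \<Rightarrow> ('a \<Rightarrow> 'a) \<Rightarrow> ('a \<Rightarrow> nat \<Rightarrow> nat) \<Rightarrow> ('a \<rightharpoonup> nat) \<Rightarrow> bool" where
  "paired V \<mu> \<rho> m \<longleftrightarrow> (\<forall>v\<in>V. \<mu> v = v \<longrightarrow> v \<in> dom m) \<and>
     (\<forall>v\<in>V. \<forall>c. \<mu> v \<noteq> v \<and> m v = Some c \<longrightarrow> m (\<mu> v) = Some (\<rho> v c))"

text \<open>The domain of a paired coloring is closed under \<open>\<mu>\<close>, so the partner of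
  a free vertex is free. The second condition on \<open>\<rho>\<close> makes the relation between
  the two colors the same, whichever vertex is colored first.\<close>

lemma responds_paired:
  assumes \<mu>: "\<And>v. v \<in> V \<Longrightarrow> \<mu> v \<in> V" "\<And>v. v \<in> V \<Longrightarrow> \<mu> (\<mu> v) = v"
    and \<rho>: "\<And>v c. c < d \<Longrightarrow> \<rho> v c < d" "\<And>v c. v \<in> V \<Longrightarrow> c < d \<Longrightarrow> \<rho> (\<mu> v) (\<rho> v c) = c"
  shows "responds V d (paired V \<mu> \<rho>)"
  unfolding responds_def
proof (intro allI impI)
  fix m v c assume "paired V \<mu> \<rho> m \<and> v \<in> V - dom m \<and> c < d"
  then have m: "paired V \<mu> \<rho> m" and v: "v \<in> V" "m v = None" and c: "c < d" by auto
  have ne: "\<mu> v \<noteq> v" using m v unfolding paired_def by auto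
  have none: "m (\<mu> v) = None"
  proof (rule ccontr)
    assume "m (\<mu> v) \<noteq> None"
    then obtain c' where "m (\<mu> v) = Some c'" by blast
    then have "m v = Some (\<rho> (\<mu> v) c')"
      using m \<mu>[OF v(1)] ne unfolding paired_def by metis
    then show False using v by simp
  qed
  have "paired V \<mu> \<rho> (m(v \<mapsto> c, \<mu> v \<mapsto> \<rho> v c))"
    unfolding paired_def
  proof (intro conjI ballI allI impI)
    fix u assume "u \<in> V" "\<mu> u = u"
    then show "u \<in> dom (m(v \<mapsto> c, \<mu> v \<mapsto> \<rho> v c))" using m by (auto simp: paired_def)
  next
    fix u e assume u: "u \<in> V" "\<mu> u \<noteq> u \<and> (m(v \<mapsto> c, \<mu> v \<mapsto> \<rho> v c)) u = Some e"
    consider "u = v" | "u = \<mu> v" | "u \<noteq> v" "u \<noteq> \<mu> v" by blast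
    then show "(m(v \<mapsto> c, \<mu> v \<mapsto> \<rho> v c)) (\<mu> u) = Some (\<rho> u e)"
    proof cases
      case 3
      then have "\<mu> u \<noteq> v" "\<mu> u \<noteq> \<mu> v" using \<mu> u(1) v(1) by metis+
      then show ?thesis using 3 u m by (simp add: paired_def)
    qed (use u v c ne \<mu> \<rho> in auto)
  qed
  then show "\<exists>w\<in>V - dom m - {v}. \<exists>e<d. paired V \<mu> \<rho> (m(v \<mapsto> c, w \<mapsto> e))"
    using \<mu>(1)[OF v(1)] \<rho>(1)[OF c] none ne by (intro bexI[of _ "\<mu> v"] exI[of _ "\<rho> v c"]) auto
qed

lemma startable_paired:
  assumes "\<And>u v. u \<in> V \<Longrightarrow> v \<in> V \<Longrightarrow> \<mu> u = u \<Longrightarrow> \<mu> v = v \<Longrightarrow> u = v"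
    and "first \<longleftrightarrow> (\<exists>v\<in>V. \<mu> v = v)" and "1 \<le> d"
  shows "startable V d (paired V \<mu> \<rho>) first"
proof (cases first)
  case True
  then obtain v where "v \<in> V" "\<mu> v = v" using assms(2) by blast
  moreover from this have "paired V \<mu> \<rho> [v \<mapsto> 0]" using assms(1) by (auto simp: paired_def)
  moreover have "0 < d" using assms(3) by simp
  ultimately show ?thesis using True unfolding startable_def by auto
qed (use assms in \<open>auto simp: startable_def paired_def\<close>)

text \<open>The graph is dropped and its automorphisms are replaced by an arbitrary set of maps. So
  the game can be moved to coordinates in which these maps are explicit formulas.\<close>

definition forces :: "'a set \<Rightarrow> ('a \<Rightarrow> 'a) set \<Rightarrow> player \<Rightarrow> bool" where
  "forces V G p \<longleftrightarrow> (\<exists>S. responds V 2 S \<and> startable V 2 S (p = Gentle) \<and>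
     (\<forall>m. S m \<and> dom m = V \<and> ran m \<subseteq> {..<2} \<longrightarrow>
        (\<forall>g\<in>G. (\<forall>v\<in>V. m (g v) = m v) \<longrightarrow> (\<forall>v\<in>V. g v = v))))"

lemma gentle_wins_if_forces:
  assumes "forces (verts X) {f. automorphism X f} p"
  shows "gentle_wins X 2 p"
proof -
  obtain S where S: "responds (verts X) 2 S" "startable (verts X) 2 S (p = Gentle)"
    and final: "\<And>m f v. S m \<Longrightarrow> dom m = verts X \<Longrightarrow> ran m \<subseteq> {..<2} \<Longrightarrow> automorphism X f \<Longrightarrow>
       (\<And>v. v \<in> verts X \<Longrightarrow> m (f v) = m v) \<Longrightarrow> v \<in> verts X \<Longrightarrow> f v = v"
    using assms unfolding forces_def by auto
  show ?thesis
  proof (rule gentle_wins_if_can_keep)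
    show "can_keep (verts X) 2 Gentle (\<lambda>r m. if r = Gentle then reply_pending (verts X) 2 S m else S m)"
      using S(1) by (rule can_keep_responds)
    show "if p = Gentle then reply_pending (verts X) 2 S Map.empty else S Map.empty"
      using S(2) by (rule responds_start)
  next
    fix r m assume "if r = Gentle then reply_pending (verts X) 2 S m else S m"
      and m: "dom m = verts X" "ran m \<subseteq> {..<2}"
    then have "S m" using responds_full S(1) by metis
    show "distinguishing X (\<lambda>v. the (m v))"
      unfolding distinguishing_def
    proof (intro allI impI)
      fix f assume f: "automorphism X f \<and> (\<forall>v\<in>verts X. the (m (f v)) = the (m v))"
      have "m (f v) = m v" if v: "v \<in> verts X" for v
      proof -
        have "f v \<in> verts X" using f v by (auto simp: automorphism_def bij_betw_def)
        then show ?thesis using f v m(1) by (metis domD option.sel)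
      qed
      then show "\<forall>v\<in>verts X. f v = v" using final[OF \<open>S m\<close> m] f by blast
    qed
  qed simp
qed

text \<open>Colorings are carried along \<open>h\<close>. Each map in \<open>G'\<close> only has to
  be intertwined with some map in \<open>G\<close>, which may contain further maps.\<close>

lemma forces_transport:
  assumes F: "forces V G p" and h: "bij_betw h V' V"
    and G': "\<And>g' v. g' \<in> G' \<Longrightarrow> v \<in> V' \<Longrightarrow> g' v \<in> V'"
    and com: "\<And>g'. g' \<in> G' \<Longrightarrow> \<exists>g\<in>G. \<forall>v\<in>V'. h (g' v) = g (h v)"
  shows "forces V' G' p"
proof -
  obtain S where S: "responds V 2 S" "startable V 2 S (p = Gentle)"
    and final: "\<And>m g v. S m \<Longrightarrow> dom m = V \<Longrightarrow> ran m \<subseteq> {..<2} \<Longrightarrow> g \<in> G \<Longrightarrow>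
       (\<And>v. v \<in> V \<Longrightarrow> m (g v) = m v) \<Longrightarrow> v \<in> V \<Longrightarrow> g v = v"
    using F unfolding forces_def by auto
  define k where "k = inv_into V' h"
  have hV: "h v \<in> V" if "v \<in> V'" for v using that h by (auto simp: bij_betw_def)
  have kV: "k v \<in> V'" if "v \<in> V" for v
    using that h by (auto simp: bij_betw_def k_def intro: inv_into_into)
  have hk: "h (k v) = v" if "v \<in> V" for v
    using that h by (auto simp: bij_betw_def k_def f_inv_into_f)
  have kh: "k (h v) = v" if "v \<in> V'" for v
    using that h by (auto simp: bij_betw_def k_def)
  define pull where "pull m = (\<lambda>v. if v \<in> V then m (k v) else None)" for m :: "'b \<rightharpoonup> nat"
  have pull_upd: "pull (m(v \<mapsto> c)) = (pull m)(h v \<mapsto> c)" if "v \<in> V'" for m v c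
    using that hV hk kh by (auto simp: pull_def fun_eq_iff)
  have pull_dom: "h v \<in> dom (pull m) \<longleftrightarrow> v \<in> dom m" if "v \<in> V'" for m v
    using that hV kh by (auto simp: pull_def)
  have pull_empty: "pull Map.empty = Map.empty" by (simp add: pull_def)
  have "responds V' 2 (\<lambda>m. S (pull m))"
    unfolding responds_def
  proof (intro allI impI)
    fix m v and c :: nat assume *: "S (pull m) \<and> v \<in> V' - dom m \<and> c < 2"
    then have "h v \<in> V - dom (pull m)" using hV pull_dom by blast
    then obtain w e where w: "w \<in> V - dom (pull m) - {h v}" "e < 2" "S ((pull m)(h v \<mapsto> c, w \<mapsto> e))"
      using S(1) * unfolding responds_def by blast
    then have "k w \<in> V' - dom m - {v}" using kV hk pull_dom by (metis Diff_iff singleton_iff)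
    moreover have "S (pull (m(v \<mapsto> c, k w \<mapsto> e)))"
      using w * kV hk by (simp add: pull_upd)
    ultimately show "\<exists>w\<in>V' - dom m - {v}. \<exists>e<2. S (pull (m(v \<mapsto> c, w \<mapsto> e)))"
      using w(2) by blast
  qed
  moreover have "startable V' 2 (\<lambda>m. S (pull m)) (p = Gentle)"
  proof (cases "p = Gentle")
    case True
    then obtain v c where "v \<in> V" "c < 2" "S [v \<mapsto> c]" using S(2) by (auto simp: startable_def)
    then have "k v \<in> V'" "S (pull [k v \<mapsto> c])" using kV hk by (simp_all add: pull_upd pull_empty)
    then show ?thesis using True \<open>c < 2\<close> by (auto simp: startable_def)
  next
    case False
    then show ?thesis using S(2) by (simp add: startable_def pull_empty)
  qed
  moreover have "g' v = v" if m: "S (pull m)" "dom m = V'" "ran m \<subseteq> {..<2}" and g': "g' \<in> G'"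
    and inv: "\<And>v. v \<in> V' \<Longrightarrow> m (g' v) = m v" and v: "v \<in> V'" for m g' v
  proof -
    obtain g where g: "g \<in> G" "\<And>v. v \<in> V' \<Longrightarrow> h (g' v) = g (h v)" using com[OF g'] by blast
    have "g (h v) = h v"
    proof (rule final[OF m(1) _ _ g(1)])
      show "dom (pull m) = V" using kV m(2) by (auto simp: pull_def dom_def)
      show "ran (pull m) \<subseteq> {..<2}" using m(3) by (auto simp: pull_def ran_def)
      fix u assume u: "u \<in> V"
      then have "g u = h (g' (k u))" using g(2)[OF kV[OF u]] hk by simp
      then show "pull m (g u) = pull m u"
        using u hV kV kh G'[OF g' kV[OF u]] inv[OF kV[OF u]] by (simp add: pull_def)
    qed (rule hV[OF v])
    then show ?thesis using g(2)[OF v] kh v G'[OF g' v] by metis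
  qed
  ultimately show ?thesis unfolding forces_def by blast
qed

text \<open>Equal colors on every orbit make \<open>\<sigma>\<close> color-preserving. The condition
  on \<open>p\<close> gives Rascal the last move: a single fixed vertex makes the number of vertices
  odd.\<close>

lemma not_gentle_wins_involution:
  assumes "finite (verts X)" and \<sigma>: "automorphism X \<sigma>" "\<And>v. v \<in> verts X \<Longrightarrow> \<sigma> (\<sigma> v) = v"
    and unique: "\<And>u v. u \<in> verts X \<Longrightarrow> v \<in> verts X \<Longrightarrow> \<sigma> u = u \<Longrightarrow> \<sigma> v = v \<Longrightarrow> u = v"
    and p: "p = Rascal \<longleftrightarrow> (\<exists>v\<in>verts X. \<sigma> v = v)"
    and nontriv: "v0 \<in> verts X" "\<sigma> v0 \<noteq> v0" and d: "1 \<le> d"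
  shows "\<not> gentle_wins X d p"
proof -
  have \<sigma>V: "\<sigma> v \<in> verts X" if "v \<in> verts X" for v
    using that \<sigma>(1) by (auto simp: automorphism_def bij_betw_def)
  let ?S = "paired (verts X) \<sigma> (\<lambda>_ c. c)"
  have S: "responds (verts X) d ?S" using \<sigma>V \<sigma>(2) by (rule responds_paired) simp_all
  show ?thesis
  proof (rule not_gentle_wins_if_can_keep)
    show "can_keep (verts X) d Rascal (\<lambda>r m. if r = Rascal then reply_pending (verts X) d ?S m else ?S m)"
      using S by (rule can_keep_responds)
    show "if p = Rascal then reply_pending (verts X) d ?S Map.empty else ?S Map.empty"
      using startable_paired[OF unique p d] by (intro responds_start) blast
  next
    fix r m assume "if r = Rascal then reply_pending (verts X) d ?S m else ?S m"
      and m: "dom m = verts X"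
    then have "?S m" using responds_full S by metis
    have "the (m (\<sigma> v)) = the (m v)" if v: "v \<in> verts X" for v
    proof -
      obtain c where "m v = Some c" using v m by blast
      then show ?thesis using v \<open>?S m\<close> unfolding paired_def by (cases "\<sigma> v = v") auto
    qed
    then show "\<not> distinguishing X (\<lambda>v. the (m v))"
      using \<sigma>(1) nontriv unfolding distinguishing_def by blast
  qed (rule assms(1))
qed

section \<open>From winning strategies to game numbers\<close>

lemma game_number_infinity:
  "(\<And>d. 1 \<le> d \<Longrightarrow> \<not> gentle_wins X d p) \<Longrightarrow> game_number p X = \<infinity>"
  by (simp add: game_number_def Inf_enat_def)

lemma game_number_2:
  assumes "gentle_wins X 2 p" "\<not> gentle_wins X 1 p"
  shows "game_number p X = 2"
proof -
  have "2 \<in> {d. 1 \<le> d \<and> gentle_wins X d p}" using assms by simp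
  moreover have "2 \<le> d" if "1 \<le> d" "gentle_wins X d p" for d
    using that assms(2) by (cases "d = 1") auto
  ultimately show ?thesis
    unfolding game_number_def by (intro cInf_eq_minimum) (force simp: numeral_eq_enat)+
qed

section \<open>Automorphisms of a product of cycles of distinct lengths\<close>

text \<open>Coordinates outside \<open>J\<close> are pinned to 0, so that equal points are equal
  functions and a further coordinate is added by a function update, without a change of
  type.\<close>

definition box :: "(nat \<Rightarrow> int) \<Rightarrow> nat set \<Rightarrow> (nat \<Rightarrow> int) set" where
  "box N J = {v. (\<forall>i\<in>J. v i \<in> {0..<N i}) \<and> (\<forall>i. i \<notin> J \<longrightarrow> v i = 0)}"

definition affine :: "(nat \<Rightarrow> int) \<Rightarrow> nat set \<Rightarrow> (nat \<Rightarrow> int) \<Rightarrow> (nat \<Rightarrow> int) \<Rightarrow> (nat \<Rightarrow> int) \<Rightarrow> nat \<Rightarrow> int" where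
  "affine N J s t v = (\<lambda>i. if i \<in> J then (s i * v i + t i) mod N i else 0)"

definition affines :: "(nat \<Rightarrow> int) \<Rightarrow> nat set \<Rightarrow> ((nat \<Rightarrow> int) \<Rightarrow> nat \<Rightarrow> int) set" where
  "affines N J = {affine N J s t | s t. \<forall>i. s i \<in> {1, -1}}"

lemma affine_mod: "(s * (x mod n) + t) mod n = (s * x + t) mod (n::int)"
  by (metis mod_add_left_eq mod_mult_right_eq)

lemma small_dvd: "(n::int) dvd z \<Longrightarrow> \<bar>z\<bar> < n \<Longrightarrow> z = 0"
  using dvd_imp_le_int[of z n] by linarith

locale torus =
  fixes N :: "nat \<Rightarrow> int" and J :: "nat set"
  assumes fin: "finite J" and N3: "i \<in> J \<Longrightarrow> 3 \<le> N i"
begin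

definition disp :: "(nat \<Rightarrow> int) \<Rightarrow> (nat \<Rightarrow> int) \<Rightarrow> nat \<Rightarrow> int" where
  "disp a u = (\<lambda>i. if i \<in> J then (u i + a i) mod N i else 0)"

definition move :: "nat \<Rightarrow> int \<Rightarrow> (nat \<Rightarrow> int) \<Rightarrow> nat \<Rightarrow> int" where
  "move i d = disp (\<lambda>l. if l = i then d else 0)"

definition nbr :: "(nat \<Rightarrow> int) \<Rightarrow> (nat \<Rightarrow> int) \<Rightarrow> bool" where
  "nbr u v \<longleftrightarrow> (\<exists>i\<in>J. \<exists>d\<in>{1, -1}. v = move i d u)"

text \<open>\<open>v\<close> and \<open>w\<close> are opposite neighbors of \<open>u\<close> on a
  line. Length 4 is left out because there opposite neighbors look like those at a corner: they have
  a second common neighbor.\<close>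

definition straight :: "(nat \<Rightarrow> int) \<Rightarrow> (nat \<Rightarrow> int) \<Rightarrow> (nat \<Rightarrow> int) \<Rightarrow> bool" where
  "straight u v w \<longleftrightarrow> (\<exists>i\<in>J. N i \<noteq> 4 \<and> (\<exists>d\<in>{1, -1}. v = move i d u \<and> w = move i (-d) u))"

abbreviation B where "B \<equiv> box N J"

lemma disp_in [simp]: "disp a u \<in> B"
  using N3 by (fastforce simp: box_def disp_def)

lemma move_in [simp]: "move i d u \<in> B"
  by (simp add: move_def)

lemma disp_disp: "disp a (disp b u) = disp (\<lambda>i. a i + b i) u"
  by (auto simp: disp_def fun_eq_iff mod_simps algebra_simps)

lemma disp_0: "u \<in> B \<Longrightarrow> disp (\<lambda>_. 0) u = u"
  by (auto simp: disp_def box_def fun_eq_iff)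

lemma disp_eq_iff: "disp a u = disp b u \<longleftrightarrow> (\<forall>i\<in>J. N i dvd a i - b i)"
proof -
  have "(u i + a i) mod N i = (u i + b i) mod N i \<longleftrightarrow> N i dvd a i - b i" for i
    by (simp add: mod_eq_dvd_iff)
  then show ?thesis by (auto simp: disp_def fun_eq_iff)
qed

lemma disp_eq_self_iff: "u \<in> B \<Longrightarrow> disp a u = u \<longleftrightarrow> (\<forall>i\<in>J. N i dvd a i)"
  using disp_eq_iff[of a u "\<lambda>_. 0"] by (simp add: disp_0)

lemma move_move: "move i d (move i e u) = move i (d + e) u"
  by (auto simp: move_def disp_disp intro!: arg_cong[where f = "\<lambda>a. disp a u"])

lemma move_0: "u \<in> B \<Longrightarrow> move i 0 u = u"
  by (simp add: move_def disp_0)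

lemma move_eq_iff: "i \<in> J \<Longrightarrow> move i d u = move i e u \<longleftrightarrow> N i dvd d - e"
  by (auto simp: move_def disp_eq_iff)

lemma move_eq_self_iff: "i \<in> J \<Longrightarrow> u \<in> B \<Longrightarrow> move i d u = u \<longleftrightarrow> N i dvd d"
  using move_eq_iff[of i d u 0] by (simp add: move_0)

lemma move_eq_move_iff:
  assumes "i \<in> J" "j \<in> J" "d \<in> {1, -1}" "e \<in> {1, -1}"
  shows "move i d u = move j e u \<longleftrightarrow> i = j \<and> d = e"
proof
  assume eq: "move i d u = move j e u"
  then have "N i dvd (if i = i then d else 0) - (if i = j then e else 0)"
    using assms(1) unfolding move_def disp_eq_iff by blast
  then have "d - (if i = j then e else 0) = 0"
    by (intro small_dvd[of "N i"]) (use assms N3[of i] in auto)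
  then show "i = j \<and> d = e" using assms(3) by (auto split: if_splits)
qed simp

text \<open>Neighbors of \<open>u\<close> in different directions are not adjacent and have the
  fourth corner of a square as second common neighbor. Opposite neighbors are adjacent on a line of
  length 3, have only \<open>u\<close> in common from length 5 on, and also share the antipode of
  \<open>u\<close> at length 4.\<close>

lemma straight_iff:
  assumes u: "u \<in> B" and "nbr u v" "nbr u w" "v \<noteq> w"
  shows "straight u v w \<longleftrightarrow> nbr v w \<or> (\<forall>x. nbr v x \<and> nbr w x \<longrightarrow> x = u)"
proof -
  obtain i d where i: "i \<in> J" "d \<in> {1, -1}" and v: "v = move i d u"
    using assms(2) by (auto simp: nbr_def)
  obtain j e where j: "j \<in> J" "e \<in> {1, -1}" and w: "w = move j e u"
    using assms(3) by (auto simp: nbr_def)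
  have str: "straight u v w \<longleftrightarrow> i = j \<and> N i \<noteq> 4"
  proof
    assume "straight u v w"
    then obtain l f where "l \<in> J" "N l \<noteq> 4" "f \<in> {1, -1}" "v = move l f u" "w = move l (-f) u"
      unfolding straight_def by blast
    moreover from this have "l = i" "l = j"
      using i j v w move_eq_move_iff[of l i f d u] move_eq_move_iff[of l j "-f" e u] by auto
    ultimately show "i = j \<and> N i \<noteq> 4" by blast
  next
    assume ij: "i = j \<and> N i \<noteq> 4"
    then have "e = -d" using assms(4) v w i j by auto
    then show "straight u v w" using ij i v w by (auto simp: straight_def)
  qed
  have "w = move l f v \<longleftrightarrow> (\<forall>m\<in>J. N m dvd
       (if m = l then f else 0) + (if m = i then d else 0) - (if m = j then e else 0))" for l f
  proof -
    have "w = move l f v \<longleftrightarrow> move l f v = w" by blast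
    then show ?thesis unfolding v w move_def disp_disp disp_eq_iff .
  qed
  then have nbr_vw: "nbr v w \<longleftrightarrow> (\<exists>l\<in>J. \<exists>f\<in>{1, -1}. \<forall>m\<in>J. N m dvd
       (if m = l then f else 0) + (if m = i then d else 0) - (if m = j then e else 0))"
    unfolding nbr_def by presburger
  show ?thesis
  proof (cases "i = j")
    case False
    have "\<not> nbr v w"
    proof
      assume "nbr v w"
      then obtain l f where l: "l \<in> J" "f \<in> {1, -1}" and dvd: "\<And>m. m \<in> J \<Longrightarrow> N m dvd
         (if m = l then f else 0) + (if m = i then d else 0) - (if m = j then e else 0)"
        unfolding nbr_vw by blast
      have "l = i"
        using dvd[of i] small_dvd[of "N i" d] i N3[of i] False by (auto split: if_splits)
      moreover have "l = j"
        using dvd[of j] small_dvd[of "N j" "-e"] j N3[of j] False by (auto split: if_splits)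
      ultimately show False using False by blast
    qed
    moreover have "nbr v (move j e v)" using j by (auto simp: nbr_def)
    moreover have "move j e v = move i d w"
      unfolding v w move_def disp_disp by (simp add: add.commute)
    moreover from this have "nbr w (move j e v)" using i by (auto simp: nbr_def)
    moreover have "move j e v \<noteq> u"
    proof
      assume "move j e v = u"
      then have "N i dvd d"
        using i(1) False disp_eq_self_iff[OF u] unfolding v move_def disp_disp by force
      then show False using small_dvd[of "N i" d] i N3[of i] by auto
    qed
    ultimately show ?thesis using str False by blast
  next
    case True
    then have e: "e = -d" using assms(4) v w i j by auto
    consider "N i = 3" | "N i = 4" | "5 \<le> N i" using N3[OF i(1)] by linarith
    then show ?thesis
    proof cases
      case 1
      have "w = move i d v"
        using 1 i unfolding v w e True[symmetric] move_move by (auto simp: move_eq_iff)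
      then have "nbr v w" using i by (auto simp: nbr_def)
      then show ?thesis using str 1 True by simp
    next
      case 2
      have "\<not> nbr v w"
      proof
        assume "nbr v w"
        then obtain l f where l: "l \<in> J" "f \<in> {1, -1}" and dvd: "\<And>m. m \<in> J \<Longrightarrow> N m dvd
           (if m = l then f else 0) + (if m = i then d else 0) - (if m = j then e else 0)"
          unfolding nbr_vw by blast
        have "4 dvd (if i = l then f else 0) + 2 * d"
          using dvd[OF i(1)] True e 2 by (auto simp: algebra_simps split: if_splits)
        then show False
          using i(2) l dvd[of l] N3[of l] small_dvd[of "N l" f] True by (auto split: if_splits)
      qed
      moreover have "move i d v = move i (-d) w"
        using 2 i unfolding v w e True[symmetric] move_move by (auto simp: move_eq_iff)
      moreover from this have "nbr w (move i d v)" using i by (force simp: nbr_def)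
      moreover have "nbr v (move i d v)" using i by (auto simp: nbr_def)
      moreover have "move i d v \<noteq> u"
        using 2 i unfolding v move_move by (auto simp: move_eq_self_iff[OF i(1) u])
      ultimately show ?thesis using str 2 by blast
    next
      case 3
      have "x = u" if x: "nbr v x" "nbr w x" for x
      proof -
        obtain l f where l: "l \<in> J" "f \<in> {1, -1}" "x = move l f v"
          using x(1) by (auto simp: nbr_def)
        obtain l' f' where l': "l' \<in> J" "f' \<in> {1, -1}" "x = move l' f' w"
          using x(2) by (auto simp: nbr_def)
        have "disp (\<lambda>m. (if m = l then f else 0) + (if m = i then d else 0)) u
            = disp (\<lambda>m. (if m = l' then f' else 0) + (if m = i then -d else 0)) u"
          using l(3) l'(3) unfolding v w e True[symmetric] move_def disp_disp by simp
        then have "N i dvd (if i = l then f else 0) + d - ((if i = l' then f' else 0) - d)"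
          using i(1) unfolding disp_eq_iff by force
        then have "(if i = l then f else 0) + d - ((if i = l' then f' else 0) - d) = 0"
          by (rule small_dvd) (use 3 i l l' in auto)
        then have "i = l" "f = -d" using i(2) l(2) l'(2) by (auto split: if_splits)
        then show ?thesis using l(3) u by (simp add: v move_move move_0)
      qed
      then show ?thesis using str 3 True by auto
    qed
  qed
qed

lemma nbr_in: "nbr u v \<Longrightarrow> v \<in> B"
  by (auto simp: nbr_def)

lemma straight_nbr:
  assumes "straight u v w"
  shows "nbr u v" "nbr u w" "v \<noteq> w"
proof -
  obtain i d where i: "i \<in> J" "d \<in> {1, -1}" "v = move i d u" "w = move i (-d) u"
    using assms unfolding straight_def by blast
  then show "nbr u v" "nbr u w" by (auto simp: nbr_def)
  show "v \<noteq> w" using i move_eq_move_iff[of i i d "-d" u] by auto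
qed

text \<open>Being straight is a graph-theoretic property, hence invariant; this shows that
  automorphisms map lines to lines, and the lengths of the lines tell the directions apart.
  Lines of length 4 are not seen by it, but there is at most one direction of length 4.\<close>

lemma automorphism_affine:
  assumes inj: "inj_on N J"
    and bij: "bij_betw F B B"
    and nbr: "\<And>u v. u \<in> B \<Longrightarrow> v \<in> B \<Longrightarrow> nbr (F u) (F v) \<longleftrightarrow> nbr u v"
  shows "\<exists>g\<in>affines N J. \<forall>v\<in>B. F v = g v"
proof -
  have F_in [simp]: "F u \<in> B" if "u \<in> B" for u
    using that bij by (auto simp: bij_betw_def)
  have F_eq: "F u = F v \<longleftrightarrow> u = v" if "u \<in> B" "v \<in> B" for u v
    using that bij by (auto simp: bij_betw_def inj_on_def)
  have F_surj: "\<exists>u\<in>B. F u = v" if "v \<in> B" for v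
    using that bij unfolding bij_betw_def by (metis imageE)
  have straight: "straight (F u) (F v) (F w) \<longleftrightarrow> straight u v w" if B: "u \<in> B" "v \<in> B" "w \<in> B" for u v w
  proof (cases "nbr u v \<and> nbr u w \<and> v \<noteq> w")
    case False
    then show ?thesis using B straight_nbr[of u v w] straight_nbr[of "F u" "F v" "F w"]
      by (auto simp: nbr F_eq)
  next
    case True
    have "(\<forall>x. nbr (F v) x \<and> nbr (F w) x \<longrightarrow> x = F u) \<longleftrightarrow> (\<forall>x. nbr v x \<and> nbr w x \<longrightarrow> x = u)"
    proof (intro iffI allI impI)
      fix x assume *: "\<forall>x. nbr (F v) x \<and> nbr (F w) x \<longrightarrow> x = F u" and x: "nbr v x \<and> nbr w x"
      then have "x \<in> B" using nbr_in by blast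
      then have "F x = F u" using * x B nbr by blast
      then show "x = u" using F_eq B \<open>x \<in> B\<close> by blast
    next
      fix x assume *: "\<forall>x. nbr v x \<and> nbr w x \<longrightarrow> x = u" and x: "nbr (F v) x \<and> nbr (F w) x"
      then obtain y where y: "y \<in> B" "F y = x" using nbr_in F_surj by blast
      then have "y = u" using * x B nbr by blast
      then show "x = F u" using y by simp
    qed
    then show ?thesis
      using True B straight_iff[of u v w] straight_iff[of "F u" "F v" "F w"] by (simp add: nbr F_eq)
  qed
  have step: "\<exists>e\<in>{1, -1}. F (move i d u) = move i e (F u)"
    if u: "u \<in> B" and i: "i \<in> J" "d \<in> {1, -1}" for u i d
  proof (cases "N i = 4")
    case True
    have "nbr u (move i d u)" using i by (auto simp: nbr_def)
    then have "nbr (F u) (F (move i d u))" using u by (simp add: nbr)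
    then obtain j e where j: "j \<in> J" "e \<in> {1, -1}" "F (move i d u) = move j e (F u)"
      by (auto simp: nbr_def)
    \<comment> \<open>An image in a direction of another length would be straight with its opposite
      neighbor; pulled back, this would give a straight triple in a direction of length 4.\<close>
    have "N j = 4"
    proof (rule ccontr)
      assume "N j \<noteq> 4"
      obtain w where w: "w \<in> B" "F w = move j (-e) (F u)" using F_surj[OF move_in] by blast
      then have "straight (F u) (F (move i d u)) (F w)"
        using j \<open>N j \<noteq> 4\<close> by (auto simp: straight_def)
      then have "straight u (move i d u) w" using u w(1) straight by simp
      then show False
        using True i move_eq_move_iff[of i _ d _ u] by (auto simp: straight_def)
    qed
    then have "j = i" using True inj i(1) j(1) by (auto simp: inj_on_def)
    then show ?thesis using j by blast
  next
    case False
    have "straight u (move i d u) (move i (-d) u)" using i False by (auto simp: straight_def)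
    then have "straight (F u) (F (move i d u)) (F (move i (-d) u))" using u by (simp add: straight)
    then obtain j e where j: "j \<in> J" "e \<in> {1, -1}" "F (move i d u) = move j e (F u)"
      by (auto simp: straight_def)
    \<comment> \<open>Straightness at each point determines the next one, so the whole line is
      traversed with the same step \<open>e\<close>. Two consecutive points are carried through the
      induction because the next triple needs both.\<close>
    have line: "F (move i (int m * d) u) = move j (int m * e) (F u) \<and>
        F (move i (int (Suc m) * d) u) = move j (int (Suc m) * e) (F u)" for m
    proof (induction m)
      case 0
      then show ?case using j u by (simp add: move_0)
    next
      case (Suc m)
      let ?u = "move i (int (Suc m) * d) u"
      let ?v = "move i (int m * d) u" and ?w = "move i (int (Suc (Suc m)) * d) u"
      have "straight ?u (move i (-d) ?u) (move i (- (-d)) ?u)"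
        unfolding straight_def using i False by (intro bexI[of _ i] conjI bexI[of _ "-d"]) auto
      then have "straight ?u ?v ?w"
        by (simp add: move_move algebra_simps)
      then have "straight (F ?u) (F ?v) (F ?w)" by (simp add: straight)
      then obtain j' e' where j': "j' \<in> J" "e' \<in> {1, -1}" "F ?v = move j' e' (F ?u)"
          "F ?w = move j' (-e') (F ?u)"
        unfolding straight_def by blast
      have "F ?v = move j (-e) (F ?u)"
        using Suc.IH by (simp add: move_move algebra_simps)
      then have "j' = j" "e' = -e"
        using j' j move_eq_move_iff[of j' j e' "-e" "F ?u"] by auto
      then have "F ?w = move j (int (Suc (Suc m)) * e) (F u)"
        using j'(4) Suc.IH by (simp add: move_move algebra_simps)
      then show ?case using Suc.IH by blast
    qed
    \<comment> \<open>Once around the line in direction \<open>i\<close> must close up in direction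
      \<open>j\<close>, and conversely by injectivity of \<open>F\<close>.\<close>
    have "N j dvd N i"
    proof -
      have "move i (N i * d) u = u" using i u by (simp add: move_eq_self_iff)
      then have "move j (N i * e) (F u) = F u"
        using line[of "nat (N i)"] N3[OF i(1)] by simp
      then have "N j dvd N i * e" using j u by (simp add: move_eq_self_iff)
      then show ?thesis using j by auto
    qed
    moreover have "N i dvd N j"
    proof -
      have "move j (N j * e) (F u) = F u" using j u by (simp add: move_eq_self_iff)
      then have "F (move i (N j * d) u) = F u"
        using line[of "nat (N j)"] N3[OF j(1)] by simp
      then have "move i (N j * d) u = u" using u by (simp add: F_eq)
      then have "N i dvd N j * d" using i u by (simp add: move_eq_self_iff)
      then show ?thesis using i by auto
    qed
    ultimately have "N i = N j" using N3[OF i(1)] N3[OF j(1)] by (simp add: zdvd_antisym_nonneg)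
    then have "j = i" using inj i(1) j(1) by (auto simp: inj_on_def)
    then show ?thesis using j by blast
  qed
  have other: "F (move l d u) i = F u i" if u: "u \<in> B" and l: "l \<in> J" "l \<noteq> i" for l d u i
  proof -
    have *: "F (move l (int m) u) i = F u i" for m
    proof (induction m)
      case (Suc m)
      obtain e where "F (move l 1 (move l (int m) u)) = move l e (F (move l (int m) u))"
        using step[of "move l (int m) u" l 1] l by auto
      then have "F (move l (int (Suc m)) u) i = F (move l (int m) u) i"
        using l(2) F_in[OF move_in, of l "int m" u]
        by (auto simp: move_move move_def[of l e] disp_def box_def)
      then show ?case using Suc.IH by simp
    qed (use u in \<open>simp add: move_0\<close>)
    have "move l d u = move l (int (nat (d mod N l))) u"
      using l N3[OF l(1)] by (simp add: move_eq_iff)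
    then show ?thesis using * by metis
  qed
  \<comment> \<open>Coordinate \<open>i\<close> of the image depends on coordinate \<open>i\<close>
    alone: \<open>u\<close> is changed into \<open>v\<close> in the other coordinates, one at a
    time, and \<open>other\<close> applies to each change.\<close>
  have coord: "F u i = F v i" if B: "u \<in> B" "v \<in> B" and i: "i \<in> J" "u i = v i" for u v i
  proof -
    have "finite K \<Longrightarrow> K \<subseteq> J - {i} \<Longrightarrow> override_on u v K \<in> B \<and> F (override_on u v K) i = F u i" for K
    proof (induction K rule: finite_induct)
      case empty
      then show ?case using B by simp
    next
      case (insert l K)
      let ?u = "override_on u v K"
      have l: "l \<in> J" "l \<noteq> i" and IH: "?u \<in> B" "F ?u i = F u i" using insert by auto
      have "override_on u v (insert l K) = move l (v l - ?u l) ?u"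
        using IH(1) B(2) l(1) by (auto simp: fun_eq_iff move_def disp_def box_def override_on_def)
      then show ?case using other[OF IH(1) l] IH(2) by simp
    qed
    from this[of "J - {i}"] fin have "F (override_on u v (J - {i})) i = F u i" by blast
    moreover have "override_on u v (J - {i}) = v"
      using B i by (auto simp: fun_eq_iff override_on_def box_def)
    ultimately show ?thesis by simp
  qed
  define z :: "nat \<Rightarrow> int" where "z = (\<lambda>_. 0)"
  have z: "z \<in> B" using N3 by (fastforce simp: z_def box_def)
  \<comment> \<open>Straight triples say nothing about length 4. Here the sign is kept along the
    axis because a reversal would give two points at distance 2 the same image.\<close>
  have "\<exists>e\<in>{1, -1}. \<forall>m. F (move i (int m) z) = move i (int m * e) (F z)" if i: "i \<in> J" for i
  proof -
    obtain e where e: "e \<in> {1, -1}" "F (move i 1 z) = move i e (F z)"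
      using step[OF z i, of 1] by auto
    have "F (move i (int m) z) = move i (int m * e) (F z) \<and>
        F (move i (int (Suc m)) z) = move i (int (Suc m) * e) (F z)" for m
    proof (induction m)
      case 0
      then show ?case using e z by (simp add: move_0)
    next
      case (Suc m)
      obtain e' where e': "e' \<in> {1, -1}"
        "F (move i 1 (move i (int (Suc m)) z)) = move i e' (F (move i (int (Suc m)) z))"
        using step[OF move_in i, of 1] by blast
      then have eq: "F (move i (int (Suc (Suc m))) z) = move i (e' + int (Suc m) * e) (F z)"
        using Suc.IH by (simp add: move_move algebra_simps)
      have "e' = e"
      proof (rule ccontr)
        assume "e' \<noteq> e"
        then have "e' = -e" using e e' by auto
        then have "F (move i (int (Suc (Suc m))) z) = F (move i (int m) z)"
          using eq Suc.IH by (simp add: algebra_simps)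
        then have "N i dvd 2" using i by (simp add: F_eq move_eq_iff)
        then show False using N3[OF i] zdvd_imp_le[of "N i" 2] by simp
      qed
      then show ?case using eq Suc.IH by (simp add: algebra_simps)
    qed
    then show ?thesis using e by blast
  qed
  then obtain s0 where s0: "\<And>i. i \<in> J \<Longrightarrow> s0 i \<in> {1, -1}"
      "\<And>i m. i \<in> J \<Longrightarrow> F (move i (int m) z) = move i (int m * s0 i) (F z)"
    by metis
  \<comment> \<open>\<open>affines\<close> asks for a sign at every index, hence the value 1 outside
    \<open>J\<close>.\<close>
  define s where "s i = (if i \<in> J then s0 i else 1)" for i
  have "F v = affine N J s (F z) v" if v: "v \<in> B" for v
  proof
    fix i
    show "F v i = affine N J s (F z) v i"
    proof (cases "i \<in> J")
      case True
      have vi: "0 \<le> v i" "v i < N i" using v True by (auto simp: box_def)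
      have "F v i = F (move i (v i) z) i"
        by (rule coord[OF v move_in True]) (use vi True in \<open>simp add: move_def disp_def z_def\<close>)
      also have "\<dots> = move i (v i * s0 i) (F z) i"
        using s0(2)[OF True, of "nat (v i)"] vi by simp
      also have "\<dots> = affine N J s (F z) v i"
        using True by (simp add: move_def disp_def affine_def s_def algebra_simps)
      finally show ?thesis .
    next
      case False
      then show ?thesis using F_in[OF v] by (simp add: affine_def box_def)
    qed
  qed
  moreover have "affine N J s (F z) \<in> affines N J"
    unfolding affines_def
    by (intro CollectI exI[of _ s] exI[of _ "F z"]) (use s0(1) in \<open>auto simp: s_def\<close>)
  ultimately show ?thesis by blast
qed

lemma affine_in [simp]: "affine N J s t v \<in> B"
  using N3 by (fastforce simp: box_def affine_def)

lemma affine_nbr: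
  assumes s: "\<And>i. i \<in> J \<Longrightarrow> s i \<in> {1, -1}" and "nbr u v"
  shows "nbr (affine N J s t u) (affine N J s t v)"
proof -
  obtain i d where i: "i \<in> J" "d \<in> {1, -1}" "v = move i d u" using assms(2) by (auto simp: nbr_def)
  have "affine N J s t v = move i (s i * d) (affine N J s t u)"
    by (auto simp: i(3) affine_def move_def disp_def fun_eq_iff affine_mod mod_simps)
      (simp add: algebra_simps)
  moreover have "s i * d \<in> {1, -1}" using s[OF i(1)] i(2) by auto
  ultimately show ?thesis using i(1) by (auto simp: nbr_def)
qed

text \<open>Applied twice, the map adds \<open>s i * t i + t i\<close> in coordinate
  \<open>i\<close>. This covers the half turn (\<open>s i = 1\<close>, \<open>2 * t i = N i\<close>)
  as well as every reflection (\<open>s i = -1\<close>).\<close>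

lemma affine_involution:
  assumes "\<And>i. i \<in> J \<Longrightarrow> s i * s i = 1" "\<And>i. i \<in> J \<Longrightarrow> N i dvd s i * t i + t i" and "v \<in> B"
  shows "affine N J s t (affine N J s t v) = v"
proof
  fix i
  show "affine N J s t (affine N J s t v) i = v i"
  proof (cases "i \<in> J")
    case True
    have "(s i * ((s i * v i + t i) mod N i) + t i) mod N i = (s i * (s i * v i + t i) + t i) mod N i"
      by (rule affine_mod)
    also have "s i * (s i * v i + t i) + t i = (s i * s i) * v i + (s i * t i + t i)"
      by (simp add: algebra_simps)
    also have "(s i * s i * v i + (s i * t i + t i)) mod N i = (v i + 0) mod N i"
      using assms(1,2)[OF True] mod_add_cong[of "v i" "N i" "v i" "s i * t i + t i" 0] by simp
    also have "\<dots> = v i" using assms(3) True by (simp add: box_def)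
    finally show ?thesis using True by (simp add: affine_def)
  qed (use assms in \<open>auto simp: affine_def box_def\<close>)
qed

end

section \<open>Rigid pairings\<close>

definition obeys :: "'a set \<Rightarrow> ('a \<Rightarrow> 'a) \<Rightarrow> ('a \<Rightarrow> bool) \<Rightarrow> ('a \<Rightarrow> bool) \<Rightarrow> bool" where
  "obeys V \<mu> \<delta> c \<longleftrightarrow> (\<forall>v\<in>V. \<mu> v \<noteq> v \<longrightarrow> (c (\<mu> v) \<noteq> c v \<longleftrightarrow> \<delta> v))"

text \<open>The color of one vertex in each pair is up to Rascal, hence the quantification over all
  colorings that obey the pairing.\<close>

definition rigid :: "'a set \<Rightarrow> ('a \<Rightarrow> 'a) set \<Rightarrow> ('a \<Rightarrow> 'a) \<Rightarrow> ('a \<Rightarrow> bool) \<Rightarrow> bool" where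
  "rigid V G \<mu> \<delta> \<longleftrightarrow> (\<forall>v\<in>V. \<mu> v \<in> V \<and> \<mu> (\<mu> v) = v \<and> \<delta> (\<mu> v) = \<delta> v) \<and>
     (\<forall>c. obeys V \<mu> \<delta> c \<longrightarrow> (\<forall>g\<in>G. (\<forall>v\<in>V. c (g v) = c v) \<longrightarrow> (\<forall>v\<in>V. g v = v)))"

definition odd_rigid :: "'a set \<Rightarrow> ('a \<Rightarrow> 'a) set \<Rightarrow> bool" where
  "odd_rigid V G \<longleftrightarrow> (\<exists>\<mu> \<delta>. rigid V G \<mu> \<delta> \<and> (\<exists>!v. v \<in> V \<and> \<mu> v = v))"

definition dihedral :: "int \<Rightarrow> (int \<Rightarrow> int) set" where
  "dihedral n = {\<lambda>x. (s * x + t) mod n | s t. s \<in> {1, -1}}"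

definition prod_maps :: "('a \<Rightarrow> 'a) set \<Rightarrow> ('b \<Rightarrow> 'b) set \<Rightarrow> ('a \<times> 'b \<Rightarrow> 'a \<times> 'b) set" where
  "prod_maps G H = {map_prod f g | f g. f \<in> G \<and> g \<in> H}"

lemma odd_rigidE:
  assumes "odd_rigid V G"
  obtains \<mu> \<delta> v0 where "\<And>v. v \<in> V \<Longrightarrow> \<mu> v \<in> V" "\<And>v. v \<in> V \<Longrightarrow> \<mu> (\<mu> v) = v"
      "\<And>v. v \<in> V \<Longrightarrow> \<delta> (\<mu> v) = \<delta> v"
    and "\<And>c g v. obeys V \<mu> \<delta> c \<Longrightarrow> g \<in> G \<Longrightarrow> (\<And>v. v \<in> V \<Longrightarrow> c (g v) = c v) \<Longrightarrow> v \<in> V \<Longrightarrow> g v = v"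
    and "v0 \<in> V" "\<mu> v0 = v0" "\<And>v. v \<in> V \<Longrightarrow> \<mu> v = v \<Longrightarrow> v = v0"
proof -
  obtain \<mu> \<delta> where rig: "rigid V G \<mu> \<delta>" and "\<exists>!v. v \<in> V \<and> \<mu> v = v"
    using assms unfolding odd_rigid_def by (elim exE conjE)
  then obtain v0 where "v0 \<in> V" "\<mu> v0 = v0" "\<And>v. v \<in> V \<Longrightarrow> \<mu> v = v \<Longrightarrow> v = v0"
    by blast
  then show ?thesis
    using rig unfolding rigid_def by (intro that[of \<mu> \<delta> v0]) blast+
qed

text \<open>Adding a cycle needs the pairing itself and not merely the strategy behind
  \<open>forces\<close>, hence this counterpart of \<open>forces_transport\<close>.\<close>

lemma odd_rigid_transport:
  assumes rig: "odd_rigid V G" and h: "bij_betw h V' V"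
    and G': "\<And>g' v. g' \<in> G' \<Longrightarrow> v \<in> V' \<Longrightarrow> g' v \<in> V'"
    and com: "\<And>g'. g' \<in> G' \<Longrightarrow> \<exists>g\<in>G. \<forall>v\<in>V'. h (g' v) = g (h v)"
  shows "odd_rigid V' G'"
proof -
  from rig obtain \<mu> \<delta> v0 where \<mu>: "\<And>v. v \<in> V \<Longrightarrow> \<mu> v \<in> V" "\<And>v. v \<in> V \<Longrightarrow> \<mu> (\<mu> v) = v"
      "\<And>v. v \<in> V \<Longrightarrow> \<delta> (\<mu> v) = \<delta> v"
    and rigid: "\<And>c g v. obeys V \<mu> \<delta> c \<Longrightarrow> g \<in> G \<Longrightarrow> (\<And>v. v \<in> V \<Longrightarrow> c (g v) = c v) \<Longrightarrow> v \<in> V \<Longrightarrow> g v = v"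
    and v0: "v0 \<in> V" "\<mu> v0 = v0" "\<And>v. v \<in> V \<Longrightarrow> \<mu> v = v \<Longrightarrow> v = v0"
    by (rule odd_rigidE) blast
  define k where "k = inv_into V' h"
  have hV: "h v \<in> V" if "v \<in> V'" for v using that h by (auto simp: bij_betw_def)
  have kV: "k v \<in> V'" if "v \<in> V" for v
    using that h by (auto simp: bij_betw_def k_def intro: inv_into_into)
  have hk: "h (k v) = v" if "v \<in> V" for v
    using that h by (auto simp: bij_betw_def k_def f_inv_into_f)
  have kh: "k (h v) = v" if "v \<in> V'" for v
    using that h by (auto simp: bij_betw_def k_def)
  have "rigid V' G' (\<lambda>v. k (\<mu> (h v))) (\<lambda>v. \<delta> (h v))"
    unfolding rigid_def
  proof (intro conjI ballI allI impI)
    fix c g v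
    assume c: "obeys V' (\<lambda>v. k (\<mu> (h v))) (\<lambda>v. \<delta> (h v)) c" and g: "g \<in> G'"
      and inv: "\<forall>v\<in>V'. c (g v) = c v" and v: "v \<in> V'"
    obtain f where f: "f \<in> G" "\<And>v. v \<in> V' \<Longrightarrow> h (g v) = f (h v)" using com[OF g] by blast
    have "obeys V \<mu> \<delta> (\<lambda>v. c (k v))"
      unfolding obeys_def
    proof (intro ballI impI)
      fix u assume u: "u \<in> V" "\<mu> u \<noteq> u"
      then have "k (\<mu> (h (k u))) \<noteq> k u" using hk kV \<mu>(1) by metis
      then show "c (k (\<mu> u)) \<noteq> c (k u) \<longleftrightarrow> \<delta> u"
        using c u kV unfolding obeys_def by (metis hk)
    qed
    moreover have "c (k (f u)) = c (k u)" if u: "u \<in> V" for u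
    proof -
      have "f u = h (g (k u))" using f(2)[OF kV[OF u]] hk[OF u] by simp
      then have "k (f u) = g (k u)" using kh G'[OF g kV[OF u]] by simp
      then show ?thesis using inv kV[OF u] by simp
    qed
    ultimately have "f (h v) = h v" using rigid f(1) hV[OF v] by blast
    then show "g v = v" using f(2)[OF v] kh v G'[OF g v] by metis
  qed (use hV kV hk kh \<mu> in auto)
  moreover have "\<exists>!v. v \<in> V' \<and> k (\<mu> (h v)) = v"
  proof (rule ex1I[of _ "k v0"])
    show "k v0 \<in> V' \<and> k (\<mu> (h (k v0))) = k v0" using v0(1,2) kV hk by simp
    fix v assume "v \<in> V' \<and> k (\<mu> (h v)) = v"
    then show "v = k v0" using v0(3)[of "h v"] hV hk kh \<mu>(1) by metis
  qed
  ultimately show ?thesis unfolding odd_rigid_def by blast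
qed

section \<open>Reflections and counting modulo an odd number\<close>

lemma odd_dvd_double: "odd (n::int) \<Longrightarrow> n dvd 2 * z \<longleftrightarrow> n dvd z"
  by (simp add: coprime_dvd_mult_right_iff)

text \<open>\<open>(n + 1) div 2\<close> is the inverse of 2 modulo \<open>n\<close>. The value
  \<open>h\<close> serves as center of the reflection \<open>x \<mapsto> t - x\<close> and as half
  of the translation by \<open>t\<close>.\<close>

lemma odd_half:
  assumes "odd (n::int)"
  obtains h where "(2 * h - t) mod n = 0"
proof
  show "(2 * (t * ((n + 1) div 2)) - t) mod n = 0"
  proof -
    have "2 * ((n + 1) div 2) = n + 1" using assms by presburger
    then have "2 * (t * ((n + 1) div 2)) - t = t * n"
      by (metis (no_types, opaque_lifting) add_diff_cancel_right' distrib_left mult.assoc mult.commute mult.right_neutral)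
    then show ?thesis by simp
  qed
qed

lemma reflect_eq_self_iff:
  assumes "odd n" "x \<in> {0..<n}" "a \<in> {0..<n}"
  shows "(2 * a - x) mod n = x \<longleftrightarrow> x = (a::int)"
proof
  assume "(2 * a - x) mod n = x"
  then have "(2 * a - x) mod n = x mod n" using assms by simp
  then have "n dvd 2 * (a - x)" unfolding mod_eq_dvd_iff by (simp add: right_diff_distrib)
  then have "n dvd a - x" using assms(1) odd_dvd_double by blast
  then show "x = a" using small_dvd[of n "a - x"] assms by auto
qed (use assms in auto)

lemma reflect_reflect: "x \<in> {0..<n} \<Longrightarrow> (2 * a - (2 * a - x) mod n) mod n = (x::int)"
  by (simp add: mod_simps)

lemma reflect_eq_center_iff:
  assumes "x \<in> {0..<n}" "a \<in> {0..<n}"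
  shows "(2 * a - x) mod n = a \<longleftrightarrow> x = (a::int)"
proof
  assume "(2 * a - x) mod n = a"
  then show "x = a" using reflect_reflect[OF assms(1), of a] assms(2) by simp
qed (use assms in auto)

text \<open>The reflection about \<open>a\<close> exchanges the points with \<open>c\<close> and
  those without it, \<open>a\<close> apart, so exactly half of them have it.\<close>

lemma card_antisymmetric:
  assumes "odd (n::int)" "a \<in> {0..<n}"
    and c: "\<And>x. x \<in> {0..<n} \<Longrightarrow> x \<noteq> a \<Longrightarrow> c ((2 * a - x) mod n) \<noteq> c x"
  shows "2 * int (card {x \<in> {0..<n}. c x}) = n - 1 + (if c a then 2 else 0)"
proof -
  let ?S = "{0..<n} - {a}"
  define A B where "A = {x \<in> ?S. c x}" and "B = {x \<in> ?S. \<not> c x}"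
  have fin: "finite A" "finite B"
    unfolding A_def B_def by (auto intro: finite_subset[of _ "{0..<n}"])
  have "bij_betw (\<lambda>x. (2 * a - x) mod n) A B"
    unfolding A_def B_def
    by (rule bij_betw_byWitness[where f' = "\<lambda>x. (2 * a - x) mod n"])
      (use assms reflect_eq_center_iff[of _ n a] c reflect_reflect[of _ n a] in auto)
  then have "card A = card B" by (rule bij_betw_same_card)
  moreover have "A \<union> B = ?S" "A \<inter> B = {}" by (auto simp: A_def B_def)
  then have "card A + card B = card ?S" using fin by (metis card_Un_disjoint)
  moreover have "int (card ?S) = n - 1"
    using assms(2) by (simp add: int_ops(6))
  moreover have "card {x \<in> {0..<n}. c x} = card A + (if c a then 1 else 0)"
  proof (cases "c a")
    case True
    then have "{x \<in> {0..<n}. c x} = insert a A" using assms(2) by (auto simp: A_def)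
    then show ?thesis using True fin by (simp add: A_def)
  next
    case False
    then have "{x \<in> {0..<n}. c x} = A" by (auto simp: A_def)
    then show ?thesis using False by simp
  qed
  ultimately show ?thesis by (auto split: if_splits)
qed

lemma bij_dihedral:
  assumes "0 < n" "f \<in> dihedral n"
  shows "bij_betw f {0..<n} {0..<n}"
proof -
  obtain s t where f: "f = (\<lambda>x. (s * x + t) mod n)" and s: "s \<in> {1, -1}"
    using assms(2) by (auto simp: dihedral_def)
  have ss: "s * s = 1" using s by auto
  have "(s * ((s * x + t) mod n) - s * t) mod n = x" if "x \<in> {0..<n}" for x
  proof -
    have "(s * ((s * x + t) mod n) - s * t) mod n = (s * (s * x + t) - s * t) mod n"
      using affine_mod[of s _ n "- (s * t)"] by simp
    also have "s * (s * x + t) - s * t = (s * s) * x" by (simp add: algebra_simps)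
    finally show ?thesis using that ss by simp
  qed
  then have "\<forall>x\<in>{0..<n}. (s * f x - s * t) mod n = x" unfolding f by blast
  moreover have "(s * ((s * x - s * t) mod n) + t) mod n = x" if "x \<in> {0..<n}" for x
  proof -
    have "s * (s * x - s * t) + t = (s * s) * x + (1 - s * s) * t" by (simp add: algebra_simps)
    then show ?thesis using that ss by (simp add: affine_mod)
  qed
  then have "\<forall>x\<in>{0..<n}. f ((s * x - s * t) mod n) = x" unfolding f by blast
  moreover have "f ` {0..<n} \<subseteq> {0..<n}" "(\<lambda>x. (s * x - s * t) mod n) ` {0..<n} \<subseteq> {0..<n}"
    unfolding f using assms(1) by auto
  ultimately show ?thesis by (rule bij_betw_byWitness)
qed

lemma rows_same_card:
  assumes "0 < n" "f \<in> dihedral n" and "\<And>x. x \<in> {0..<n} \<Longrightarrow> c (f x) \<longleftrightarrow> c' x"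
  shows "card {x \<in> {0..<n}. c x} = card {x \<in> {0..<n}. c' x}"
proof -
  have bij: "bij_betw f {0..<n} {0..<n}" using assms by (intro bij_dihedral)
  then have "{x \<in> {0..<n}. c x} = f ` {x \<in> {0..<n}. c' x}"
  proof (intro equalityI subsetI)
    fix y assume y: "y \<in> {x \<in> {0..<n}. c x}"
    then have "y \<in> f ` {0..<n}" using bij by (simp add: bij_betw_def)
    then obtain x where "x \<in> {0..<n}" "y = f x" by blast
    then show "y \<in> f ` {x \<in> {0..<n}. c' x}" using assms(3) y by blast
  next
    fix y assume "y \<in> f ` {x \<in> {0..<n}. c' x}"
    then show "y \<in> {x \<in> {0..<n}. c x}" using assms(3) bij by (auto simp: bij_betw_def)
  qed
  moreover have "inj_on f {x \<in> {0..<n}. c' x}"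
    using bij by (auto simp: bij_betw_def intro: inj_on_subset)
  ultimately show ?thesis by (simp add: card_image)
qed

text \<open>Every row \<open>{0..<n} \<times> {y}\<close> is paired up by a reflection, with different colors in each
  pair, except for its center. So the number of vertices of a color in a row determines the
  color of the center, and the centers are left to the pairing of \<^term>\<open>Y\<close>. As every point
  is the center of a row, no reflection of the rows preserves the coloring.\<close>

lemma odd_rigid_Times:
  assumes n: "odd n" "3 \<le> n" and Y: "finite Y" "n \<le> int (card Y)"
    and H: "\<And>h y. h \<in> H \<Longrightarrow> y \<in> Y \<Longrightarrow> h y \<in> Y"
    and rig: "odd_rigid Y H"
  shows "odd_rigid ({0..<n} \<times> Y) (prod_maps (dihedral n) H)"
proof -
  from rig obtain \<nu> \<epsilon> y0 where \<nu>: "\<And>v. v \<in> Y \<Longrightarrow> \<nu> v \<in> Y" "\<And>v. v \<in> Y \<Longrightarrow> \<nu> (\<nu> v) = v"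
      "\<And>v. v \<in> Y \<Longrightarrow> \<epsilon> (\<nu> v) = \<epsilon> v"
    and rigid: "\<And>c g v. obeys Y \<nu> \<epsilon> c \<Longrightarrow> g \<in> H \<Longrightarrow> (\<And>v. v \<in> Y \<Longrightarrow> c (g v) = c v) \<Longrightarrow> v \<in> Y \<Longrightarrow> g v = v"
    and y0: "y0 \<in> Y" "\<nu> y0 = y0" "\<And>v. v \<in> Y \<Longrightarrow> \<nu> v = v \<Longrightarrow> v = y0"
    by (rule odd_rigidE) blast
  \<comment> \<open>The bound on \<open>card Y\<close> leaves room for each element of
    \<open>{0..<n}\<close> to be the center of some row; rows outside the image of
    \<open>\<iota>\<close> get center 0.\<close>
  obtain \<iota> where \<iota>: "inj_on \<iota> {0..<n}" "\<iota> ` {0..<n} \<subseteq> Y"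
    using card_le_inj[of "{0..<n}" Y] Y n by (auto simp: nat_le_iff)
  define a where "a y = (if y \<in> \<iota> ` {0..<n} then inv_into {0..<n} \<iota> y else 0)" for y
  have a_in: "a y \<in> {0..<n}" for y
  proof (cases "y \<in> \<iota> ` {0..<n}")
    case True
    then show ?thesis by (simp only: a_def if_True inv_into_into)
  qed (use n in \<open>simp add: a_def\<close>)
  have a_surj: "\<exists>y\<in>Y. a y = x" if "x \<in> {0..<n}" for x
    using that \<iota> by (intro bexI[of _ "\<iota> x"]) (auto simp: a_def)
  define \<mu> where "\<mu> = (\<lambda>(x, y). if x = a y then (a (\<nu> y), \<nu> y) else ((2 * a y - x) mod n, y))"
  \<comment> \<open>Outside the centers the implication is vacuous, so all reflected pairs are
    bicolored.\<close>
  define \<delta> where "\<delta> = (\<lambda>(x, y). x = a y \<longrightarrow> \<epsilon> y)"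
  have refl: "(2 * a y - x) mod n = x \<longleftrightarrow> x = a y" "(2 * a y - x) mod n = a y \<longleftrightarrow> x = a y"
    if "x \<in> {0..<n}" for x y
  proof -
    show "(2 * a y - x) mod n = x \<longleftrightarrow> x = a y" using reflect_eq_self_iff n that a_in by blast
    show "(2 * a y - x) mod n = a y \<longleftrightarrow> x = a y" using reflect_eq_center_iff that a_in by blast
  qed
  have \<mu>: "\<mu> v \<in> {0..<n} \<times> Y \<and> \<mu> (\<mu> v) = v \<and> \<delta> (\<mu> v) = \<delta> v" if "v \<in> {0..<n} \<times> Y" for v
  proof -
    obtain x y where v: "v = (x, y)" "x \<in> {0..<n}" "y \<in> Y" using \<open>v \<in> _\<close> by blast
    show ?thesis
      using \<nu>[OF v(3)] a_in[of "\<nu> y"] refl[OF v(2), of y] n v(2,3) reflect_reflect[OF v(2), of "a y"]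
      by (auto simp: v \<mu>_def \<delta>_def)
  qed
  have center: "v = (a y0, y0)" if "v \<in> {0..<n} \<times> Y" "\<mu> v = v" for v
  proof -
    obtain x y where v: "v = (x, y)" "x \<in> {0..<n}" "y \<in> Y" using \<open>v \<in> _\<close> by blast
    have "x = a y" "\<nu> y = y"
      using refl[OF v(2), of y] that(2) by (auto simp: v(1) \<mu>_def split: if_splits)
    then show ?thesis using y0(3) v by blast
  qed
  have "rigid ({0..<n} \<times> Y) (prod_maps (dihedral n) H) \<mu> \<delta>"
    unfolding rigid_def
  proof (intro conjI allI impI ballI)
    fix c g v
    assume c: "obeys ({0..<n} \<times> Y) \<mu> \<delta> c" and g: "g \<in> prod_maps (dihedral n) H"
      and inv: "\<forall>v\<in>{0..<n} \<times> Y. c (g v) = c v" and v: "v \<in> {0..<n} \<times> Y"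
    obtain f \<psi> where f: "f \<in> dihedral n" and \<psi>: "\<psi> \<in> H" and gf: "g = map_prod f \<psi>"
      using g by (auto simp: prod_maps_def)
    have row: "c ((2 * a y - x) mod n, y) \<noteq> c (x, y)" if "x \<in> {0..<n}" "y \<in> Y" "x \<noteq> a y" for x y
      using bspec[OF c[unfolded obeys_def], of "(x, y)"] that refl[OF that(1), of y]
      by (auto simp: \<mu>_def \<delta>_def)
    have count: "2 * int (card {x \<in> {0..<n}. c (x, y)}) = n - 1 + (if c (a y, y) then 2 else 0)"
      if "y \<in> Y" for y
      by (rule card_antisymmetric[of n "a y" "\<lambda>x. c (x, y)"]) (use n a_in row that in auto)
    \<comment> \<open>Row \<open>y\<close> is mapped onto row \<open>\<psi> y\<close>, so the counts
      agree and with them the colors of the centers. As the centers obey the pairing of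
      \<open>Y\<close>, this will make \<open>\<psi>\<close> the identity.\<close>
    have "c (a (\<psi> y), \<psi> y) = c (a y, y)" if y: "y \<in> Y" for y
    proof -
      have "card {x \<in> {0..<n}. c (x, \<psi> y)} = card {x \<in> {0..<n}. c (x, y)}"
        by (rule rows_same_card[of n f]) (use n f inv y in \<open>auto simp: gf\<close>)
      then show ?thesis using count[OF y] count[OF H[OF \<psi> y]] by (auto split: if_splits)
    qed
    moreover have "obeys Y \<nu> \<epsilon> (\<lambda>y. c (a y, y))"
      unfolding obeys_def
    proof (intro ballI impI)
      fix y assume "y \<in> Y" "\<nu> y \<noteq> y"
      then show "c (a (\<nu> y), \<nu> y) \<noteq> c (a y, y) \<longleftrightarrow> \<epsilon> y"
        using bspec[OF c[unfolded obeys_def], of "(a y, y)"] a_in[of y] by (auto simp: \<mu>_def \<delta>_def)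
    qed
    ultimately have \<psi>_id: "\<psi> y = y" if "y \<in> Y" for y
      using rigid[OF _ \<psi>] that by blast
    have c_f: "c (f x, y) = c (x, y)" if "x \<in> {0..<n}" "y \<in> Y" for x y
      using inv that \<psi>_id by (force simp: gf)
    obtain s t where st: "f = (\<lambda>x. (s * x + t) mod n)" "s \<in> {1, -1}"
      using f by (auto simp: dihedral_def)
    have "f x = x" if x: "x \<in> {0..<n}" for x
    proof -
      obtain h where h: "(2 * h - t) mod n = 0" using odd_half n(1) by blast
      consider "s = 1" "n dvd t" | "s = 1" "\<not> n dvd t" | "s = -1" using st(2) by auto
      then show ?thesis
      proof cases
        case 1
        then show ?thesis using x by (auto simp: st elim!: dvdE)
      next
        case 2
        \<comment> \<open>As \<open>t\<close> is \<open>2 * h\<close> modulo \<open>n\<close>, the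
          translation takes \<open>a y0 - h\<close> to its mirror image \<open>a y0 + h\<close> in
          row \<open>y0\<close>, which has the other color.\<close>
        let ?x = "(a y0 - h) mod n"
        have "f ?x = (2 * a y0 - ?x) mod n"
          using 2 h by (auto simp: st mod_simps mod_eq_dvd_iff mod_0_imp_dvd algebra_simps)
        moreover have "?x \<noteq> a y0"
        proof
          assume "?x = a y0"
          then have "(a y0 - h) mod n = a y0 mod n" using a_in[of y0] by simp
          then have "n dvd h" by (simp add: mod_eq_dvd_iff)
          then have "n dvd 2 * h" by simp
          moreover have "n dvd 2 * h - t" using h by auto
          ultimately have "n dvd t" using dvd_diff[of n "2 * h" "2 * h - t"] by simp
          then show False using 2(2) by simp
        qed
        moreover have "?x \<in> {0..<n}" using n by simp
        ultimately show ?thesis using row[of ?x y0] c_f[of ?x y0] y0(1) by simp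
      next
        case 3
        \<comment> \<open>In a row with the same center as the reflection, \<open>f\<close>
          exchanges the vertices of each pair; \<open>x\<close> is just some vertex other than the
          center.\<close>
        obtain y where y: "y \<in> Y" "a y = h mod n" using a_surj[of "h mod n"] n by auto
        define x where "x = (if a y = 0 then 1 else 0 :: int)"
        have x: "x \<in> {0..<n}" "x \<noteq> a y" using n by (auto simp: x_def)
        have "(2 * a y - x) mod n = (2 * h - x) mod n"
          unfolding y by (metis mod_diff_left_eq mod_mult_right_eq)
        also have "\<dots> = f x"
          using 3 h by (simp add: st mod_eq_dvd_iff mod_0_imp_dvd)
        finally have "f x = (2 * a y - x) mod n" by simp
        then show ?thesis using row[OF x(1) y(1) x(2)] c_f[OF x(1) y(1)] by simp
      qed
    qed
    then show "g v = v" using v \<psi>_id by (auto simp: gf)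
  qed (use \<mu> in blast)+
  moreover have "\<exists>!v. v \<in> {0..<n} \<times> Y \<and> \<mu> v = v"
    by (rule ex1I[of _ "(a y0, y0)"]) (use center a_in y0(1,2) in \<open>auto simp: \<mu>_def\<close>)
  ultimately show ?thesis unfolding odd_rigid_def by blast
qed

section \<open>The product of a long and an arbitrary odd cycle\<close>

text \<open>A row of vertices \<open>0, \<dots>, n - 1\<close> is paired up by \<open>(1, 2), (3, 4), \<dots>, (n - 2, n - 1)\<close>;
  if \<^term>\<open>E\<close> holds, then the two colors differ in exactly the first and the last pair.\<close>

definition domino :: "int \<Rightarrow> bool \<Rightarrow> (int \<Rightarrow> bool) \<Rightarrow> bool" where
  "domino n E b \<longleftrightarrow> (\<forall>u. b (u mod n) = b u) \<and>
     (\<forall>u. odd u \<and> 1 \<le> u \<and> u \<le> n - 2 \<longrightarrow> (b (u + 1) \<noteq> b u \<longleftrightarrow> E \<and> (u = 1 \<or> u = n - 2)))"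

lemma domino_pair:
  "domino n E b \<Longrightarrow> odd u \<Longrightarrow> 1 \<le> u \<Longrightarrow> u \<le> n - 2 \<Longrightarrow> b (u + 1) \<noteq> b u \<longleftrightarrow> E \<and> (u = 1 \<or> u = n - 2)"
  unfolding domino_def by blast

lemma domino_cong: "domino n E b \<Longrightarrow> n dvd u - v \<Longrightarrow> b u = b v"
  unfolding domino_def by (metis mod_eq_dvd_iff)

lemma dihedralI: "s \<in> {1, -1} \<Longrightarrow> (\<lambda>x. (s * x + t) mod n) \<in> dihedral n"
  unfolding dihedral_def by blast

text \<open>Let \<open>r = t mod n\<close>. For odd \<open>r\<close> the first domino goes to
  \<open>(r - 2, r - 1)\<close>, for even \<open>r\<close> the last one goes to
  \<open>(r + 1, r + 2)\<close>. Apart from the three exceptions this is a unicolored domino, or the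
  same bicolored domino reversed; neither is possible.\<close>

lemma domino_reflection:
  assumes n: "odd n" "9 \<le> n" and b: "domino n True b" and refl: "\<And>u. b (t - u) = b u"
  shows "t mod n \<in> {0, 1, n - 1}"
proof (rule ccontr)
  define r where "r = t mod n"
  have refl: "b (r - u) = b u" for u
    using refl[of u] domino_cong[OF b, of "r - u" "t - u"] by (simp add: r_def mod_eq_dvd_iff[symmetric])
  assume "t mod n \<notin> {0, 1, n - 1}"
  then have r: "2 \<le> r" "r \<le> n - 2"
    using pos_mod_bound[of n t] pos_mod_sign[of n t] n unfolding r_def[symmetric] by auto
  have d: "b (u + 1) \<noteq> b u \<longleftrightarrow> u = 1 \<or> u = n - 2" if "odd u" "1 \<le> u" "u \<le> n - 2" for u
    using b that by (simp add: domino_def)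
  show False
  proof (cases "odd r")
    case True
    then have "3 \<le> r" using r by presburger
    then show ?thesis
      using d[of "r - 2"] d[of 1] refl[of 1] refl[of 2] True r by (auto simp: algebra_simps)
  next
    case False
    then have "r \<le> n - 3" using r n by presburger
    moreover have "b (r + 1) = b (n - 1)" "b (r + 2) = b (n - 2)"
      using refl[of "n - 1"] refl[of "n - 2"] domino_cong[OF b, of "r - (n - 1)" "r + 1"]
        domino_cong[OF b, of "r - (n - 2)" "r + 2"] by auto
    ultimately show ?thesis
      using d[of "r + 1"] d[of "n - 2"] False r n by (auto simp: algebra_simps)
  qed
qed

text \<open>An even shift \<open>r\<close> takes the first domino to \<open>(r + 1, r + 2)\<close>,
  which is unicolored if \<open>r \<le> n - 5\<close>. The shifts by -1 and -3 remain.\<close>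

lemma domino_translation:
  assumes n: "odd n" "9 \<le> n" and b: "domino n True b" and trans: "\<And>u. b (u + t) = b u"
  shows "n dvd t"
proof (rule ccontr)
  assume nt: "\<not> n dvd t"
  have d: "b (u + 1) \<noteq> b u \<longleftrightarrow> u = 1 \<or> u = n - 2" if "odd u" "1 \<le> u" "u \<le> n - 2" for u
    using b that by (simp add: domino_def)
  \<comment> \<open>The coloring is invariant under \<open>t\<close> and \<open>-t\<close>, and
    since \<open>n\<close> is odd, one of the two residues is even.\<close>
  define r where "r = (if even (t mod n) then t mod n else n - t mod n)"
  have "b (u + t mod n) = b u" for u
    using trans[of u] domino_cong[OF b, of "u + t" "u + t mod n"] by (simp add: mod_eq_dvd_iff[symmetric])
  moreover from this have "b (u + (n - t mod n)) = b u" for u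
    using domino_cong[OF b, of "u + n" u] by (metis add.assoc add_diff_cancel_left' diff_add_cancel dvd_refl)
  ultimately have shift: "b (u + r) = b u" for u by (simp add: r_def)
  have "t mod n \<noteq> 0" "0 \<le> t mod n" "t mod n < n" using nt n by auto
  moreover obtain q where q: "t mod n = q" by blast
  ultimately have "even r \<and> 2 \<le> r \<and> r \<le> n - 1"
    using n(1) unfolding r_def q by (cases "even q"; simp; presburger)
  then have r: "even r" "2 \<le> r" "r \<le> n - 1" by blast+
  then have "r = n - 1 \<or> r = n - 3 \<or> r \<le> n - 5" using n(1) by presburger
  then consider "r = n - 1" | "r = n - 3" | "r \<le> n - 5" by blast
  then show False
  proof cases
    case 1
    then show ?thesis
      using shift[of 2] domino_cong[OF b, of "2 + r" 1] d[of 1] n by simp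
  next
    case 2
    then have "b (u + 3) = b u" for u
      using shift[of "u + 3"] domino_cong[OF b, of "u + 3 + r" u] by simp
    \<comment> \<open>\<open>b 1 = b 4 = b 3 = b 6 = b 5 = b 2\<close>: the dominoes at 3 and 5 are
      unicolored because \<open>n \<ge> 9\<close>.\<close>
    from this[of 1] this[of 2] this[of 3] show ?thesis
      using d[of 1] d[of 3] d[of 5] n by simp
  next
    case 3
    then show ?thesis
      using shift[of 1] shift[of 2] d[of 1] d[of "1 + r"] r n by (auto simp: algebra_simps)
  qed
qed

text \<open>A bicolored domino of \<open>b\<close> would again be matched with a domino of
  \<open>z\<close>. All of these are unicolored, so \<open>t mod n = 0\<close> is excluded as
  well.\<close>

lemma domino_reflection_to:
  assumes n: "odd n" "9 \<le> n" and z: "domino n False z" and b: "domino n True b"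
    and refl: "\<And>u. z (t - u) = b u"
  shows "t mod n \<in> {1, n - 1}"
proof (rule ccontr)
  define r where "r = t mod n"
  have refl: "z (r - u) = b u" for u
    using refl[of u] domino_cong[OF z, of "r - u" "t - u"] by (simp add: r_def mod_eq_dvd_iff[symmetric])
  assume "t mod n \<notin> {1, n - 1}"
  then have r: "r \<noteq> 1" "r \<noteq> n - 1" "0 \<le> r" "r < n"
    using n unfolding r_def[symmetric] by (auto simp: r_def)
  have d: "b (u + 1) \<noteq> b u \<longleftrightarrow> u = 1 \<or> u = n - 2" if "odd u" "1 \<le> u" "u \<le> n - 2" for u
    using b that by (simp add: domino_def)
  have dz: "z (u + 1) = z u" if "odd u" "1 \<le> u" "u \<le> n - 2" for u
    using z that by (simp add: domino_def)
  show False
  proof (cases "odd r")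
    case True
    then have "3 \<le> r" using r by presburger
    then show ?thesis
      using dz[of "r - 2"] d[of 1] refl[of 1] refl[of 2] True r n by (auto simp: algebra_simps)
  next
    case False
    then have "r \<le> n - 3" using r n by presburger
    moreover have "z (r + 1) = b (n - 1)" "z (r + 2) = b (n - 2)"
      using refl[of "n - 1"] refl[of "n - 2"] domino_cong[OF z, of "r - (n - 1)" "r + 1"]
        domino_cong[OF z, of "r - (n - 2)" "r + 2"] by auto
    ultimately show ?thesis
      using dz[of "r + 1"] d[of "n - 2"] False r n by (auto simp: algebra_simps)
  qed
qed

text \<open>A domino contributes an odd number exactly if it is bicolored.\<close>

lemma odd_card_dominoes:
  "odd (card {u \<in> {0..<2 * int L + 1}. b u}) \<longleftrightarrow>
     (b 0 \<noteq> odd (card {j \<in> {..<L}. b (2 * int j + 2) \<noteq> b (2 * int j + 1)}))"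
proof (induction L)
  case 0
  have "{0..<2 * int 0 + 1} = {0}" by auto
  then have "{u \<in> {0..<2 * int 0 + 1}. b u} = (if b 0 then {0} else {})" by auto
  then show ?case by simp
next
  case (Suc L)
  define S where "S = {u \<in> {0..<2 * int L + 1}. b u}"
  define T where "T = {j \<in> {..<L}. b (2 * int j + 2) \<noteq> b (2 * int j + 1)}"
  have fin: "finite S" "finite T"
    unfolding S_def T_def by (auto intro: finite_subset[of _ "{0..<2 * int L + 1}"])
  let ?u = "2 * int L + 1"
  have "{u \<in> {0..<2 * int (Suc L) + 1}. b u} =
      S \<union> (if b ?u then {?u} else {}) \<union> (if b (?u + 1) then {?u + 1} else {})"
    unfolding S_def by (auto split: if_splits) (smt (verit))+
  moreover have "?u \<notin> S" "?u + 1 \<notin> S" by (auto simp: S_def)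
  ultimately have "odd (card {u \<in> {0..<2 * int (Suc L) + 1}. b u}) \<longleftrightarrow>
      (odd (card S) \<noteq> (b (?u + 1) \<noteq> b ?u))"
    using fin by auto
  moreover have "{j \<in> {..<Suc L}. b (2 * int j + 2) \<noteq> b (2 * int j + 1)} =
      (if b (?u + 1) \<noteq> b ?u then insert L T else T)"
    by (auto simp: T_def less_Suc_eq add.assoc)
  moreover have "L \<notin> T" by (simp add: T_def)
  ultimately show ?case
    using Suc.IH fin unfolding S_def[symmetric] T_def[symmetric] by auto
qed

text \<open>The number of bicolored dominoes is 0 or 2, so the parity of the row is decided by the
  left over vertex.\<close>

lemma domino_odd_card:
  assumes "odd n" "9 \<le> n" "domino n E b"
  shows "odd (card {u \<in> {0..<n}. b u}) \<longleftrightarrow> b 0"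
proof -
  define L where "L = nat (n div 2)"
  have "n = 2 * (n div 2) + 1" "4 \<le> n div 2" using assms(1,2) by presburger+
  then have n: "n = 2 * int L + 1" and L: "4 \<le> L" unfolding L_def by simp_all
  have "b (2 * int j + 2) \<noteq> b (2 * int j + 1) \<longleftrightarrow> E \<and> (j = 0 \<or> j = L - 1)" if "j < L" for j
  proof -
    have "odd (2 * int j + 1) \<and> 1 \<le> 2 * int j + 1 \<and> 2 * int j + 1 \<le> n - 2" using n that by simp
    then have "b (2 * int j + 1 + 1) \<noteq> b (2 * int j + 1) \<longleftrightarrow>
        E \<and> (2 * int j + 1 = 1 \<or> 2 * int j + 1 = n - 2)"
      using assms(3) unfolding domino_def by blast
    moreover have "2 * int j + 1 = n - 2 \<longleftrightarrow> j = L - 1" using n L by auto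
    ultimately show ?thesis by (simp add: add.assoc)
  qed
  then have "{j \<in> {..<L}. b (2 * int j + 2) \<noteq> b (2 * int j + 1)} =
      {j \<in> {..<L}. E \<and> (j = 0 \<or> j = L - 1)}"
    by (intro Collect_cong) blast
  also have "\<dots> = (if E then {0, L - 1} else {})" using L by auto
  finally have "even (card {j \<in> {..<L}. b (2 * int j + 2) \<noteq> b (2 * int j + 1)})"
    using L by auto
  then show ?thesis using odd_card_dominoes[of L b] unfolding n by simp
qed

text \<open>The rows \<open>{0..<n} \<times> {y}\<close> carry dominoes, which are shifted by 3 in the rows other than 0
  and 1, and colors differ inside the first and the last domino except in row 0. The left over vertices are paired
  up by \<open>y \<mapsto> -y\<close>, with different colors. As the parity of a row determines the color of its
  left over vertex, an automorphism can only fix all rows or reflect the rows about a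
  row \<open>r \<noteq> 0\<close>, and then it fixes row \<open>r\<close> and exchanges row \<open>0\<close> with row \<open>2 * r\<close>.\<close>

lemma odd_rigid_domino:
  assumes n: "odd n" "9 \<le> n" and m: "odd m" "3 \<le> m"
  shows "odd_rigid ({0..<n} \<times> {0..<m}) (prod_maps (dihedral n) (dihedral m))"
proof -
  \<comment> \<open>A reflection \<open>x \<mapsto> t - x\<close> that preserves a bicolored row
    with shift \<open>a\<close> has \<open>t\<close> within 1 of \<open>2 * a\<close>; the different
    shifts of rows 1 and 2 thus exclude one that preserves every row.\<close>
  define a :: "int \<Rightarrow> int" where "a y = (if y \<in> {0, 1} then 0 else 3)" for y
  define partner :: "int \<Rightarrow> int" where
    "partner u = (if u = 0 then 0 else if odd u then u + 1 else u - 1)" for u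
  define P where "P y x = (partner ((x - a y) mod n) + a y) mod n" for x y
  define \<mu> where "\<mu> = (\<lambda>(x, y). if x = a y then (a (- y mod m), - y mod m) else (P y x, y))"
  define \<delta> where "\<delta> = (\<lambda>(x, y). x = a y \<or> y \<noteq> 0 \<and> (x - a y) mod n \<in> {1, 2, n - 2, n - 1})"
  have a_in: "0 \<le> a y" "a y < n" for y using n by (auto simp: a_def)
  have partner: "partner u \<in> {1..<n}" "partner (partner u) = u" "partner u \<noteq> u"
      "partner u \<in> {1, 2, n - 2, n - 1} \<longleftrightarrow> u \<in> {1, 2, n - 2, n - 1}"
    if "u \<in> {1..<n}" for u
    using that n unfolding partner_def by (auto, presburger+)
  have sub: "(x - a y) mod n \<in> {1..<n}" if "x \<in> {0..<n}" "x \<noteq> a y" for x y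
  proof -
    have "\<bar>x - a y\<bar> < n" using that a_in[of y] by (simp add: abs_less_iff)
    then have "(x - a y) mod n \<noteq> 0"
      using that(2) small_dvd[of n "x - a y"] by auto
    moreover have "0 \<le> (x - a y) mod n" "(x - a y) mod n < n" using n by simp_all
    ultimately show ?thesis by auto
  qed
  have shift_back: "((x - a y) mod n + a y) mod n = x" if "x \<in> {0..<n}" for x y
    using that by (simp add: mod_simps)
  have P: "P y x \<in> {0..<n}" "(P y x - a y) mod n = partner ((x - a y) mod n)"
      "P y x \<noteq> x" "P y x \<noteq> a y" "P y (P y x) = x"
    if x: "x \<in> {0..<n}" "x \<noteq> a y" for x y
  proof -
    note p = partner[OF sub[OF x]]
    show 1: "P y x \<in> {0..<n}" using n by (simp add: P_def)
    show 2: "(P y x - a y) mod n = partner ((x - a y) mod n)"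
      using p(1) by (simp add: P_def mod_simps)
    show "P y x \<noteq> x" using 2 p(3) by metis
    show "P y x \<noteq> a y" using 2 p(1) by auto
    have "P y (P y x) = (partner ((P y x - a y) mod n) + a y) mod n" by (simp add: P_def)
    then show "P y (P y x) = x" using p(2) shift_back[OF x(1)] by (simp add: 2)
  qed
  have neg: "(- y mod m) mod m = - y mod m" "- (- y mod m) mod m = y" "- y mod m \<in> {0..<m}"
      "- y mod m = y \<longleftrightarrow> y = 0" if "y \<in> {0..<m}" for y
  proof -
    show "- (- y mod m) mod m = y" using that by (simp add: mod_simps)
    show "- y mod m = y \<longleftrightarrow> y = 0"
      using reflect_eq_self_iff[of m y 0] m that by simp
  qed (use m in auto)
  have \<mu>: "\<mu> v \<in> {0..<n} \<times> {0..<m} \<and> \<mu> (\<mu> v) = v \<and> \<delta> (\<mu> v) = \<delta> v"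
    if "v \<in> {0..<n} \<times> {0..<m}" for v
  proof -
    obtain x y where v: "v = (x, y)" "x \<in> {0..<n}" "y \<in> {0..<m}" using \<open>v \<in> _\<close> by blast
    show ?thesis
    proof (cases "x = a y")
      case True
      then show ?thesis using neg[OF v(3)] a_in[of "- y mod m"] v by (simp add: v(1) \<mu>_def \<delta>_def)
    next
      case False
      then show ?thesis using P[OF v(2) False] partner(4)[OF sub[OF v(2) False]] v
        by (simp add: v(1) \<mu>_def \<delta>_def)
    qed
  qed
  have fixed: "v = (0, 0)" if "v \<in> {0..<n} \<times> {0..<m}" "\<mu> v = v" for v
  proof -
    obtain x y where v: "v = (x, y)" "x \<in> {0..<n}" "y \<in> {0..<m}" using \<open>v \<in> _\<close> by blast
    show ?thesis
      using P(3)[OF v(2), of y] neg(4)[OF v(3)] that(2)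
      by (auto simp: v(1) \<mu>_def a_def split: if_splits)
  qed
  have "rigid ({0..<n} \<times> {0..<m}) (prod_maps (dihedral n) (dihedral m)) \<mu> \<delta>"
    unfolding rigid_def
  proof (intro conjI allI impI ballI)
    fix c g v
    assume c: "obeys ({0..<n} \<times> {0..<m}) \<mu> \<delta> c" and g: "g \<in> prod_maps (dihedral n) (dihedral m)"
      and inv: "\<forall>v\<in>{0..<n} \<times> {0..<m}. c (g v) = c v" and v: "v \<in> {0..<n} \<times> {0..<m}"
    obtain s t s' t' where st: "s \<in> {1, -1}" "s' \<in> {1, -1}"
      and g: "g = map_prod (\<lambda>x. (s * x + t) mod n) (\<lambda>y. (s' * y + t') mod m)"
      using g by (auto simp: prod_maps_def dihedral_def)
    \<comment> \<open>The periodic extension of the coloring, on which translations and reflections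
      need no reduction.\<close>
    define C where "C x y = c (x mod n, y mod m)" for x y
    have C_cong: "C x y = C x' y'" if "n dvd x - x'" "m dvd y - y'" for x x' y y'
      using that by (simp add: C_def mod_eq_dvd_iff[symmetric])
    have C_inv: "C (s * x + t) (s' * y + t') = C x y" for x y
      using bspec[OF inv, of "(x mod n, y mod m)"] n m by (simp add: C_def g affine_mod)
    define A where "A y = a (y mod m)" for y
    have A_cong: "A y = A y'" if "m dvd y - y'" for y y'
      using that by (simp add: A_def mod_eq_dvd_iff[symmetric])
    have domino: "domino n (\<not> m dvd y) (\<lambda>u. C (u + A y) y)" for y
      unfolding domino_def
    proof (intro conjI allI impI)
      fix u show "C (u mod n + A y) y = C (u + A y) y"
        by (simp add: C_def mod_simps)
    next
      fix u assume u: "odd u \<and> 1 \<le> u \<and> u \<le> n - 2"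
      let ?x = "(u + A y) mod n" and ?y = "y mod m"
      have x: "?x \<in> {0..<n}" "?y \<in> {0..<m}" using n m by auto
      have xa: "(?x - a ?y) mod n = u" using u by (simp add: A_def mod_simps)
      then have ne: "?x \<noteq> a ?y" using u by auto
      have "P ?y ?x = (u + 1 + A y) mod n"
        using u by (simp add: P_def xa) (simp add: partner_def A_def)
      then have "C (u + 1 + A y) y \<noteq> C (u + A y) y \<longleftrightarrow> \<delta> (?x, ?y)"
        using bspec[OF c[unfolded obeys_def], of "(?x, ?y)"] x ne P(3)[OF x(1) ne]
        by (simp add: \<mu>_def C_def)
      moreover have "\<delta> (?x, ?y) \<longleftrightarrow> \<not> m dvd y \<and> (u = 1 \<or> u = n - 2)"
      proof -
        have "\<delta> (?x, ?y) \<longleftrightarrow> ?y \<noteq> 0 \<and> u \<in> {1, 2, n - 2, n - 1}"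
          using ne unfolding \<delta>_def by (simp only: prod.case xa simp_thms)
        moreover have "u \<noteq> 2" "u \<noteq> n - 1" using u n by auto
        ultimately show ?thesis unfolding dvd_eq_mod_eq_0 by simp
      qed
      ultimately show "C (u + 1 + A y) y \<noteq> C (u + A y) y \<longleftrightarrow> \<not> m dvd y \<and> (u = 1 \<or> u = n - 2)"
        by simp
    qed
    define p where "p y = C (A y) y" for y
    have p_cong: "p y = p y'" if "m dvd y - y'" for y y'
      using A_cong[OF that] C_cong[of "A y" "A y'" y y'] that by (simp add: p_def)
    have p_neg: "p (- y) \<noteq> p y" if "\<not> m dvd y" for y
    proof -
      let ?y = "y mod m"
      have y: "?y \<in> {0..<m}" "?y \<noteq> 0" using that m by auto
      have "\<mu> (a ?y, ?y) = (a (- y mod m), - y mod m)" by (simp add: \<mu>_def mod_simps)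
      moreover have "- y mod m \<noteq> ?y" using neg(4)[OF y(1)] y(2) by (simp add: mod_simps)
      ultimately show ?thesis
        using bspec[OF c[unfolded obeys_def], of "(a ?y, ?y)"] y a_in
        by (simp add: p_def C_def A_def \<delta>_def)
    qed
    have p_card: "odd (card {x \<in> {0..<n}. C x y}) \<longleftrightarrow> p y" for y
    proof -
      have "card {x \<in> {0..<n}. C x y} = card {u \<in> {0..<n}. C (u + A y) y}"
        by (rule rows_same_card[of n "\<lambda>u. (1 * u + A y) mod n"])
          (use n dihedralI[of 1] in \<open>auto simp: C_def\<close>)
      then show ?thesis using domino_odd_card[OF n domino[of y]] by (simp add: p_def)
    qed
    have p_inv: "p (s' * y + t') = p y" for y
    proof -
      have "card {x \<in> {0..<n}. C x (s' * y + t')} = card {x \<in> {0..<n}. C x y}"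
        by (rule rows_same_card[of n "\<lambda>u. (s * u + t) mod n"])
          (use n dihedralI[OF st(1)] C_inv in \<open>auto simp: C_def\<close>)
      then show ?thesis using p_card by metis
    qed
    have m1: "\<not> m dvd 1" "\<not> m dvd 2"
      using zdvd_imp_le[of m 1] zdvd_imp_le[of m 2] m by auto
    have A1: "A 1 = 0" and A2: "A 2 = 3" using m by (auto simp: A_def a_def)
    have A0: "A 0 = 0" by (simp add: A_def a_def)
    have domino1: "domino n True (\<lambda>u. C u 1)" using domino[of 1] m1 A1 by simp
    have domino2: "domino n True (\<lambda>u. C (u + 3) 2)" using domino[of 2] m1 A2 by simp
    have domino0: "domino n False (\<lambda>u. C u 0)" using domino[of 0] A0 by simp
    have near: "\<exists>e\<in>{0, 1, -1}. n dvd t - e" if "t mod n \<in> {0, 1, n - 1}" for t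
    proof -
      obtain q where "t mod n = q" "n dvd t - q" using dvd_minus_mod by blast
      moreover have "n dvd t - (n - 1) \<Longrightarrow> n dvd t - -1"
        using dvd_add[of n "t - (n - 1)" n] by simp
      ultimately show ?thesis using that by auto
    qed
    have ids: "s = 1 \<and> n dvd t \<and> s' = 1 \<and> m dvd t'"
    proof (cases "s' = 1")
      case True
      \<comment> \<open>With \<open>t' = 2 * h\<close> modulo \<open>m\<close>, row
        \<open>-h\<close> is taken to row \<open>h\<close>, but their left over vertices have
        different colors unless \<open>m dvd h\<close>.\<close>
      obtain h where "(2 * h - t') mod m = 0" using odd_half m(1) by blast
      then have h: "m dvd 2 * h - t'" by auto
      have mt': "m dvd t'"
      proof (rule ccontr)
        assume nt: "\<not> m dvd t'"
        have "\<not> m dvd h"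
        proof
          assume "m dvd h"
          then have "m dvd 2 * h" by simp
          then show False using nt h dvd_diff[of m "2 * h" "2 * h - t'"] by simp
        qed
        moreover have "p (- h) = p h"
          using p_inv[of "- h"] p_cong[of "- h + t'" h] h True by (simp add: dvd_diff_commute)
        ultimately show False using p_neg by blast
      qed
      have inv: "C (s * x + t) y = C x y" for x y
        using C_inv[of x y] C_cong[of "s * x + t" "s * x + t" "y + t'" y] mt' True by simp
      consider "s = 1" | "s = -1" using st by auto
      then show ?thesis
      proof cases
        case 1
        then have "n dvd t" by (intro domino_translation[OF n domino1]) (use inv in simp)
        then show ?thesis using 1 True mt' by simp
      next
        case 2
        then have r: "C (t - x) y = C x y" for x y using inv[of x y] by (simp add: algebra_simps)
        have "t mod n \<in> {0, 1, n - 1}"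
          by (rule domino_reflection[OF n domino1]) (use r in simp)
        from near[OF this] obtain e where e: "e \<in> {0, 1, -1}" "n dvd t - e" by blast
        have "(t - 6) mod n \<in> {0, 1, n - 1}"
        proof (rule domino_reflection[OF n domino2])
          fix u show "C (t - 6 - u + 3) 2 = C (u + 3) 2"
            using r[of "u + 3" 2] by (simp add: algebra_simps)
        qed
        from near[OF this] obtain e' where e': "e' \<in> {0, 1, -1}" "n dvd t - 6 - e'" by blast
        \<comment> \<open>Row 1 puts \<open>t\<close> near 0, row 2 near 6. The difference
          \<open>6 + e' - e\<close> lies between 4 and 8, so it is not divisible by
          \<open>n \<ge> 9\<close>.\<close>
        have "n dvd (t - e) - (t - 6 - e')" by (rule dvd_diff[OF e(2) e'(2)])
        then have "n dvd 6 + e' - e" by (simp add: algebra_simps)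
        then show ?thesis using e e' n small_dvd[of n "6 + e' - e"] by auto
      qed
    next
      case False
      then have s': "s' = -1" using st by auto
      \<comment> \<open>Otherwise rows 1 and -1 would be exchanged, whose left over vertices differ
        in color.\<close>
      have mt': "\<not> m dvd t'"
      proof
        assume "m dvd t'"
        then have "p (- 1) = p 1"
          using p_inv[of 1] p_cong[of "- 1 + t'" "- 1"] s' by simp
        then show False using p_neg m1 by blast
      qed
      obtain r where "(2 * r - t') mod m = 0" using odd_half m(1) by blast
      then have r: "m dvd 2 * r - t'" by auto
      have r0: "\<not> m dvd r" "\<not> m dvd 2 * r"
      proof -
        show "\<not> m dvd 2 * r" using mt' r dvd_diff[of m "2 * r" "2 * r - t'"] by auto
        then show "\<not> m dvd r" by auto
      qed
      have inv: "C (s * x + t) (2 * r - y) = C x y" for x y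
        using C_inv[of x y] C_cong[of "s * x + t" "s * x + t" "- y + t'" "2 * r - y"] r s'
        by (simp add: dvd_diff_commute)
      consider "s = 1" | "s = -1" using st by auto
      then show ?thesis
      proof cases
        case 1
        \<comment> \<open>The square of the map fixes every row and translates it by
          \<open>2 * t\<close>.\<close>
        have "C (u + 2 * t) 1 = C u 1" for u
          using inv[of u 1] inv[of "u + t" "2 * r - 1"] 1 by (simp add: algebra_simps)
        then have "n dvd 2 * t" by (rule domino_translation[OF n domino1])
        then have "n dvd t" using n odd_dvd_double by blast
        then have "C x (2 * r) = C x 0" for x
          using inv[of x 0] C_cong[of "x + t" x "2 * r" "2 * r"] 1 by simp
        moreover have "C 2 0 = C 1 0" using domino_pair[OF domino0, of 1] n by simp
        moreover have "C 2 (2 * r) \<noteq> C 1 (2 * r)"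
        proof -
          have d: "domino n True (\<lambda>u. C (u + A (2 * r)) (2 * r))" using domino[of "2 * r"] r0 by simp
          have "A (2 * r) = 0 \<or> A (2 * r) = 3" by (auto simp: A_def a_def)
          then show ?thesis
          proof
            assume "A (2 * r) = 0"
            then show ?thesis using domino_pair[OF d, of 1] n by simp
          next
            assume A3: "A (2 * r) = 3"
            \<comment> \<open>The shift by 3 brings the bicolored last domino
              \<open>(n - 2, n - 1)\<close> to the vertices 1 and 2, which form a unicolored domino
              in row 0.\<close>
            have "C (n - 2 + 1 + 3) (2 * r) \<noteq> C (n - 2 + 3) (2 * r)"
              using domino_pair[OF d, of "n - 2"] n unfolding A3 by simp
            moreover have "C (n - 2 + 1 + 3) (2 * r) = C 2 (2 * r)" "C (n - 2 + 3) (2 * r) = C 1 (2 * r)"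
              by (rule C_cong; simp)+
            ultimately show ?thesis by simp
          qed
        qed
        ultimately show ?thesis by simp
      next
        case 2
        then have refl: "C (t - x) (2 * r - y) = C x y" for x y
          using inv[of x y] by (simp add: algebra_simps)
        have "(t - A (2 * r)) mod n \<in> {1, n - 1}"
        proof (rule domino_reflection_to[OF n domino0])
          show "domino n True (\<lambda>u. C (u + A (2 * r)) (2 * r))" using domino[of "2 * r"] r0 by simp
          fix u show "C (t - A (2 * r) - u) 0 = C (u + A (2 * r)) (2 * r)"
            using refl[of "u + A (2 * r)" "2 * r"] by (simp add: algebra_simps)
        qed
        then have "(t - A (2 * r)) mod n \<in> {0, 1, n - 1}" by simp
        from near[OF this] obtain e where e: "e \<in> {0, 1, -1}" "n dvd t - A (2 * r) - e" by blast
        have "(t - 2 * A r) mod n \<in> {0, 1, n - 1}"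
        proof (rule domino_reflection[OF n])
          show "domino n True (\<lambda>u. C (u + A r) r)" using domino[of r] r0 by simp
          fix u show "C (t - 2 * A r - u + A r) r = C (u + A r) r"
            using refl[of "u + A r" r] by (simp add: algebra_simps)
        qed
        from near[OF this] obtain e' where e': "e' \<in> {0, 1, -1}" "n dvd t - 2 * A r - e'" by blast
        have "n dvd (t - A (2 * r) - e) - (t - 2 * A r - e')" by (rule dvd_diff[OF e(2) e'(2)])
        then have dvd: "n dvd 2 * A r + e' - A (2 * r) - e" by (simp add: algebra_simps)
        \<comment> \<open>Rows \<open>0\<close> and \<open>2 * r\<close> put \<open>t\<close> within
          1 of \<open>A (2 * r)\<close>, row \<open>r\<close> puts it within 1 of
          \<open>2 * A r\<close>. In each case listed these values differ by 3 or 6, which two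
          errors of 1 cannot bridge modulo \<open>n\<close>.\<close>
        have "A r = 0 \<and> A (2 * r) = 3 \<or> A r = 3 \<and> A (2 * r) \<in> {0, 3}"
        proof (cases "r mod m = 1")
          case True
          then have "(2 * r) mod m = 2 mod m" using m by (metis mod_mult_right_eq mult.right_neutral)
          then show ?thesis using True A2 by (simp add: A_def a_def)
        next
          case False
          then show ?thesis using r0 by (auto simp: A_def a_def dvd_eq_mod_eq_0)
        qed
        then show ?thesis
          using e e' n small_dvd[OF dvd] by auto
      qed
    qed
    then show "g v = v" using v by (auto simp: g elim!: dvdE)
  qed (use \<mu> in blast)+
  moreover have "\<exists>!v. v \<in> {0..<n} \<times> {0..<m} \<and> \<mu> v = v"
    by (rule ex1I[of _ "(0, 0)"]) (use fixed n m in \<open>auto simp: \<mu>_def a_def\<close>)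
  ultimately show ?thesis unfolding odd_rigid_def by blast
qed

section \<open>Small products of odd cycles\<close>

subsection \<open>Checking a pairing\<close>

text \<open>A pairing is given by its pairs \<open>(u, w, d)\<close>, where \<open>d\<close> tells whether the colors of \<open>u\<close>
  and \<open>w\<close> are different.\<close>

definition partner :: "('a \<times> 'a \<times> bool) list \<Rightarrow> 'a \<Rightarrow> 'a" where
  "partner ps v = (case find (\<lambda>(u, w, d). u = v \<or> w = v) ps of
     Some (u, w, d) \<Rightarrow> if u = v then w else u | None \<Rightarrow> v)"

definition differ :: "('a \<times> 'a \<times> bool) list \<Rightarrow> 'a \<Rightarrow> bool" where
  "differ ps v = (case find (\<lambda>(u, w, d). u = v \<or> w = v) ps of Some (u, w, d) \<Rightarrow> d | None \<Rightarrow> False)"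

text \<open>Does the orbit of \<open>v\<close> under \<open>f \<circ> partner ps\<close>, continued from \<open>w\<close>, change the color an odd
  number of times? Then no coloring obeying the pairing is preserved by \<open>f\<close>.\<close>

fun odd_walk :: "nat \<Rightarrow> ('a \<Rightarrow> 'a) \<Rightarrow> ('a \<times> 'a \<times> bool) list \<Rightarrow> 'a \<Rightarrow> 'a \<Rightarrow> bool \<Rightarrow> bool" where
  "odd_walk 0 f ps v w q = False"
| "odd_walk (Suc k) f ps v w q =
     (let w' = f (partner ps w); q' = (q \<noteq> differ ps w)
      in if w' = v then q' else odd_walk k f ps v w' q')"

text \<open>Along the walk, \<open>q\<close> records whether the color differs from that of
  \<open>v\<close>; a return to \<open>v\<close> with \<open>q\<close> true is impossible.\<close>

lemma odd_walk_sound: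
  assumes "obeys V (partner ps) (differ ps) c"
    and V: "\<And>v. v \<in> V \<Longrightarrow> partner ps v \<in> V" "\<And>v. v \<in> V \<Longrightarrow> f v \<in> V" and c: "\<And>v. v \<in> V \<Longrightarrow> c (f v) = c v"
    and fixed: "\<And>v. v \<in> V \<Longrightarrow> partner ps v = v \<Longrightarrow> \<not> differ ps v"
  shows "w \<in> V \<Longrightarrow> c w = (c v \<noteq> q) \<Longrightarrow> \<not> odd_walk k f ps v w q"
proof (induction k arbitrary: w q)
  case (Suc k)
  have "c (partner ps w) = (c w \<noteq> differ ps w)"
    using assms(1) Suc.prems(1) fixed[of w]
    unfolding obeys_def by (cases "partner ps w = w") auto
  then have "c (f (partner ps w)) = (c v \<noteq> (q \<noteq> differ ps w))"
    using Suc.prems c V by auto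
  then show ?case using Suc.IH V Suc.prems(1) by (auto simp: Let_def)
qed simp

definition cells :: "int \<Rightarrow> int \<Rightarrow> (int \<times> int) list" where
  "cells n m = List.product [0..n - 1] [0..m - 1]"

lemma set_cells: "set (cells n m) = {0..<n} \<times> {0..<m}"
  by (auto simp: cells_def)

text \<open>\<open>v0\<close> is the vertex without a partner. The two existence tests provide
  bicolored pairs along each of the two directions, which serve to exclude translations.\<close>

definition valid_pairs :: "int \<Rightarrow> int \<Rightarrow> int \<times> int \<Rightarrow> ((int \<times> int) \<times> (int \<times> int) \<times> bool) list \<Rightarrow> bool" where
  "valid_pairs n m v0 ps \<longleftrightarrow> v0 \<in> set (cells n m) \<and>
     list_ex (\<lambda>v. differ ps v \<and> fst (partner ps v) = fst v) (cells n m) \<and>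
     list_ex (\<lambda>v. differ ps v \<and> snd (partner ps v) = snd v) (cells n m) \<and>
     list_all (\<lambda>v. let w = partner ps v in w \<in> set (cells n m) \<and> partner ps w = v \<and>
       differ ps w = differ ps v \<and> (w = v) = (v = v0) \<and> (w = v \<longrightarrow> \<not> differ ps v)) (cells n m)"

text \<open>Glide reflections are not listed: the square of one is a translation, which reduces it
  to a reflection tested here.\<close>

definition no_reflection :: "int \<Rightarrow> int \<Rightarrow> ((int \<times> int) \<times> (int \<times> int) \<times> bool) list \<Rightarrow> bool" where
  "no_reflection n m ps \<longleftrightarrow>
     (let C = cells n m; N = length C;
        test = (\<lambda>f. list_ex (\<lambda>v. odd_walk N f ps v v False) C) in
      list_all (\<lambda>t. test (\<lambda>(x, y). ((t - x) mod n, y))) [0..n - 1] \<and>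
      list_all (\<lambda>t'. test (\<lambda>(x, y). (x, (t' - y) mod m))) [0..m - 1] \<and>
      list_all (\<lambda>(t, t'). test (\<lambda>(x, y). ((t - x) mod n, (t' - y) mod m))) C)"

lemma coprime_multiple:
  assumes "coprime t (n::int)" "0 < n"
  obtains k :: nat where "n dvd int k * t - 1"
proof -
  obtain a b where "a * t + b * n = 1"
    using bezout_int[of t n] assms(1) by (auto simp: coprime_iff_gcd_eq_1)
  then have "n dvd a * t - 1" by (intro dvdI[of _ _ "- b"]) (simp add: algebra_simps)
  moreover have "n dvd (a mod n) * t - a * t"
    by (metis left_diff_distrib dvd_mult2 mod_eq_dvd_iff mod_mod_trivial)
  ultimately have "n dvd ((a mod n) * t - a * t) + (a * t - 1)" by (rule dvd_add[rotated])
  then show ?thesis using that[of "nat (a mod n)"] assms(2) by simp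
qed

text \<open>Some multiple of \<open>t\<close> is 1 modulo \<open>n\<close>, so both periods together
  yield period 1.\<close>

lemma shift_invariant:
  fixes C :: "int \<Rightarrow> 'a"
  assumes per: "\<And>x. C (x + n) = C x" and inv: "\<And>x. C (x + t) = C x"
    and "coprime t n" "0 < n"
  shows "C x = C y"
proof -
  have mult: "D (x + int k * t) = D x" if "\<And>x. D (x + t) = D x" for D :: "int \<Rightarrow> 'a" and t x k
  proof (induction k)
    case (Suc k)
    then show ?case using that[of "x + int k * t"] by (simp add: algebra_simps)
  qed simp
  have per': "C (x + z * n) = C x" for x z
    using mult[of C n x "nat z", OF per] mult[of C n "x + z * n" "nat (- z)", OF per]
    by (cases "0 \<le> z") (simp_all add: algebra_simps)
  obtain k where "n dvd int k * t - 1" using coprime_multiple assms by blast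
  then obtain z where "int k * t - 1 = n * z" by (rule dvdE)
  then have z: "int k * t = 1 + n * z" by simp
  have one: "C (x + 1) = C x" for x
  proof -
    have "C (x + int k * t) = C x" using mult[of C t x k] inv by simp
    moreover have "x + int k * t = x + 1 + z * n" by (simp add: z)
    ultimately show ?thesis using per'[of "x + 1" z] by simp
  qed
  have up: "C (x + int k) = C x" for x k
    using mult[of C 1 x k, OF one] by simp
  show ?thesis
    using up[of x "nat (y - x)"] up[of y "nat (x - y)"] by (cases "x \<le> y") simp_all
qed

text \<open>Modulo a prime, any nontrivial translation generates all of them, so a coloring
  invariant under it is constant in that direction, against the bicolored pair. This leaves the
  reflections, which are checked by evaluation.\<close>

lemma odd_rigid_pairs:
  assumes prime: "prime n" "prime m" "n \<noteq> m" "odd n"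
    and valid: "valid_pairs n m v0 ps" and refl: "no_reflection n m ps"
  shows "odd_rigid ({0..<n} \<times> {0..<m}) (prod_maps (dihedral n) (dihedral m))"
proof -
  have n: "0 < n" and m: "0 < m" using prime(1,2) by (simp_all add: prime_gt_0_int)
  have nm: "coprime n m" using prime primes_coprime by blast
  let ?V = "{0..<n} \<times> {0..<m}" and ?\<mu> = "partner ps" and ?\<delta> = "differ ps"
  have "\<forall>v\<in>?V. ?\<mu> v \<in> ?V \<and> ?\<mu> (?\<mu> v) = v \<and> ?\<delta> (?\<mu> v) = ?\<delta> v \<and> (?\<mu> v = v) = (v = v0) \<and>
      (?\<mu> v = v \<longrightarrow> \<not> ?\<delta> v)"
    using valid unfolding valid_pairs_def list_all_iff Let_def set_cells by blast
  then have \<mu>: "?\<mu> v \<in> ?V" "?\<mu> (?\<mu> v) = v" "?\<delta> (?\<mu> v) = ?\<delta> v" "?\<mu> v = v \<longleftrightarrow> v = v0"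
      "?\<mu> v = v \<Longrightarrow> \<not> ?\<delta> v" if "v \<in> ?V" for v
    using that by blast+
  have v0: "v0 \<in> ?V" using valid by (simp add: valid_pairs_def set_cells)
  obtain u where u: "u \<in> ?V" "?\<delta> u" "fst (?\<mu> u) = fst u"
    using valid unfolding valid_pairs_def list_ex_iff set_cells by blast
  obtain w where w: "w \<in> ?V" "?\<delta> w" "snd (?\<mu> w) = snd w"
    using valid unfolding valid_pairs_def list_ex_iff set_cells by blast
  have "rigid ?V (prod_maps (dihedral n) (dihedral m)) ?\<mu> ?\<delta>"
    unfolding rigid_def
  proof (intro conjI allI impI ballI)
    fix c g v
    assume c: "obeys ?V ?\<mu> ?\<delta> c" and g: "g \<in> prod_maps (dihedral n) (dihedral m)"
      and inv: "\<forall>v\<in>?V. c (g v) = c v" and v: "v \<in> ?V"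
    obtain s t s' t' where st: "s \<in> {1, -1}" "s' \<in> {1, -1}"
      and g: "g = map_prod (\<lambda>x. (s * x + t) mod n) (\<lambda>y. (s' * y + t') mod m)"
      using g by (auto simp: prod_maps_def dihedral_def)
    define C where "C x y = c (x mod n, y mod m)" for x y
    have C_cong: "C x y = C x' y'" if "n dvd x - x'" "m dvd y - y'" for x x' y y'
      using that by (simp add: C_def mod_eq_dvd_iff[symmetric])
    have C_inv: "C (s * x + t) (s' * y + t') = C x y" for x y
      using bspec[OF inv, of "(x mod n, y mod m)"] n m by (simp add: C_def g affine_mod)
    have differ: "C (fst (?\<mu> v)) (snd (?\<mu> v)) \<noteq> C (fst v) (snd v)" if "v \<in> ?V" "?\<delta> v" for v
    proof -
      have "C (fst v) (snd v) = c v" if "v \<in> ?V" for v using that by (auto simp: C_def)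
      then show ?thesis using that c \<mu>(1,5)[OF that(1)] unfolding obeys_def by metis
    qed
    have trans_x: "n dvd d" if "\<And>x y. C (x + d) y = C x y" for d
    proof (rule ccontr)
      assume "\<not> n dvd d"
      then have "coprime d n" using prime(1) prime_imp_coprime coprime_commute by blast
      then have "C x y = C x' y" for x x' y
        using shift_invariant[of "\<lambda>x. C x y" n d x x'] that n C_cong by simp
      then show False using differ[OF w(1,2)] w(3) by metis
    qed
    have trans_y: "m dvd d" if "\<And>x y. C x (y + d) = C x y" for d
    proof (rule ccontr)
      assume "\<not> m dvd d"
      then have "coprime d m" using prime(2) prime_imp_coprime coprime_commute by blast
      then have "C x y = C x y'" for x y y'
        using shift_invariant[of "\<lambda>y. C x y" m d y y'] that m C_cong by simp
      then show False using differ[OF u(1,2)] u(3) by metis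
    qed
    have trans: "n dvd d \<and> m dvd e" if inv: "\<And>x y. C (x + d) (y + e) = C x y" for d e
    proof -
      have mult: "C (x + int k * d) (y + int k * e) = C x y" for x y k
      proof (induction k)
        case (Suc k)
        then show ?case using inv[of "x + int k * d" "y + int k * e"] by (simp add: algebra_simps)
      qed simp
      \<comment> \<open>After \<open>m\<close> repetitions the second coordinate is back, and
        \<open>m\<close> is invertible modulo \<open>n\<close>; likewise with the roles
        exchanged.\<close>
      have "C (x + m * d) y = C x y" for x y
        using mult[of x "nat m" y] C_cong[of "x + m * d" "x + m * d" "y + m * e" y] m by simp
      moreover have "C x (y + n * e) = C x y" for x y
        using mult[of x "nat n" y] C_cong[of "x + n * d" x "y + n * e" "y + n * e"] n by simp
      ultimately have "n dvd m * d" "m dvd n * e" using trans_x trans_y by blast+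
      then show ?thesis using nm coprime_dvd_mult_right_iff coprime_commute by metis
    qed
    have walk: "\<not> list_ex (\<lambda>v. odd_walk (length (cells n m)) f ps v v False) (cells n m)"
      if "\<And>v. v \<in> ?V \<Longrightarrow> f v \<in> ?V" "\<And>v. v \<in> ?V \<Longrightarrow> c (f v) = c v" for f
      using odd_walk_sound[OF c \<mu>(1) that \<mu>(5)] unfolding list_ex_iff set_cells by blast
    have no_x: False if "\<And>x y. C (d - x) y = C x y" for d
    proof -
      have "\<not> list_ex (\<lambda>v. odd_walk (length (cells n m)) (\<lambda>(x, y). ((d mod n - x) mod n, y)) ps v v False) (cells n m)"
      proof (rule walk)
        fix v assume "v \<in> ?V"
        then obtain x y where "v = (x, y)" "x \<in> {0..<n}" "y \<in> {0..<m}" by blast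
        then show "c (case v of (x, y) \<Rightarrow> ((d mod n - x) mod n, y)) = c v"
          using that[of x y] by (simp add: C_def mod_simps)
      qed (use n m in auto)
      moreover have "d mod n \<in> set [0..n - 1]" using n by simp
      ultimately show False using refl unfolding no_reflection_def Let_def list_all_iff by blast
    qed
    have no_y: False if "\<And>x y. C x (e - y) = C x y" for e
    proof -
      have "\<not> list_ex (\<lambda>v. odd_walk (length (cells n m)) (\<lambda>(x, y). (x, (e mod m - y) mod m)) ps v v False) (cells n m)"
      proof (rule walk)
        fix v assume "v \<in> ?V"
        then obtain x y where "v = (x, y)" "x \<in> {0..<n}" "y \<in> {0..<m}" by blast
        then show "c (case v of (x, y) \<Rightarrow> (x, (e mod m - y) mod m)) = c v"
          using that[of x y] by (simp add: C_def mod_simps)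
      qed (use n m in auto)
      moreover have "e mod m \<in> set [0..m - 1]" using m by simp
      ultimately show False using refl unfolding no_reflection_def Let_def list_all_iff by blast
    qed
    have no_xy: False if "\<And>x y. C (d - x) (e - y) = C x y" for d e
    proof -
      have "\<not> list_ex (\<lambda>v. odd_walk (length (cells n m))
          (\<lambda>(x, y). ((d mod n - x) mod n, (e mod m - y) mod m)) ps v v False) (cells n m)"
      proof (rule walk)
        fix v assume "v \<in> ?V"
        then obtain x y where "v = (x, y)" "x \<in> {0..<n}" "y \<in> {0..<m}" by blast
        then show "c (case v of (x, y) \<Rightarrow> ((d mod n - x) mod n, (e mod m - y) mod m)) = c v"
          using that[of x y] by (simp add: C_def mod_simps)
      qed (use n m in auto)
      moreover have "(d mod n, e mod m) \<in> set (cells n m)" using n m by (simp add: set_cells)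
      ultimately show False using refl unfolding no_reflection_def Let_def list_all_iff by blast
    qed
    have "s = 1 \<and> s' = 1 \<and> n dvd t \<and> m dvd t'"
    proof -
      consider "s = 1" "s' = 1" | "s = 1" "s' = -1" | "s = -1" "s' = 1" | "s = -1" "s' = -1"
        using st by auto
      then show ?thesis
      proof cases
        case 1
        then show ?thesis using trans[of t t'] C_inv by simp
      next
        case 2
        have "C (x + 2 * t) y = C x y" for x y
          using C_inv[of x y] C_inv[of "x + t" "t' - y"] 2 by (simp add: algebra_simps)
        then have "n dvd 2 * t" by (rule trans_x)
        then have "n dvd t" using odd_dvd_double prime(4) by blast
        then have "C x (t' - y) = C x y" for x y
          using C_inv[of x y] C_cong[of "x + t" x "t' - y" "t' - y"] 2 by simp
        then show ?thesis using no_y by blast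
      next
        case 3
        have "C x (y + 2 * t') = C x y" for x y
          using C_inv[of x y] C_inv[of "t - x" "y + t'"] 3 by (simp add: algebra_simps)
        then have "m dvd 2 * t'" by (rule trans_y)
        moreover have "coprime m 2" if "m \<noteq> 2"
          using that prime(2) primes_coprime[of m 2] by simp
        ultimately have "m dvd t' \<or> m = 2" using coprime_dvd_mult_right_iff by blast
        then show ?thesis
        proof
          assume "m dvd t'"
          then have "C (t - x) y = C x y" for x y
            using C_inv[of x y] C_cong[of "t - x" "t - x" "y + t'" y] 3 by simp
          then show ?thesis using no_x by blast
        next
          \<comment> \<open>Modulo 2 the translation \<open>y + t'\<close> and the reflection
            \<open>t' - y\<close> coincide.\<close>
          assume "m = 2"
          then have "C (t - x) (t' - y) = C x y" for x y
            using C_inv[of x y] C_cong[of "t - x" "t - x" "y + t'" "t' - y"] 3 by simp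
          then show ?thesis using no_xy by blast
        qed
      next
        case 4
        then show ?thesis using no_xy[of t t'] C_inv by (simp add: algebra_simps)
      qed
    qed
    then show "g v = v" using v by (auto simp: g elim!: dvdE)
  qed (use \<mu> in blast)+
  moreover have "\<exists>!v. v \<in> ?V \<and> ?\<mu> v = v" using \<mu>(4) v0 by blast
  ultimately show ?thesis unfolding odd_rigid_def by blast
qed

text \<open>These two pairings were found by simulated annealing.\<close>

definition pairs37 :: "((int \<times> int) \<times> (int \<times> int) \<times> bool) list" where
  "pairs37 =
   [((2, 0), (2, 4), True), ((0, 3), (0, 5), True), ((0, 1), (1, 1), True),
    ((2, 2), (2, 5), True), ((0, 4), (0, 0), True), ((2, 6), (2, 3), True),
    ((0, 6), (0, 2), False), ((1, 4), (1, 6), True), ((1, 2), (1, 5), True),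
    ((1, 3), (1, 0), False)]"

definition pairs57 :: "((int \<times> int) \<times> (int \<times> int) \<times> bool) list" where
  "pairs57 =
   [((4, 6), (1, 6), True), ((4, 5), (2, 5), True), ((1, 3), (1, 1), False),
    ((4, 0), (4, 2), True), ((3, 2), (3, 0), True), ((2, 3), (3, 4), True),
    ((2, 4), (2, 2), True), ((3, 5), (3, 3), False), ((0, 0), (0, 2), False),
    ((0, 6), (0, 1), False), ((0, 3), (0, 5), True), ((1, 2), (1, 0), True),
    ((4, 3), (4, 1), True), ((2, 6), (2, 1), True), ((1, 5), (1, 4), False),
    ((4, 4), (2, 0), True), ((3, 1), (3, 6), True)]"

lemma odd_rigid_3_7: "odd_rigid ({0..<3} \<times> {0..<7}) (prod_maps (dihedral 3) (dihedral 7))"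
proof (rule odd_rigid_pairs)
  show "valid_pairs 3 7 (2, 1) pairs37" by code_simp
  show "no_reflection 3 7 pairs37" by code_simp
qed simp_all

lemma odd_rigid_5_7: "odd_rigid ({0..<5} \<times> {0..<7}) (prod_maps (dihedral 5) (dihedral 7))"
proof (rule odd_rigid_pairs)
  show "valid_pairs 5 7 (0, 4) pairs57" by code_simp
  show "no_reflection 5 7 pairs57" by code_simp
qed simp_all

subsection \<open>Solving a game on a few vertices\<close>

fun place :: "'c \<Rightarrow> 'c option list \<Rightarrow> 'c option list list" where
  "place c [] = []"
| "place c (x # xs) = (if x = None then [Some c # xs] else []) @ map ((#) x) (place c xs)"

text \<open>A search of the game tree on a block: \<open>b\<close> lists its colors,
  \<open>k\<close> counts the remaining rounds of a move and a reply. The test for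
  \<open>None\<close> keeps \<open>list_all\<close> from holding vacuously on a full board.\<close>

fun force :: "nat list list \<Rightarrow> nat \<Rightarrow> nat option list \<Rightarrow> bool" where
  "force good 0 b \<longleftrightarrow> None \<notin> set b \<and> map the b \<in> set good"
| "force good (Suc k) b \<longleftrightarrow> None \<in> set b \<and>
     list_all (\<lambda>b1. list_ex (force good k) (place 0 b1 @ place 1 b1)) (place 0 b @ place 1 b)"

lemma set_place: "b' \<in> set (place c b) \<longleftrightarrow> (\<exists>i<length b. b ! i = None \<and> b' = b[i := Some c])"
proof (induction b arbitrary: b')
  case (Cons x b)
  have "(\<exists>i<length (x # b). (x # b) ! i = None \<and> b' = (x # b)[i := Some c]) \<longleftrightarrow>
      x = None \<and> b' = Some c # b \<or> (\<exists>i<length b. b ! i = None \<and> b' = x # b[i := Some c])"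
    by (auto simp: less_Suc_eq_0_disj)
  then show ?case using Cons.IH by auto
qed simp

lemma map_upd_nth:
  assumes "distinct xs" "i < length xs"
  shows "map (m(xs ! i \<mapsto> c)) xs = (map m xs)[i := Some c]"
  using assms by (intro nth_equalityI) (auto simp: nth_list_update nth_eq_iff_index_eq)

lemma responds_force:
  assumes xs: "distinct xs"
  shows "responds (set xs) 2 (\<lambda>m. \<exists>k. force good k (map m xs))"
  unfolding responds_def
proof (intro allI impI, elim conjE exE)
  fix m v k and c :: nat
  assume k: "force good k (map m xs)" and v: "v \<in> set xs - dom m" and c: "c < 2"
  obtain i where i: "i < length xs" "v = xs ! i" using v by (auto simp: in_set_conv_nth)
  have none: "map m xs ! i = None" using v i by auto
  have "None \<in> set (map m xs)" using none i(1) by (metis length_map nth_mem)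
  then obtain k' where k': "k = Suc k'" using k by (cases k) auto
  have "c = 0 \<or> c = 1" using c by linarith
  then have "map (m(v \<mapsto> c)) xs \<in> set (place 0 (map m xs) @ place 1 (map m xs))"
    unfolding set_append Un_iff set_place i(2) map_upd_nth[OF xs i(1)] using none i(1) by auto
  then obtain b where b: "force good k' b"
      "b \<in> set (place 0 (map (m(v \<mapsto> c)) xs) @ place 1 (map (m(v \<mapsto> c)) xs))"
    using k unfolding k' force.simps list_all_iff list_ex_iff by blast
  from b(2) obtain e where e: "e < 2" "b \<in> set (place e (map (m(v \<mapsto> c)) xs))"
    by (metis Un_iff set_append one_less_numeral_iff semiring_norm(76) zero_less_numeral)
  then obtain j where j: "j < length xs" "map (m(v \<mapsto> c)) xs ! j = None"
      "b = (map (m(v \<mapsto> c)) xs)[j := Some e]"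
    unfolding set_place by auto
  then have "b = map (m(v \<mapsto> c, xs ! j \<mapsto> e)) xs" using map_upd_nth[OF xs] by metis
  moreover have "xs ! j \<in> set xs - dom m - {v}" using j by (auto split: if_splits)
  ultimately show "\<exists>w\<in>set xs - dom m - {v}. \<exists>e<2. \<exists>k. force good k (map (m(v \<mapsto> c, w \<mapsto> e)) xs)"
    using b(1) e(1) by blast
qed

lemma force_final:
  assumes "force good k (map m xs)" "set xs \<subseteq> dom m"
  shows "map (\<lambda>v. the (m v)) xs \<in> set good"
proof -
  have "None \<notin> set (map m xs)" using assms(2) by force
  then show ?thesis using assms(1) by (cases k) (auto simp: comp_def)
qed

subsection \<open>The product of a triangle and a pentagon\<close>

text \<open>The dihedral group as operations on lists. Its head is \<open>rotate 0\<close>, the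
  identity, which \<open>tl\<close> removes.\<close>

definition dihs :: "nat \<Rightarrow> ('a list \<Rightarrow> 'a list) list" where
  "dihs n = map rotate [0..<n] @ map (\<lambda>k xs. rev (rotate k xs)) [0..<n]"

text \<open>Precomposition with \<open>f\<close> rearranges the table of values, so that invariance
  under \<open>f\<close> becomes an equation of lists that can be evaluated.\<close>

lemma dihedral_dihs:
  assumes n: "0 < n" and f: "f \<in> dihedral n"
  shows "(\<forall>x\<in>{0..<n}. f x = x) \<or>
    (\<exists>\<tau>\<in>set (tl (dihs (nat n))). \<forall>h :: int \<Rightarrow> 'a. map (\<lambda>x. h (f x)) [0..n - 1] = \<tau> (map h [0..n - 1]))"
proof -
  obtain s t where st: "f = (\<lambda>x. (s * x + t) mod n)" "s \<in> {1, -1}"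
    using f by (auto simp: dihedral_def)
  have tl: "tl (dihs (nat n)) =
      map rotate [1..<nat n] @ map (\<lambda>k xs. rev (rotate k xs)) [0..<nat n]"
    using n by (simp add: dihs_def upt_rec[of 0])
  consider "s = 1" "n dvd t" | "s = 1" "\<not> n dvd t" | "s = -1" using st(2) by auto
  then show ?thesis
  proof cases
    case 1
    then have "f x = x" if "x \<in> {0..<n}" for x using that by (auto simp: st(1) elim!: dvdE)
    then show ?thesis by blast
  next
    case 2
    define k where "k = nat (t mod n)"
    have k: "int k = t mod n" "k \<in> {1..<nat n}"
      using n 2 by (auto simp: k_def dvd_eq_mod_eq_0 nat_less_iff Suc_le_eq zero_less_nat_eq
          le_neq_trans pos_mod_sign order.not_eq_order_implies_strict)
    have "rotate k \<in> set (tl (dihs (nat n)))" using k(2) unfolding tl by auto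
    moreover have "map (\<lambda>x. h (f x)) [0..n - 1] = rotate k (map h [0..n - 1])" for h
    proof (rule nth_equalityI)
      fix i assume i: "i < length (map (\<lambda>x. h (f x)) [0..n - 1])"
      have "int ((k + i) mod nat n) = (int i + t) mod n"
        using n k(1) by (simp add: zmod_int mod_simps algebra_simps)
      then show "map (\<lambda>x. h (f x)) [0..n - 1] ! i = rotate k (map h [0..n - 1]) ! i"
        using i n 2 by (simp add: nth_rotate nth_upto st(1) nat_less_iff[symmetric] zle_diff1_eq)
    qed simp
    ultimately show ?thesis by blast
  next
    case 3
    \<comment> \<open>\<open>rev\<close> reads position \<open>n - 1 - i\<close>, so
      \<open>t + 1\<close> is needed to arrive at \<open>t - i\<close> modulo
      \<open>n\<close>.\<close>
    define k where "k = nat ((t + 1) mod n)"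
    have k: "int k = (t + 1) mod n" "k \<in> {0..<nat n}" using n by (auto simp: k_def nat_less_iff)
    define \<tau> :: "'a list \<Rightarrow> 'a list" where "\<tau> = (\<lambda>xs. rev (rotate k xs))"
    have "\<tau> \<in> set (tl (dihs (nat n)))" using k(2) unfolding tl \<tau>_def by auto
    moreover have "map (\<lambda>x. h (f x)) [0..n - 1] = \<tau> (map h [0..n - 1])" for h
      unfolding \<tau>_def
    proof (rule nth_equalityI)
      fix i assume i: "i < length (map (\<lambda>x. h (f x)) [0..n - 1])"
      have "int ((k + (nat n - Suc i)) mod nat n) = ((t + 1) mod n + (n - 1 - int i)) mod n"
        using n k(1) i by (simp add: zmod_int of_nat_diff algebra_simps)
      also have "\<dots> = ((t + 1) + (n - 1 - int i)) mod n" by (simp only: mod_add_left_eq)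
      also have "(t + 1) + (n - 1 - int i) = (t - int i) + n" by simp
      also have "\<dots> mod n = (t - int i) mod n" by simp
      finally have eq: "int ((k + (nat n - Suc i)) mod nat n) = (t - int i) mod n" .
      have "(k + (nat n - Suc i)) mod nat n < nat n" using n by simp
      then show "map (\<lambda>x. h (f x)) [0..n - 1] ! i = rev (rotate k (map h [0..n - 1])) ! i"
        using i n 3 eq by (simp add: rev_nth nth_rotate nth_upto st(1) nat_less_iff[symmetric] zle_diff1_eq)
    qed simp
    ultimately show ?thesis by blast
  qed
qed

definition asymmetric :: "nat \<Rightarrow> nat \<Rightarrow> 'a list list \<Rightarrow> bool" where
  "asymmetric n m g \<longleftrightarrow> list_all (\<lambda>\<tau>. map \<tau> g \<noteq> g) (tl (dihs m)) \<and>
     list_all (\<lambda>\<sigma>. let g' = \<sigma> g in g' \<noteq> g \<and> list_all (\<lambda>\<tau>. map \<tau> g' \<noteq> g) (tl (dihs m))) (tl (dihs n))"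

lemma asymmetric_sound:
  fixes c :: "int \<times> int \<Rightarrow> 'a"
  assumes n: "0 < n" and m: "0 < m" and g: "g \<in> prod_maps (dihedral n) (dihedral m)"
    and inv: "\<And>v. v \<in> {0..<n} \<times> {0..<m} \<Longrightarrow> c (g v) = c v"
    and asym: "asymmetric (nat n) (nat m) (map (\<lambda>x. map (\<lambda>y. c (x, y)) [0..m - 1]) [0..n - 1])"
    and v: "v \<in> {0..<n} \<times> {0..<m}"
  shows "g v = v"
proof -
  obtain f \<psi> where f: "f \<in> dihedral n" and \<psi>: "\<psi> \<in> dihedral m" and g: "g = map_prod f \<psi>"
    using g by (auto simp: prod_maps_def)
  let ?g = "map (\<lambda>x. map (\<lambda>y. c (x, y)) [0..m - 1]) [0..n - 1]"
  have inv: "map (\<lambda>x. map (\<lambda>y. c (f x, \<psi> y)) [0..m - 1]) [0..n - 1] = ?g"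
    using inv by (auto simp: g)
  consider (id) "\<forall>y\<in>{0..<m}. \<psi> y = y"
    | (dih) \<tau> where "\<tau> \<in> set (tl (dihs (nat m)))"
        "\<And>h :: int \<Rightarrow> 'a. map (\<lambda>x. h (\<psi> x)) [0..m - 1] = \<tau> (map h [0..m - 1])"
    using dihedral_dihs[OF m \<psi>, where ?'a = 'a] by blast
  note \<psi>_cases = this
  consider (id) "\<forall>x\<in>{0..<n}. f x = x"
    | (dih) \<sigma> where "\<sigma> \<in> set (tl (dihs (nat n)))"
        "\<And>h :: int \<Rightarrow> 'a list. map (\<lambda>x. h (f x)) [0..n - 1] = \<sigma> (map h [0..n - 1])"
    using dihedral_dihs[OF n f, where ?'a = "'a list"] by blast
  then show ?thesis
  proof cases
    case f1: id
    show ?thesis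
    proof (cases rule: \<psi>_cases)
      case id
      then show ?thesis using v f1 by (auto simp: g)
    next
      case (dih \<tau>)
      have "map \<tau> ?g = map (\<lambda>x. map (\<lambda>y. c (x, \<psi> y)) [0..m - 1]) [0..n - 1]"
        unfolding map_map comp_def dih(2)[symmetric] ..
      also have "\<dots> = ?g" using f1 by (subst inv[symmetric]) simp
      finally show ?thesis using asym dih(1) unfolding asymmetric_def list_all_iff by blast
    qed
  next
    case f2: (dih \<sigma>)
    have \<sigma>: "\<sigma> ?g = map (\<lambda>x. map (\<lambda>y. c (f x, y)) [0..m - 1]) [0..n - 1]"
      unfolding f2(2)[symmetric] ..
    show ?thesis
    proof (cases rule: \<psi>_cases)
      case id
      have "\<sigma> ?g = map (\<lambda>x. map (\<lambda>y. c (f x, \<psi> y)) [0..m - 1]) [0..n - 1]"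
        unfolding \<sigma> using id by (intro map_cong refl arg_cong[where f = c]) auto
      then have "\<sigma> ?g = ?g" using inv by simp
      then show ?thesis using asym f2(1) unfolding asymmetric_def list_all_iff Let_def by blast
    next
      case (dih \<tau>)
      have "map \<tau> (\<sigma> ?g) = map (\<lambda>x. map (\<lambda>y. c (f x, \<psi> y)) [0..m - 1]) [0..n - 1]"
        unfolding \<sigma> map_map comp_def dih(2)[symmetric] ..
      then have "map \<tau> (\<sigma> ?g) = ?g" using inv by simp
      then show ?thesis using asym f2(1) dih(1) unfolding asymmetric_def list_all_iff Let_def by blast
    qed
  qed
qed

text \<open>Gentle starts with color 0 at \<open>(1, 0)\<close>. Then \<^term>\<open>pairs35\<close> are used as pairs, while the
  answers inside \<^term>\<open>block35\<close> depend on the moves of Rascal.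
  Gentle can force the final colors of the block into \<^term>\<open>good35\<close>, where no coloring of the pairs
  leads to a symmetric coloring. All this data was found by computer search.\<close>

definition block35 :: "(int \<times> int) list" where
  "block35 = [(1, 0), (0, 2), (1, 3), (2, 2), (0, 3), (2, 3), (1, 2)]"

definition good35 :: "nat list list" where
  "good35 = map ((#) 0)
    [[0, 0, 0, 0, 0, 0], [0, 0, 0, 1, 1, 0], [0, 0, 1, 0, 0, 1], [0, 1, 0, 0, 1, 0],
     [0, 1, 0, 1, 0, 0], [0, 1, 1, 1, 0, 1], [1, 0, 0, 0, 0, 1], [1, 0, 1, 0, 0, 0],
     [1, 0, 1, 1, 1, 0], [1, 1, 0, 1, 0, 1], [1, 1, 1, 0, 1, 0], [1, 1, 1, 1, 0, 0]]"

definition pairs35 :: "((int \<times> int) \<times> (int \<times> int) \<times> bool) list" where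
  "pairs35 = [((2, 1), (2, 4), True), ((0, 1), (0, 4), True), ((1, 1), (1, 4), False),
     ((0, 0), (2, 0), True)]"

definition paired35 :: "(int \<times> int) list" where
  "paired35 = [(2, 1), (2, 4), (0, 1), (0, 4), (1, 1), (1, 4), (0, 0), (2, 0)]"

text \<open>The table of the whole coloring, with one row per first coordinate: \<open>p\<close>
  holds the colors of the first vertices in \<open>pairs35\<close>, from which those of their
  partners follow, and \<open>b\<close> the colors of \<open>block35\<close>, both in the order of
  these lists.\<close>

definition grid35 :: "nat list \<Rightarrow> nat list \<Rightarrow> nat list list" where
  "grid35 p b = (case (p, b) of ([a, e, i, o'], [b10, b02, b13, b22, b03, b23, b12]) \<Rightarrow>
     [[o', e, b02, b03, 1 - e], [b10, i, b12, b13, i], [1 - o', a, b22, b23, 1 - a]] | _ \<Rightarrow> [])"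

lemma force35: "force good35 3 (Some 0 # replicate 6 None)"
  by code_simp

lemma asymmetric35:
  "list_all (\<lambda>b. list_all (\<lambda>p. asymmetric 3 5 (grid35 p b)) (List.n_lists 4 [0, 1])) good35"
  by code_simp

lemma forces_3_5: "forces ({0..<3} \<times> {0..<5}) (prod_maps (dihedral 3) (dihedral 5)) Gentle"
proof -
  define \<rho> where "\<rho> v c = (if differ pairs35 v then 1 - c else c)" for v and c :: nat
  let ?V = "{0..<3} \<times> {0..<5} :: (int \<times> int) set"
  let ?W = "set paired35" and ?B = "set block35"
  define S where "S m \<longleftrightarrow> paired ?W (partner pairs35) \<rho> (m |` ?W) \<and>
    (\<exists>k. force good35 k (map (m |` ?B) block35))" for m
  have V: "?V = ?W \<union> ?B"
  proof -
    have "?V = set (cells 3 5)" by (simp add: set_cells)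
    also have "\<dots> = ?W \<union> ?B" by code_simp
    finally show ?thesis .
  qed
  have pairs: "\<forall>v\<in>?W. partner pairs35 v \<in> ?W \<and> partner pairs35 (partner pairs35 v) = v \<and>
      partner pairs35 v \<noteq> v \<and> differ pairs35 (partner pairs35 v) = differ pairs35 v"
    by code_simp
  have "responds ?W 2 (paired ?W (partner pairs35) \<rho>)"
    by (rule responds_paired) (use pairs in \<open>auto simp: \<rho>_def\<close>)
  moreover have "responds ?B 2 (\<lambda>m. \<exists>k. force good35 k (map m block35))"
    by (rule responds_force) code_simp
  moreover have "?W \<inter> ?B = {}" by code_simp
  ultimately have "responds ?V 2 S"
    unfolding V S_def[abs_def] by (rule responds_Un)
  moreover have "startable ?V 2 S (Gentle = Gentle)"
  proof -
    have "map ([(1, 0) \<mapsto> 0 :: nat] |` ?B) block35 = Some 0 # replicate 6 None"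
      by (simp add: block35_def restrict_map_def numeral_eq_Suc)
    moreover have "[(1, 0) \<mapsto> 0 :: nat] |` ?W = Map.empty"
      by (auto simp: paired35_def restrict_map_def)
    moreover have "paired ?W (partner pairs35) \<rho> Map.empty" using pairs by (simp add: paired_def)
    ultimately have "S [(1, 0) \<mapsto> 0]"
      unfolding S_def by (intro conjI exI[of _ 3]) (simp_all only: force35)
    then show ?thesis by (force simp: startable_def)
  qed
  moreover have "g v = v" if m: "S m" "dom m = ?V" "ran m \<subseteq> {..<2}"
    and g: "g \<in> prod_maps (dihedral 3) (dihedral 5)" and inv: "\<And>v. v \<in> ?V \<Longrightarrow> m (g v) = m v"
    and v: "v \<in> ?V" for m g v
  proof -
    define c where "c v = the (m v)" for v
    have m_c: "m v = Some (c v)" "c v \<in> {0, 1}" if v: "v \<in> ?V" for v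
    proof -
      obtain e where e: "m v = Some e" using v m(2) by blast
      then have "e < 2" using m(3) ranI by fastforce
      then show "m v = Some (c v)" "c v \<in> {0, 1}" using e by (auto simp: c_def)
    qed
    have pc: "c (partner pairs35 v) = \<rho> v (c v)" if "v \<in> ?W" for v
    proof -
      have "(m |` ?W) (partner pairs35 v) = Some (\<rho> v (c v))"
        using m(1) pairs that m_c(1)[of v] unfolding S_def paired_def V by (simp add: restrict_map_def)
      then show ?thesis using pairs that m_c(1)[of "partner pairs35 v"] unfolding V by (simp add: restrict_map_def)
    qed
    obtain k where "force good35 k (map (m |` ?B) block35)" using m(1) unfolding S_def by blast
    moreover have "map (m |` ?B) block35 = map m block35" by simp
    ultimately have "force good35 k (map m block35)" by metis
    then have "map (\<lambda>v. the (m v)) block35 \<in> set good35"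
      by (rule force_final) (use m(2) V in blast)
    then have "map c block35 \<in> set good35" by (simp only: c_def[abs_def])
    moreover have "map c [(2, 1), (0, 1), (1, 1), (0, 0)] \<in> set (List.n_lists 4 [0, 1])"
      using m_c(2) by (auto simp: set_n_lists)
    ultimately have "asymmetric 3 5 (grid35 (map c [(2, 1), (0, 1), (1, 1), (0, 0)]) (map c block35))"
      using asymmetric35 unfolding list_all_iff by blast
    moreover have "c (2, 4) = 1 - c (2, 1)" "c (0, 4) = 1 - c (0, 1)" "c (1, 4) = c (1, 1)"
        "c (2, 0) = 1 - c (0, 0)"
      using pc[of "(2, 1)"] pc[of "(0, 1)"] pc[of "(1, 1)"] pc[of "(0, 0)"]
      by (simp_all add: paired35_def pairs35_def partner_def differ_def \<rho>_def)
    ultimately have "asymmetric 3 5 (map (\<lambda>x. map (\<lambda>y. c (x, y)) [0..5 - 1]) [0..3 - 1])"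
      by (simp add: grid35_def block35_def upto_rec_numeral upto.simps)
    then show ?thesis
      using asymmetric_sound[of 3 5 g c v] g v inv by (simp add: c_def)
  qed
  ultimately show ?thesis unfolding forces_def by blast
qed

section \<open>Strategies of Gentle on products of cycles\<close>

text \<open>Gentle repeats the color \<open>c\<close> or answers \<open>1 - c\<close>, as
  \<open>\<delta>\<close> says. The condition on \<open>p\<close> gives Gentle the last move, with
  or without a fixed vertex.\<close>

lemma forces_rigid:
  assumes "rigid V G \<mu> \<delta>"
    and unique: "\<And>u v. u \<in> V \<Longrightarrow> v \<in> V \<Longrightarrow> \<mu> u = u \<Longrightarrow> \<mu> v = v \<Longrightarrow> u = v"
    and p: "p = Gentle \<longleftrightarrow> (\<exists>v\<in>V. \<mu> v = v)"
  shows "forces V G p"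
proof -
  have \<mu>: "\<And>v. v \<in> V \<Longrightarrow> \<mu> v \<in> V" "\<And>v. v \<in> V \<Longrightarrow> \<mu> (\<mu> v) = v"
      "\<And>v. v \<in> V \<Longrightarrow> \<delta> (\<mu> v) = \<delta> v"
    and rigid: "\<And>c g v. obeys V \<mu> \<delta> c \<Longrightarrow> g \<in> G \<Longrightarrow> (\<And>v. v \<in> V \<Longrightarrow> c (g v) = c v) \<Longrightarrow> v \<in> V \<Longrightarrow> g v = v"
    using assms(1) unfolding rigid_def by blast+
  define \<rho> where "\<rho> v c = (if \<delta> v then 1 - c else c)" for v and c :: nat
  have "responds V 2 (paired V \<mu> \<rho>)"
    using \<mu>(1,2) by (rule responds_paired) (use \<mu>(3) in \<open>auto simp: \<rho>_def\<close>)
  moreover have "startable V 2 (paired V \<mu> \<rho>) (p = Gentle)"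
    using unique p by (rule startable_paired) simp_all
  moreover have "g v = v" if m: "paired V \<mu> \<rho> m" "dom m = V" "ran m \<subseteq> {..<2}" and g: "g \<in> G"
    and inv: "\<forall>v\<in>V. m (g v) = m v" and v: "v \<in> V" for m g v
  proof (rule rigid[OF _ g _ v])
    show "obeys V \<mu> \<delta> (\<lambda>v. m v = Some 1)"
      unfolding obeys_def
    proof (intro ballI impI)
      fix u assume u: "u \<in> V" "\<mu> u \<noteq> u"
      then obtain c where c: "m u = Some c" using m(2) by blast
      then have "c = 0 \<or> c = 1" using m(3) ranI by fastforce
      moreover have "m (\<mu> u) = Some (\<rho> u c)" using m(1) u c unfolding paired_def by blast
      ultimately show "(m (\<mu> u) = Some 1) \<noteq> (m u = Some 1) \<longleftrightarrow> \<delta> u" using c by (auto simp: \<rho>_def)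
    qed
  qed (use inv in simp)
  ultimately show ?thesis unfolding forces_def by blast
qed

lemma forces_odd_rigid: "odd_rigid V G \<Longrightarrow> forces V G Gentle"
  unfolding odd_rigid_def using forces_rigid[of V G _ _ Gentle] by blast

context torus
begin

text \<open>Opposite vertices in direction \<^term>\<open>i0\<close> are paired. Every automorphism respects this
  pairing, hence also the set of pairs with different colors, which consists of the pair of the
  origin and the pairs of its neighbors.\<close>

lemma rigid_even:
  assumes i0: "i0 \<in> J" "even (N i0)" and J2: "2 \<le> card J"
  shows "\<exists>\<mu> \<delta>. rigid B (affines N J) \<mu> \<delta> \<and> (\<forall>v\<in>B. \<mu> v \<noteq> v)"
proof -
  obtain h where h: "N i0 = 2 * h" using i0(2) by blast
  then have h2: "2 \<le> h" using N3[OF i0(1)] by simp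
  \<comment> \<open>The pairs form a smaller torus, with side \<open>h\<close> instead of
    \<open>N i0\<close>; \<open>v i mod H i\<close> are the coordinates of the pair of
    \<open>v\<close>.\<close>
  define H where "H i = (if i = i0 then h else N i)" for i
  have H2: "2 \<le> H i" and HN: "H i dvd N i" if "i \<in> J" for i
    using that N3[OF that] h h2 by (auto simp: H_def)
  define \<mu> where "\<mu> v = v(i0 := (v i0 + h) mod N i0)" for v
  \<comment> \<open>The pair is the origin of this torus or a unit vector; only neighbors in
    positive directions count, which is what excludes reflections if \<open>H i > 2\<close>.\<close>
  define \<delta> where "\<delta> v \<longleftrightarrow> (\<forall>i\<in>J. v i mod H i \<in> {0, 1}) \<and>
    (\<forall>i\<in>J. \<forall>j\<in>J. v i mod H i = 1 \<and> v j mod H j = 1 \<longrightarrow> i = j)" for v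
  have \<mu>_in: "\<mu> v \<in> B" if "v \<in> B" for v
    using that i0(1) N3[OF i0(1)] by (auto simp: \<mu>_def box_def)
  have \<mu>_\<mu>: "\<mu> (\<mu> v) = v" if "v \<in> B" for v
  proof -
    have "((v i0 + h) mod N i0 + h) mod N i0 = (v i0 + N i0) mod N i0"
      by (simp only: mod_add_left_eq h) (simp add: algebra_simps)
    then show ?thesis using that i0(1) by (auto simp: \<mu>_def box_def)
  qed
  have \<mu>_ne: "\<mu> v \<noteq> v" if "v \<in> B" for v
  proof
    assume "\<mu> v = v"
    then have "(v i0 + h) mod N i0 = v i0 mod N i0"
      using that i0(1) unfolding \<mu>_def box_def fun_eq_iff by (auto dest!: spec[of _ i0])
    then have "N i0 dvd h" by (simp add: mod_eq_dvd_iff)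
    then show False using h h2 zdvd_imp_le[of "N i0" h] by simp
  qed
  have \<mu>_H: "\<mu> v i mod H i = v i mod H i" for v i
    using h by (auto simp: \<mu>_def H_def mod_mod_cancel)
  have \<delta>_\<mu>: "\<delta> (\<mu> v) = \<delta> v" for v by (simp add: \<delta>_def \<mu>_H)
  have "rigid B (affines N J) \<mu> \<delta>"
    unfolding rigid_def
  proof (intro conjI allI impI ballI)
    fix c g v assume c: "obeys B \<mu> \<delta> c" and "g \<in> affines N J"
      and inv: "\<forall>v\<in>B. c (g v) = c v" and v: "v \<in> B"
    then obtain s t where g: "g = affine N J s t" and s: "\<And>i. s i \<in> {1, -1}"
      by (auto simp: affines_def)
    have opp: "c (\<mu> v) \<noteq> c v \<longleftrightarrow> \<delta> v" if "v \<in> B" for v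
      using c \<mu>_ne that by (simp add: obeys_def)
    \<comment> \<open>\<open>h\<close> and \<open>-h\<close> agree modulo \<open>N i0\<close>, so
      the sign in direction \<open>i0\<close> does not matter.\<close>
    have "g (\<mu> v) = \<mu> (g v)" for v
    proof -
      have "s i0 * (v i0 + h) + t i0 = s i0 * v i0 + t i0 + h + (if s i0 = 1 then 0 else - N i0)"
        using s[of i0] h by (auto simp: algebra_simps)
      then have "(s i0 * ((v i0 + h) mod N i0) + t i0) mod N i0 = ((s i0 * v i0 + t i0) mod N i0 + h) mod N i0"
        unfolding affine_mod by (simp add: mod_simps mod_eq_dvd_iff)
      then show ?thesis using i0(1) by (auto simp: g affine_def \<mu>_def fun_eq_iff)
    qed
    then have \<delta>_g: "\<delta> (g v) = \<delta> v" if "v \<in> B" for v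
      using opp[OF that] opp[of "g v"] inv that \<mu>_in[OF that] by (auto simp: g)
    define z :: "nat \<Rightarrow> int" where "z = (\<lambda>_. 0)"
    define e :: "nat \<Rightarrow> nat \<Rightarrow> int" where "e i = (\<lambda>l. if l = i then 1 else 0)" for i
    have zB: "z \<in> B" using N3 by (fastforce simp: z_def box_def)
    have eB: "e i \<in> B" if "i \<in> J" for i using that N3 by (fastforce simp: e_def box_def)
    have "1 mod H i = 1" if "i \<in> J" for i using H2[OF that] by simp
    then have \<delta>z: "\<delta> z" and \<delta>e: "\<And>i. \<delta> (e i)" by (auto simp: \<delta>_def z_def e_def)
    have gz: "g z i mod H i = t i mod H i" if "i \<in> J" for i
      using that HN by (simp add: g affine_def z_def mod_mod_cancel)
    have ge: "g (e i) l mod H l = ((if l = i then s i else 0) + t l) mod H l" if "l \<in> J" for i l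
      using that HN by (simp add: g affine_def e_def mod_mod_cancel)
    have sH: "s i mod H i \<noteq> 0" if "i \<in> J" for i
      using s[of i] H2[OF that] small_dvd[of "H i" "s i"] by (auto simp: mod_eq_0_iff_dvd)
    have \<delta>gz: "\<delta> (g z)" and \<delta>ge: "\<And>i. i \<in> J \<Longrightarrow> \<delta> (g (e i))"
      using \<delta>_g zB eB \<delta>z \<delta>e by blast+
    \<comment> \<open>If the origin went to the unit vector in direction \<open>j\<close>, the unit
      vector in another direction \<open>i\<close> would go to a point with two nonzero
      coordinates.\<close>
    have t: "t j mod H j = 0" if j: "j \<in> J" for j
    proof (rule ccontr)
      assume "t j mod H j \<noteq> 0"
      then have tj: "t j mod H j = 1" using \<delta>gz gz j by (auto simp: \<delta>_def)
      have "\<not> J \<subseteq> {j}" using J2 card_mono[of "{j}" J] by auto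
      then obtain i where i: "i \<in> J" "i \<noteq> j" by blast
      have "t i mod H i = 0" using \<delta>gz gz i j tj unfolding \<delta>_def by (metis insertE singletonD)
      then have "(s i + t i) mod H i = s i mod H i" by (metis add.right_neutral mod_add_right_eq)
      then have "g (e i) i mod H i = 1"
        using \<delta>ge[OF i(1)] ge[OF i(1), of i] sH[OF i(1)] i(1) by (auto simp: \<delta>_def)
      moreover have "g (e i) j mod H j = 1" using ge[OF j, of i] i tj by simp
      ultimately show False using \<delta>ge[OF i(1)] i j unfolding \<delta>_def by blast
    qed
    have s1: "s i = 1 \<or> H i = 2" if i: "i \<in> J" for i
    proof (rule ccontr)
      assume "\<not> ?thesis"
      then have "s i = -1" "2 < H i" using s[of i] H2[OF i] by auto
      moreover have "(s i + t i) mod H i = s i mod H i" using t[OF i] by (metis add.right_neutral mod_add_right_eq)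
      moreover have "- 1 mod H i = H i - 1" using H2[OF i] by (simp add: zmod_minus1)
      ultimately show False using \<delta>ge[OF i] ge[OF i, of i] i unfolding \<delta>_def by force
    qed
    have others: "s i = 1" "N i dvd t i" if "i \<in> J" "i \<noteq> i0" for i
      using s1[OF that(1)] t[OF that(1)] N3[OF that(1)] that(2) by (auto simp: H_def)
    \<comment> \<open>So far \<open>t i0\<close> is known modulo \<open>h\<close>. The half turn
      would send the origin to its partner, which has the other color.\<close>
    have t0: "N i0 dvd t i0"
    proof (rule ccontr)
      assume "\<not> N i0 dvd t i0"
      moreover have "h dvd t i0" using t[OF i0(1)] by (auto simp: H_def)
      then obtain q where q: "t i0 = h * q" by blast
      ultimately have "odd q" using h by (auto elim!: evenE)
      then obtain r where "q = 2 * r + 1" by (rule oddE)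
      then have "t i0 = h + N i0 * r" using q h by (simp add: algebra_simps)
      then have "g z = \<mu> z"
        using others i0(1) by (auto simp: g affine_def \<mu>_def z_def fun_eq_iff)
      then show False using opp[OF zB] \<delta>z bspec[OF inv zB] by simp
    qed
    \<comment> \<open>The remaining case is a cycle of length 4, where the reflection sends 1 to 3,
      again a bicolored pair of opposite vertices.\<close>
    have s0: "s i0 = 1"
    proof (rule ccontr)
      assume "s i0 \<noteq> 1"
      then have "h = 2" "s i0 = -1" using s1[OF i0(1)] s[of i0] by (auto simp: H_def)
      moreover have "(t i0 - 1) mod 4 = 3" if "4 dvd t i0" using that by presburger
      ultimately have "g (e i0) = \<mu> (e i0)"
        using others i0(1) t0 h by (auto simp: g affine_def \<mu>_def e_def fun_eq_iff)
      then show False using opp[OF eB[OF i0(1)]] \<delta>e bspec[OF inv eB[OF i0(1)]] by simp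
    qed
    have "s i = 1 \<and> N i dvd t i" if "i \<in> J" for i using that others s0 t0 by metis
    then have "(s i * v i + t i) mod N i = v i" if "i \<in> J" for i
      using that v by (auto simp: box_def mod_add_right_eq[symmetric])
    then show "g v = v" using v by (auto simp: g affine_def fun_eq_iff box_def)
  qed (use \<mu>_in \<mu>_\<mu> \<delta>_\<mu> in auto)
  then show ?thesis using \<mu>_ne by blast
qed

end

section \<open>Coordinates and extension by further cycles\<close>

lemma bij_box_pair:
  assumes "i \<noteq> j"
  shows "bij_betw (\<lambda>v. (v i, v j)) (box N {i, j}) ({0..<N i} \<times> {0..<N j})"
  by (rule bij_betw_byWitness[where f' = "\<lambda>(x, y) l. if l = i then x else if l = j then y else 0"])
    (use assms in \<open>auto simp: box_def fun_eq_iff\<close>)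

lemma affines_pair:
  assumes "g \<in> affines N {i, j}"
  shows "\<exists>g'\<in>prod_maps (dihedral (N i)) (dihedral (N j)). \<forall>v. (g v i, g v j) = g' (v i, v j)"
proof -
  obtain s t where g: "g = affine N {i, j} s t" "\<And>l. s l \<in> {1, -1}"
    using assms by (auto simp: affines_def)
  let ?f = "\<lambda>l x. (s l * x + t l) mod N l"
  have "map_prod (?f i) (?f j) \<in> prod_maps (dihedral (N i)) (dihedral (N j))"
    unfolding prod_maps_def using dihedralI[OF g(2)] by blast
  moreover have "(g v i, g v j) = map_prod (?f i) (?f j) (v i, v j)" for v
    by (simp add: g affine_def)
  ultimately show ?thesis by blast
qed

lemma affines_in:
  assumes "\<And>i. i \<in> J \<Longrightarrow> 0 < N i" "g \<in> affines N J"
  shows "g v \<in> box N J"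
  using assms by (fastforce simp: affines_def affine_def box_def)

lemma odd_rigid_box_pair:
  assumes "i \<noteq> j" "0 < N i" "0 < N j"
    and "odd_rigid ({0..<N i} \<times> {0..<N j}) (prod_maps (dihedral (N i)) (dihedral (N j)))"
  shows "odd_rigid (box N {i, j}) (affines N {i, j})"
proof (rule odd_rigid_transport[OF assms(4) bij_box_pair[OF assms(1)]])
  fix g assume g: "g \<in> affines N {i, j}"
  show "g v \<in> box N {i, j}" for v using g by (rule affines_in[rotated]) (use assms in auto)
  show "\<exists>g'\<in>prod_maps (dihedral (N i)) (dihedral (N j)).
      \<forall>v\<in>box N {i, j}. (g v i, g v j) = g' (v i, v j)"
    using affines_pair[OF g] by blast
qed

lemma forces_box_pair:
  assumes "i \<noteq> j" "0 < N i" "0 < N j"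
    and "forces ({0..<N i} \<times> {0..<N j}) (prod_maps (dihedral (N i)) (dihedral (N j))) p"
  shows "forces (box N {i, j}) (affines N {i, j}) p"
proof (rule forces_transport[OF assms(4) bij_box_pair[OF assms(1)]])
  fix g assume g: "g \<in> affines N {i, j}"
  show "g v \<in> box N {i, j}" for v using g by (rule affines_in[rotated]) (use assms in auto)
  show "\<exists>g'\<in>prod_maps (dihedral (N i)) (dihedral (N j)).
      \<forall>v\<in>box N {i, j}. (g v i, g v j) = g' (v i, v j)"
    using affines_pair[OF g] by blast
qed

lemma finite_box:
  assumes "finite J"
  shows "finite (box N J)"
proof -
  have "finite (PiE J (\<lambda>i. {0..<N i}))" using assms by (intro finite_PiE) auto
  moreover have "inj_on (\<lambda>v. restrict v J) (box N J)"
  proof (rule inj_onI)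
    fix u v assume *: "u \<in> box N J" "v \<in> box N J" "restrict u J = restrict v J"
    show "u = v"
    proof
      fix i show "u i = v i"
        using *(1,2) fun_cong[OF *(3), of i] by (cases "i \<in> J") (auto simp: box_def)
    qed
  qed
  moreover have "(\<lambda>v. restrict v J) ` box N J \<subseteq> PiE J (\<lambda>i. {0..<N i})"
    by (auto simp: box_def)
  ultimately show ?thesis by (metis finite_imageD finite_subset)
qed

lemma card_box_ge:
  assumes "finite J" "j \<in> J" "\<And>i. i \<in> J \<Longrightarrow> 0 < N i"
  shows "N j \<le> int (card (box N J))"
proof -
  have "inj_on (\<lambda>x l. if l = j then x else 0) {0..<N j}"
    by (auto simp: inj_on_def fun_eq_iff)
  moreover have "(\<lambda>x l. if l = j then x else 0) ` {0..<N j} \<subseteq> box N J"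
    using assms by (auto simp: box_def)
  ultimately have "card {0..<N j} \<le> card (box N J)"
    using card_inj_on_le finite_box assms(1) by blast
  then show ?thesis by simp
qed

text \<open>Coordinate \<open>i\<close> is split off as the position in a row. The axis in direction
  \<open>j\<close> alone supplies at least \<open>N i\<close> rows.\<close>

lemma odd_rigid_box_insert:
  assumes rig: "odd_rigid (box N J) (affines N J)" and i: "i \<notin> J" and J: "finite J" "j \<in> J" "N i \<le> N j"
    and odd: "\<And>l. l \<in> insert i J \<Longrightarrow> odd (N l) \<and> 3 \<le> N l"
  shows "odd_rigid (box N (insert i J)) (affines N (insert i J))"
proof -
  have pos: "0 < N l" if "l \<in> insert i J" for l using odd[OF that] by simp
  have "odd_rigid ({0..<N i} \<times> box N J) (prod_maps (dihedral (N i)) (affines N J))"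
  proof (rule odd_rigid_Times[OF _ _ finite_box[OF J(1)] _ _ rig])
    show "N i \<le> int (card (box N J))"
      using card_box_ge[of J j N] J pos by force
    show "h y \<in> box N J" if "h \<in> affines N J" for h y
      using that pos by (intro affines_in) auto
  qed (use odd in auto)
  moreover have "bij_betw (\<lambda>v. (v i, v(i := 0))) (box N (insert i J)) ({0..<N i} \<times> box N J)"
    by (rule bij_betw_byWitness[where f' = "\<lambda>(x, v). v(i := x)"])
      (use i in \<open>auto simp: box_def fun_eq_iff split: if_splits\<close>)
  ultimately show ?thesis
  proof (rule odd_rigid_transport)
    fix g assume "g \<in> affines N (insert i J)"
    then show "g v \<in> box N (insert i J)" for v using affines_in pos by blast
    obtain s t where g: "g = affine N (insert i J) s t" "\<And>l. s l \<in> {1, -1}"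
      using \<open>g \<in> _\<close> by (auto simp: affines_def)
    let ?f = "\<lambda>x. (s i * x + t i) mod N i"
    have "map_prod ?f (affine N J s t) \<in> prod_maps (dihedral (N i)) (affines N J)"
      unfolding prod_maps_def affines_def using dihedralI[OF g(2)] g(2) by blast
    moreover have "(g v i, (g v)(i := 0)) = map_prod ?f (affine N J s t) (v i, v(i := 0))" for v
      using i by (auto simp: g affine_def fun_eq_iff)
    ultimately show "\<exists>g'\<in>prod_maps (dihedral (N i)) (affines N J).
        \<forall>v\<in>box N (insert i J). (g v i, (g v)(i := 0)) = g' (v i, v(i := 0))"
      by blast
  qed
qed

text \<open>The starting pair contains the longest cycle \<open>j\<close>, so every further length
  is at most \<open>N j\<close>, as the extension demands. If the longest length is 5, there are
  only two cycles, so the strategy for 3 and 5, given by \<open>forces\<close> alone, never has to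
  be extended.\<close>

lemma forces_odd:
  assumes J: "finite J" "2 \<le> card J" "inj_on N J" and odd: "\<And>i. i \<in> J \<Longrightarrow> odd (N i) \<and> 3 \<le> N i"
  shows "forces (box N J) (affines N J) Gentle"
proof -
  have pos: "0 < N i" if "i \<in> J" for i using odd[OF that] by simp
  have "J \<noteq> {}" using J(2) by auto
  then obtain j where j: "j \<in> J" "\<And>i. i \<in> J \<Longrightarrow> N i \<le> N j"
    using obtains_MAX[OF J(1), of N] Max_ge[of "N ` J"] J(1) by (metis finite_imageI imageI)
  have "\<not> J \<subseteq> {j}" using J(2) card_mono[of "{j}" J] by auto
  then obtain i where i: "i \<in> J" "i \<noteq> j" by blast
  have Nij: "N i < N j" using j(2)[OF i(1)] inj_onD[OF J(3), of i j] i j(1) by force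
  have extend: ?thesis if "odd_rigid (box N {i, j}) (affines N {i, j})"
  proof -
    have "odd_rigid (box N ({i, j} \<union> K)) (affines N ({i, j} \<union> K))"
      if "finite K" "K \<subseteq> J - {i, j}" for K
      using that
    proof (induction K rule: finite_induct)
      case (insert l K)
      have "odd_rigid (box N (insert l ({i, j} \<union> K))) (affines N (insert l ({i, j} \<union> K)))"
        by (rule odd_rigid_box_insert[where j = j]) (use insert i j odd in auto)
      then show ?case by simp
    qed (use that in \<open>simp add: \<open>odd_rigid (box N {i, j}) (affines N {i, j})\<close>\<close>)
    from this[of "J - {i, j}"] have "odd_rigid (box N J) (affines N J)"
      using J(1) i j(1) by (simp add: insert_absorb Un_absorb1)
    then show ?thesis by (rule forces_odd_rigid)
  qed
  consider "9 \<le> N j" | "N j < 9" by linarith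
  then show ?thesis
  proof cases
    case 1
    have "odd_rigid (box N {j, i}) (affines N {j, i})"
      by (rule odd_rigid_box_pair) (use i j pos odd 1 odd_rigid_domino[of "N j" "N i"] in auto)
    then show ?thesis using extend by (simp add: insert_commute)
  next
    case 2
    have "odd (N i)" "odd (N j)" "3 \<le> N i" using odd i j by auto
    then have "N j = 7 \<and> N i = 3 \<or> N j = 7 \<and> N i = 5 \<or> N j = 5 \<and> N i = 3"
      using 2 Nij by presburger
    then consider "N j = 7" "N i = 3" | "N j = 7" "N i = 5" | "N j = 5" "N i = 3" by blast
    then show ?thesis
    proof cases
      case 1
      then show ?thesis
        using odd_rigid_3_7 i by (intro extend odd_rigid_box_pair) simp_all
    next
      case 2
      then show ?thesis
        using odd_rigid_5_7 i by (intro extend odd_rigid_box_pair) simp_all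
    next
      case 3
      have "l = i \<or> l = j" if l: "l \<in> J" for l
      proof -
        have "odd (N l)" "3 \<le> N l" "N l \<le> 5" using odd[OF l] j(2)[OF l] 3 by auto
        then have "N l = N i \<or> N l = N j" using 3 by presburger
        then show ?thesis using inj_onD[OF J(3)] l i(1) j(1) by blast
      qed
      then have "J = {i, j}" using i j(1) by blast
      moreover have "forces (box N {i, j}) (affines N {i, j}) Gentle"
        using forces_3_5 3 i by (intro forces_box_pair) simp_all
      ultimately show ?thesis by simp
    qed
  qed
qed

section \<open>Products of cycles as graphs of lists\<close>

locale cycle_product =
  fixes ns :: "nat list"
  assumes ns2: "2 \<le> length ns" and dist: "distinct ns" and ns3: "\<forall>n\<in>set ns. 3 \<le> n"
begin

abbreviation X where "X \<equiv> cart_prod (map cycle_graph ns)"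

abbreviation J where "J \<equiv> {..<length ns}"

definition N :: "nat \<Rightarrow> int" where "N i = int (ns ! i)"

definition vec :: "nat list \<Rightarrow> nat \<Rightarrow> int" where
  "vec xs = (\<lambda>i. if i < length ns then int (xs ! i) else 0)"

definition unvec :: "(nat \<Rightarrow> int) \<Rightarrow> nat list" where
  "unvec v = map (\<lambda>i. nat (v i)) [0..<length ns]"

sublocale torus N J
  using ns3 by unfold_locales (auto simp: N_def)

lemma inj_N: "inj_on N J"
  using dist by (auto simp: inj_on_def N_def nth_eq_iff_index_eq)

lemma verts_X: "verts X = {xs. length xs = length ns \<and> (\<forall>i<length ns. xs ! i < ns ! i)}"
  by (auto simp: cart_prod_def cycle_graph_def Let_def)

lemma vec_in: "xs \<in> verts X \<Longrightarrow> vec xs \<in> B"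
  by (auto simp: verts_X vec_def box_def N_def)

lemma unvec_in: "v \<in> B \<Longrightarrow> unvec v \<in> verts X"
  by (auto simp: verts_X unvec_def box_def N_def nat_less_iff)

lemma vec_unvec: "v \<in> B \<Longrightarrow> vec (unvec v) = v"
  by (auto simp: vec_def unvec_def box_def fun_eq_iff)

lemma unvec_vec: "xs \<in> verts X \<Longrightarrow> unvec (vec xs) = xs"
  by (auto simp: verts_X vec_def unvec_def intro!: nth_equalityI)

lemma bij_vec: "bij_betw vec (verts X) B"
  by (rule bij_betw_byWitness[where f' = unvec]) (auto simp: vec_in unvec_in vec_unvec unvec_vec)

lemma finite_X: "finite (verts X)"
  using bij_vec finite_box[of J N] bij_betw_finite by blast

lemma nbr_iff:
  assumes "u \<in> B" "v \<in> B"
  shows "nbr u v \<longleftrightarrow> (\<exists>i\<in>J. (v i = (u i + 1) mod N i \<or> u i = (v i + 1) mod N i) \<and>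
     (\<forall>j\<in>J. j \<noteq> i \<longrightarrow> u j = v j))"
proof -
  have coord: "v = move i d u \<longleftrightarrow> v i = (u i + d) mod N i \<and> (\<forall>j\<in>J. j \<noteq> i \<longrightarrow> u j = v j)" if "i \<in> J" for i d
    using that assms by (auto simp: move_def disp_def fun_eq_iff box_def)
  have minus: "v i = (u i + - 1) mod N i \<longleftrightarrow> u i = (v i + 1) mod N i" if i: "i \<in> J" for i
  proof -
    have "u i mod N i = u i" "v i mod N i = v i" using assms i by (auto simp: box_def)
    then show ?thesis
    proof (intro iffI)
      assume *: "v i = (u i + - 1) mod N i"
      have "(v i + 1) mod N i = u i mod N i" unfolding * by (simp add: mod_simps)
      then show "u i = (v i + 1) mod N i" using \<open>u i mod N i = u i\<close> by simp
    next
      assume *: "u i = (v i + 1) mod N i"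
      have "(u i + - 1) mod N i = v i mod N i" unfolding * by (simp add: mod_simps)
      then show "v i = (u i + - 1) mod N i" using \<open>v i mod N i = v i\<close> by simp
    qed
  qed
  have two: "(\<exists>d\<in>{1, -1}. v = move i d u) \<longleftrightarrow> v = move i 1 u \<or> v = move i (- 1) u" for i by simp
  have "(\<exists>d\<in>{1, -1}. v = move i d u) \<longleftrightarrow>
      (v i = (u i + 1) mod N i \<or> u i = (v i + 1) mod N i) \<and> (\<forall>j\<in>J. j \<noteq> i \<longrightarrow> u j = v j)"
    if "i \<in> J" for i
    unfolding two unfolding coord[OF that] minus[OF that] by blast
  then show ?thesis unfolding nbr_def by (rule bex_cong[OF refl])
qed

lemma adj_iff:
  assumes "xs \<in> verts X" "ys \<in> verts X"
  shows "adj X xs ys \<longleftrightarrow> nbr (vec xs) (vec ys)"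
proof -
  have cycle: "adj (map cycle_graph ns ! i) a b \<longleftrightarrow> a < ns ! i \<and> b < ns ! i \<and>
      (b = (a + 1) mod (ns ! i) \<or> a = (b + 1) mod (ns ! i))" if "i < length ns" for i a b
    using that by (simp add: cycle_graph_def)
  have "adj X xs ys \<longleftrightarrow> (\<exists>i<length ns. adj (map cycle_graph ns ! i) (xs ! i) (ys ! i) \<and>
      (\<forall>j<length ns. j \<noteq> i \<longrightarrow> xs ! j = ys ! j))"
    using assms by (simp add: cart_prod_def Let_def)
  also have "\<dots> \<longleftrightarrow> (\<exists>i<length ns. (ys ! i = (xs ! i + 1) mod (ns ! i) \<or> xs ! i = (ys ! i + 1) mod (ns ! i)) \<and>
      (\<forall>j<length ns. j \<noteq> i \<longrightarrow> xs ! j = ys ! j))"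
    by (intro ex_cong1 conj_cong refl) (use cycle assms in \<open>simp add: verts_X\<close>)
  finally have "adj X xs ys \<longleftrightarrow> (\<exists>i<length ns. (ys ! i = (xs ! i + 1) mod (ns ! i) \<or> xs ! i = (ys ! i + 1) mod (ns ! i)) \<and>
      (\<forall>j<length ns. j \<noteq> i \<longrightarrow> xs ! j = ys ! j))" .
  moreover have "int a = (int b + 1) mod N i \<longleftrightarrow> a = (b + 1) mod (ns ! i)" for a b i
    unfolding N_def by (metis of_nat_1 of_nat_add of_nat_eq_iff zmod_int)
  ultimately show ?thesis
    unfolding nbr_iff[OF vec_in[OF assms(1)] vec_in[OF assms(2)]] by (simp add: vec_def Bex_def Ball_def)
qed

lemma automorphism_X:
  assumes "automorphism X f"
  shows "\<exists>g\<in>affines N J. \<forall>xs\<in>verts X. vec (f xs) = g (vec xs)"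
proof -
  have f: "bij_betw f (verts X) (verts X)"
    and adj: "\<And>xs ys. xs \<in> verts X \<Longrightarrow> ys \<in> verts X \<Longrightarrow> adj X (f xs) (f ys) = adj X xs ys"
    using assms unfolding automorphism_def by blast+
  have f_in: "f xs \<in> verts X" if "xs \<in> verts X" for xs using that f by (auto simp: bij_betw_def)
  have "bij_betw unvec B (verts X)"
    by (rule bij_betw_byWitness[where f' = vec]) (auto simp: vec_in unvec_in vec_unvec unvec_vec)
  then have "bij_betw (vec \<circ> (f \<circ> unvec)) B B"
    using f bij_vec by (intro bij_betw_trans)
  moreover have "nbr ((vec \<circ> (f \<circ> unvec)) u) ((vec \<circ> (f \<circ> unvec)) v) \<longleftrightarrow> nbr u v"
    if "u \<in> B" "v \<in> B" for u v
    using that adj[of "unvec u" "unvec v"] adj_iff f_in unvec_in vec_unvec by simp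
  ultimately obtain g where "g \<in> affines N J" "\<And>v. v \<in> B \<Longrightarrow> (vec \<circ> (f \<circ> unvec)) v = g v"
    using automorphism_affine[OF inj_N] by blast
  then show ?thesis using vec_in unvec_vec by force
qed

lemma gentle_wins_X:
  assumes "forces B (affines N J) p"
  shows "gentle_wins X 2 p"
proof (rule gentle_wins_if_forces, rule forces_transport[OF assms bij_vec])
  fix f assume f: "f \<in> {f. automorphism X f}"
  then show "f v \<in> verts X" if "v \<in> verts X" for v
    using that by (auto simp: automorphism_def bij_betw_def)
  show "\<exists>g\<in>affines N J. \<forall>v\<in>verts X. vec (f v) = g (vec v)"
    using f automorphism_X by blast
qed

lemma affine_automorphism:
  assumes s: "\<And>i. i \<in> J \<Longrightarrow> s i \<in> {1, -1}" and t: "\<And>i. i \<in> J \<Longrightarrow> N i dvd s i * t i + t i"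
  defines "\<sigma> \<equiv> \<lambda>xs. unvec (affine N J s t (vec xs))"
  shows "automorphism X \<sigma>" "xs \<in> verts X \<Longrightarrow> \<sigma> (\<sigma> xs) = xs"
    "xs \<in> verts X \<Longrightarrow> vec (\<sigma> xs) = affine N J s t (vec xs)"
proof -
  have \<sigma>_in: "\<sigma> xs \<in> verts X" for xs by (simp add: \<sigma>_def unvec_in)
  have vec_\<sigma>: "vec (\<sigma> xs) = affine N J s t (vec xs)" for xs by (simp add: \<sigma>_def vec_unvec)
  have inv: "affine N J s t (affine N J s t v) = v" if "v \<in> B" for v
  proof (rule affine_involution[OF _ t that])
    show "s i * s i = 1" if "i \<in> J" for i using s[OF that] by auto
  qed
  have \<sigma>_\<sigma>: "\<sigma> (\<sigma> xs) = xs" if "xs \<in> verts X" for xs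
  proof -
    have "\<sigma> (\<sigma> xs) = unvec (affine N J s t (vec (\<sigma> xs)))" by (simp add: \<sigma>_def)
    then show ?thesis using vec_in[OF that] that by (simp add: vec_\<sigma> inv unvec_vec)
  qed
  have "bij_betw \<sigma> (verts X) (verts X)"
    by (rule bij_betw_byWitness[where f' = \<sigma>]) (auto simp: \<sigma>_in \<sigma>_\<sigma>)
  moreover have "adj X (\<sigma> xs) (\<sigma> ys) \<longleftrightarrow> adj X xs ys" if "xs \<in> verts X" "ys \<in> verts X" for xs ys
  proof -
    have nbr: "nbr (affine N J s t u) (affine N J s t v)" if "nbr u v" for u v
      using s that by (rule affine_nbr)
    show ?thesis
      using that nbr[of "vec xs" "vec ys"] nbr[of "vec (\<sigma> xs)" "vec (\<sigma> ys)"] inv vec_in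
      by (auto simp: adj_iff \<sigma>_in vec_\<sigma>)
  qed
  ultimately show "automorphism X \<sigma>" unfolding automorphism_def by blast
  show "xs \<in> verts X \<Longrightarrow> \<sigma> (\<sigma> xs) = xs" "xs \<in> verts X \<Longrightarrow> vec (\<sigma> xs) = affine N J s t (vec xs)"
    using \<sigma>_\<sigma> vec_\<sigma> by blast+
qed

text \<open>One affine involution serves both for copying with any number of colors and for the
  defeat with a single color.\<close>

lemma not_gentle_wins_X:
  assumes s: "\<And>i. i \<in> J \<Longrightarrow> s i \<in> {1, -1}" and t: "\<And>i. i \<in> J \<Longrightarrow> N i dvd s i * t i + t i"
    and unique: "\<And>u v. u \<in> B \<Longrightarrow> v \<in> B \<Longrightarrow> affine N J s t u = u \<Longrightarrow> affine N J s t v = v \<Longrightarrow> u = v"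
    and v0: "v0 \<in> B" "affine N J s t v0 \<noteq> v0"
  shows "p = Rascal \<longleftrightarrow> (\<exists>v\<in>B. affine N J s t v = v) \<Longrightarrow> 1 \<le> d \<Longrightarrow> \<not> gentle_wins X d p"
    and "\<not> gentle_wins X 1 p'"
proof -
  define \<sigma> where "\<sigma> xs = unvec (affine N J s t (vec xs))" for xs
  have \<sigma>: "automorphism X \<sigma>" "\<And>xs. xs \<in> verts X \<Longrightarrow> \<sigma> (\<sigma> xs) = xs"
      "\<And>xs. xs \<in> verts X \<Longrightarrow> vec (\<sigma> xs) = affine N J s t (vec xs)"
    using affine_automorphism[OF s t] by (simp_all add: \<sigma>_def[abs_def])
  have fixed: "\<sigma> xs = xs \<longleftrightarrow> affine N J s t (vec xs) = vec xs" if "xs \<in> verts X" for xs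
    using that \<sigma>(3) unvec_vec vec_in \<sigma>_def by metis
  have nontriv: "unvec v0 \<in> verts X" "\<sigma> (unvec v0) \<noteq> unvec v0"
    using v0 by (auto simp: unvec_in fixed vec_unvec)
  show "\<not> gentle_wins X 1 p'"
    using finite_X \<sigma>(1) nontriv by (rule not_gentle_wins_one_color)
  assume p: "p = Rascal \<longleftrightarrow> (\<exists>v\<in>B. affine N J s t v = v)" and d: "1 \<le> d"
  show "\<not> gentle_wins X d p"
  proof (rule not_gentle_wins_involution[OF finite_X \<sigma>(1,2) _ _ nontriv d])
    fix xs ys assume "xs \<in> verts X" "ys \<in> verts X" "\<sigma> xs = xs" "\<sigma> ys = ys"
    then show "xs = ys" using unique[of "vec xs" "vec ys"] fixed vec_in unvec_vec by metis
  next
    show "p = Rascal \<longleftrightarrow> (\<exists>v\<in>verts X. \<sigma> v = v)"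
      unfolding p using fixed vec_in unvec_in vec_unvec by metis
  qed
qed

section \<open>The game numbers for both parities\<close>

lemma even_case:
  assumes i0: "i0 \<in> J" "even (N i0)"
  shows "D_G X = \<infinity>" "D_R X = 2"
proof -
  obtain h where h: "N i0 = 2 * h" using i0(2) by blast
  then have h2: "2 \<le> h" using N3[OF i0(1)] by simp
  define t where "t i = (if i = i0 then h else 0)" for i
  have ne: "affine N J (\<lambda>_. 1) t v \<noteq> v" if "v \<in> B" for v
  proof
    assume "affine N J (\<lambda>_. 1) t v = v"
    then have "(v i0 + h) mod N i0 = v i0" using i0(1) by (auto simp: affine_def t_def dest: fun_cong[of _ _ i0])
    then have "(v i0 + h) mod N i0 = v i0 mod N i0" using that i0(1) by (simp add: box_def)
    then have "N i0 dvd h" by (simp add: mod_eq_dvd_iff)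
    then show False using h h2 zdvd_imp_le[of "N i0" h] by simp
  qed
  have zB: "(\<lambda>_. 0) \<in> B" using N3 by (fastforce simp: box_def)
  note Rascal = not_gentle_wins_X[of "\<lambda>_. 1" t "\<lambda>_. 0"]
  have "\<not> gentle_wins X d Gentle" if "1 \<le> d" for d
    by (rule Rascal(1)) (use ne zB h that in \<open>auto simp: t_def\<close>)
  then show "D_G X = \<infinity>" by (rule game_number_infinity)
  obtain \<mu> \<delta> where "rigid B (affines N J) \<mu> \<delta>" "\<And>v. v \<in> B \<Longrightarrow> \<mu> v \<noteq> v"
    using rigid_even[OF i0] ns2 by auto
  then have "forces B (affines N J) Rascal" by (intro forces_rigid) auto
  then have "gentle_wins X 2 Rascal" by (rule gentle_wins_X)
  moreover have "\<not> gentle_wins X 1 Rascal"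
    by (rule Rascal(2)) (use ne zB h in \<open>auto simp: t_def\<close>)
  ultimately show "D_R X = 2" by (rule game_number_2)
qed

lemma odd_case:
  assumes odd: "\<And>i. i \<in> J \<Longrightarrow> odd (N i)"
  shows "D_R X = \<infinity>" "D_G X = 2"
proof -
  let ?\<sigma> = "affine N J (\<lambda>_. - 1) (\<lambda>_. 0)"
  have zB: "(\<lambda>_. 0) \<in> B" using N3 by (fastforce simp: box_def)
  have fixed: "?\<sigma> v = v \<longleftrightarrow> v = (\<lambda>_. 0)" if v: "v \<in> B" for v
  proof
    assume eq: "?\<sigma> v = v"
    show "v = (\<lambda>_. 0)"
    proof
      fix i show "v i = 0"
      proof (cases "i \<in> J")
        case True
        then have "(2 * 0 - v i) mod N i = v i" using fun_cong[OF eq, of i] by (simp add: affine_def)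
        then show ?thesis
          using reflect_eq_self_iff[of "N i" "v i" 0] odd[OF True] N3[OF True] v True by (simp add: box_def)
      qed (use v in \<open>simp add: box_def\<close>)
    qed
  qed (auto simp: affine_def)
  \<comment> \<open>A unit vector: a vertex moved by the reflection.\<close>
  define e :: "nat \<Rightarrow> int" where "e i = (if i = 0 then 1 else 0)" for i
  have "0 < length ns" using ns2 by linarith
  then have "0 \<in> J" by (simp only: lessThan_iff)
  have "e i \<in> {0..<N i}" if "i \<in> J" for i
    using N3[OF that] by (cases "i = 0") (simp_all add: e_def)
  moreover have "e i = 0" if "i \<notin> J" for i
    using that \<open>0 \<in> J\<close> by (cases "i = 0") (simp_all add: e_def)
  ultimately have "e \<in> B" unfolding box_def by blast
  moreover have "e \<noteq> (\<lambda>_. 0)" by (auto simp: e_def fun_eq_iff)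
  ultimately have e: "e \<in> B" "?\<sigma> e \<noteq> e" using fixed by blast+
  note Rascal = not_gentle_wins_X[of "\<lambda>_. -1" "\<lambda>_. 0" e]
  have "\<not> gentle_wins X d Rascal" if "1 \<le> d" for d
    by (rule Rascal(1)) (use e zB fixed that in auto)
  then show "D_R X = \<infinity>" by (rule game_number_infinity)
  have "forces B (affines N J) Gentle"
    using odd N3 ns2 inj_N by (intro forces_odd) auto
  then have "gentle_wins X 2 Gentle" by (rule gentle_wins_X)
  moreover have "\<not> gentle_wins X 1 Gentle"
    by (rule Rascal(2)) (use e fixed in auto)
  ultimately show "D_G X = 2" by (rule game_number_2)
qed

end

theorem theorem1p6:
  fixes ns :: "nat list"
  assumes "2 \<le> length ns"
    and "distinct ns"
    and "\<forall>n\<in>set ns. 3 \<le> n"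
  shows "(even (prod_list ns) \<longrightarrow>
            D_G (cart_prod (map cycle_graph ns)) = \<infinity> \<and>
            D_R (cart_prod (map cycle_graph ns)) = 2) \<and>
         (odd (prod_list ns) \<longrightarrow>
            D_R (cart_prod (map cycle_graph ns)) = \<infinity> \<and>
            D_G (cart_prod (map cycle_graph ns)) = 2)"
proof -
  interpret cycle_product ns using assms by unfold_locales
  have "even (prod_list ns) \<longleftrightarrow> (\<exists>n\<in>set ns. even n)" by (induction ns) auto
  also have "\<dots> \<longleftrightarrow> (\<exists>i<length ns. even (ns ! i))" by (metis in_set_conv_nth)
  finally have even_iff: "even (prod_list ns) \<longleftrightarrow> (\<exists>i\<in>J. even (N i))" by (simp add: N_def Bex_def)
  show ?thesis
  proof (cases "even (prod_list ns)")
    case True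
    then obtain i where "i \<in> J" "even (N i)" using even_iff by blast
    then show ?thesis using True even_case by simp
  next
    case False
    then have "odd (N i)" if "i \<in> J" for i using even_iff that by blast
    then show ?thesis using False odd_case by simp
  qed
qed

end
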